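(* Let $p\in\mathbb{N}$ and let $\mathbf{a}=(a_1,\dots,a_p)$, $\mathbf{b}=(b_1,\dots,b_p)$ be complex vectors such that $a_i-a_j\notin\mathbb{Z}$ for $i\ne j$. Let $\psi_p=\sum_{i=1}^p(b_i-a_i)$, and let $g^k_p(n)$ and $h^k_p(n)$ be the coefficients defined in the context. Then, for each nonnegative integer $m$, the following identities hold for all parameter values for which all terms in them are defined: $$\sum_{j=0}^{m}\frac{(-1)^{j}}{j!}\sum_{k=1}^{p}[a_k]_j\,h^k_p(m-j)\,\frac{\prod_{i=1}^p\sin(\pi(b_i-a_k))}{\prod_{i\ne k}\sin(\pi(a_i-a_k))}=0,$$ and, for an arbitrary choice of $s\in\{1,\dots,p\}$, $$\sum_{j=0}^{m}\frac{(-1)^{j}}{(\psi_p)_{m-j}\,j!}\left\{[a_s]_j\,g^s_p(m-j)\sin(\pi\psi_p)-\sum_{k=1}^{p}[a_k]_j\,g^k_p(m-j)\,\frac{\prod_{i=1}^p\sin(\pi(b_i-a_k))}{\prod_{i\ne k}\sin(\pi(a_i-a_k))}\right\}=0.$$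
   Context: Notation: $(x)_n=x(x+1)\cdots(x+n-1)$ is the rising factorial, $[x]_j=x(x-1)\cdots(x-j+1)$ the falling factorial, $(x)_0=[x]_0=1$; $\mathbb{N}_0=\{0,1,2,\dots\}$; $\psi_m=\sum_{i=1}^m(b_i-a_i)$; products $\prod_{i\neq k}$ run over $i\in\{1,\dots,p\}\setminus\{k\}$. Meijer's function $G^{p,0}_{p,p}$: for $0<z<1$, $$G^{p,0}_{p,p}\left(z\,\Big|\,{\mathbf{b}\atop\mathbf{a}}\right)=\frac{1}{2\pi i}\int_{\mathcal{L}_-}\frac{\Gamma(a_1+s)\cdots\Gamma(a_p+s)}{\Gamma(b_1+s)\cdots\Gamma(b_p+s)}z^{-s}\,ds,$$ where $\mathcal{L}_-$ is a left loop lying in a horizontal strip, starting at $-\infty+i\varphi_1$, ending at $-\infty+i\varphi_2$ ($\varphi_1<\varphi_2$), and having all poles of the integrand on its left. Coefficients $g^k_p(n)$ (Nørlund): for $-\psi_p\notin\mathbb{N}_0$ they are defined by the expansion, for $0<z<1$, $$G^{p,0}_{p,p}\left(z\,\Big|\,{\mathbf{b}\atop\mathbf{a}}\right)=\frac{z^{a_k}(1-z)^{\psi_p-1}}{\Gamma(\psi_p)}\sum_{n=0}^{\infty}\frac{g_p^k(n)}{(\psi_p)_n}(1-z)^n.$$ They are polynomials in the parameters, given explicitly (known formula of Nørlund) by $$g^{p}_{p}(n)=\sum_{0\le j_1\le\cdots\le j_{p-2}\le n}\ \prod_{m=1}^{p-1}\frac{(\psi_m+j_{m-1})_{j_m-j_{m-1}}}{(j_m-j_{m-1})!}(b_{m+1}-a_m)_{j_m-j_{m-1}},\qquad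 j_0=0,\ j_{p-1}=n,$$ (for $p=1$: $g^1_1(0)=1$, $g^1_1(n)=0$ for $n\ge1$), and $g^k_p(n)$ is obtained from $g^p_p(n)$ by exchanging the roles of $a_p$ and $a_k$. Coefficients $h^k_p(n)$ (Bühring): for $\psi_p\notin\mathbb{Z}$ (and parameters for which the gamma functions below are finite) they are defined by the unique expansion, for $z\in(0,1)$ near $1$, $$\frac{\prod_{i=1}^p\Gamma(1-b_i+a_k)}{\prod_{i\ne k}\Gamma(1-a_i+a_k)}\;{}_pF_{p-1}\left({1-b_1+a_k,\dots,1-b_p+a_k\atop (1-a_i+a_k)_{i\ne k}};z\right)=(1-z)^{\psi_p-1}\sum_{n=0}^{\infty}f_p^k(n)(1-z)^n+\sum_{n=0}^{\infty}h_p^k(n)(1-z)^n,$$ where ${}_pF_{p-1}$ is the generalized hypergeometric function; for integer $\psi_p$ they are understood by analytic continuation in the parameters (e.g. in $b_1$). For $p\ge2$ and $\Re(1-b_i+a_p+n)>0$, $i=1,\dots,p-2$, one has the known formula of Bühring $$\begin{aligned}h_p^p(n)=&-\frac{\Gamma(\psi_p)\Gamma(1-b_p+a_p+n)\Gamma(1-b_{p-1}+a_p+n)}{(1-\psi_p)_{n+1}\Gamma(\psi_{p-1})\Gamma(\psi_p-b_{p-1}+a_p)\,n!}\sum_{j_{p-2}=0}^{\infty}\frac{(\psi_p-n-1)_{j_{p-2}}}{(\psi_{p-1})_{j_{p-2}}(\psi_p-b_{p-1}+a_p)_{j_{p-2}}}\\&\times\sum_{j_{p-3}=0}^{j_{p-2}}\cdots\sum_{j_1=0}^{j_2}\prod_{m=1}^{p-2}\frac{(\psi_m+j_{m-1})_{j_m-j_{m-1}}}{(j_m-j_{m-1})!}(b_m-a_{m+1})_{j_m-j_{m-1}},\qquad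 j_0=0\end{aligned}$$ (for $p=2$ the summation consists of the single term $j_0=0$), and $h^k_p(n)$ is obtained from $h^p_p(n)$ by exchanging the roles of $a_p$ and $a_k$. *)

theory Defs
  imports "HOL-Complex_Analysis.Complex_Analysis"
begin

text \<open>
  Parameter vectors are functions on \<^typ>\<open>nat\<close> of which only the entries with index in
  \<open>{1..p}\<close> are used.
\<close>

definition falling :: "complex \<Rightarrow> nat \<Rightarrow> complex" where
  "falling x j = (\<Prod>i<j. x - of_nat i)"

definition psi :: "nat \<Rightarrow> (nat \<Rightarrow> complex) \<Rightarrow> (nat \<Rightarrow> complex) \<Rightarrow> complex" where
  "psi m a b = (\<Sum>i=1..m. b i - a i)"


subsection \<open>Meijer's function \<open>G^{p,0}_{p,p}\<close> on \<open>(0,1)\<close>\<close>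

text \<open>Here \<^const>\<open>rGamma\<close> is the entire function \<open>1/\<Gamma>\<close>.\<close>

definition meijer_integrand ::
    "nat \<Rightarrow> (nat \<Rightarrow> complex) \<Rightarrow> (nat \<Rightarrow> complex) \<Rightarrow> real \<Rightarrow> complex \<Rightarrow> complex" where
  "meijer_integrand p a b z s =
     (\<Prod>i=1..p. Gamma (a i + s)) * (\<Prod>i=1..p. rGamma (b i + s)) * of_real z powr (- s)"

text \<open>
  The left loop is rendered by three straight segments: it comes in from \<open>-\<infinity> + i y1\<close> to
  \<open>c + i y1\<close>, goes up to \<open>c + i y2\<close> and returns to \<open>-\<infinity> + i y2\<close>; \<open>left_loop y1 y2 c R\<close> is its
  truncation at real part \<open>-R\<close>. The poles to be enclosed lie among the points \<open>-a_i - n\<close>.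
\<close>

definition left_loop :: "real \<Rightarrow> real \<Rightarrow> real \<Rightarrow> real \<Rightarrow> real \<Rightarrow> complex" where
  "left_loop y1 y2 c R =
     linepath (Complex (- R) y1) (Complex c y1) +++
     linepath (Complex c y1) (Complex c y2) +++
     linepath (Complex c y2) (Complex (- R) y2)"

definition encloses_poles ::
    "nat \<Rightarrow> (nat \<Rightarrow> complex) \<Rightarrow> real \<Rightarrow> real \<Rightarrow> real \<Rightarrow> bool" where
  "encloses_poles p a y1 y2 c \<longleftrightarrow>
     y1 < y2 \<and> (\<forall>i\<in>{1..p}. y1 < Im (- a i) \<and> Im (- a i) < y2 \<and> Re (- a i) < c)"

text \<open>The value of the integral is the same for all admissible loops.\<close>

definition meijer_G :: "nat \<Rightarrow> (nat \<Rightarrow> complex) \<Rightarrow> (nat \<Rightarrow> complex) \<Rightarrow> real \<Rightarrow> complex" where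
  "meijer_G p a b z = (THE I. \<forall>y1 y2 c. encloses_poles p a y1 y2 c \<longrightarrow>
     ((\<lambda>R. 1 / (2 * of_real pi * \<i>) *
           contour_integral (left_loop y1 y2 c R) (meijer_integrand p a b z)) \<longlongrightarrow> I) at_top)"


subsection \<open>Analytic continuation into an isolated point\<close>

definition continues_to :: "(complex \<Rightarrow> complex) \<Rightarrow> complex \<Rightarrow> complex \<Rightarrow> bool" where
  "continues_to f w0 v \<longleftrightarrow>
     (\<exists>\<phi>. \<phi> analytic_on {w0} \<and> (\<forall>\<^sub>F w in at w0. \<phi> w = f w) \<and> \<phi> w0 = v)"

definition continuation :: "(complex \<Rightarrow> complex) \<Rightarrow> complex \<Rightarrow> complex" where
  "continuation f w0 = (THE v. continues_to f w0 v)"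


subsection \<open>Norlund's coefficients\<close>

definition norlund_expansion ::
    "nat \<Rightarrow> (nat \<Rightarrow> complex) \<Rightarrow> (nat \<Rightarrow> complex) \<Rightarrow> nat \<Rightarrow> (nat \<Rightarrow> complex) \<Rightarrow> bool" where
  "norlund_expansion p a b k g \<longleftrightarrow>
     (\<forall>z::real. 0 < z \<and> z < 1 \<longrightarrow>
        summable (\<lambda>n. g n / pochhammer (psi p a b) n * of_real (1 - z) ^ n) \<and>
        meijer_G p a b z =
          of_real z powr a k * of_real (1 - z) powr (psi p a b - 1) / Gamma (psi p a b) *
          (\<Sum>n. g n / pochhammer (psi p a b) n * of_real (1 - z) ^ n))"

definition norlund_g0 ::
    "nat \<Rightarrow> (nat \<Rightarrow> complex) \<Rightarrow> (nat \<Rightarrow> complex) \<Rightarrow> nat \<Rightarrow> nat \<Rightarrow> complex" where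
  "norlund_g0 p a b k = (THE g. norlund_expansion p a b k g)"

text \<open>
  The coefficients are polynomials in the parameters; where the expansion degenerates,
  i.e. for \<open>\<psi>_p \<in> {0, -1, -2, ...}\<close>, their values are obtained by continuation in \<open>b_1\<close>.
\<close>

definition norlund_g ::
    "nat \<Rightarrow> (nat \<Rightarrow> complex) \<Rightarrow> (nat \<Rightarrow> complex) \<Rightarrow> nat \<Rightarrow> nat \<Rightarrow> complex" where
  "norlund_g p a b k n =
     (if psi p a b \<notin> \<int>\<^sub>\<le>\<^sub>0 then norlund_g0 p a b k n
      else continuation (\<lambda>w. norlund_g0 p a (b(1 := w)) k n) (b 1))"


subsection \<open>Buehring's coefficients\<close>

definition buhring_function ::
    "nat \<Rightarrow> (nat \<Rightarrow> complex) \<Rightarrow> (nat \<Rightarrow> complex) \<Rightarrow> nat \<Rightarrow> complex \<Rightarrow> complex" where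
  "buhring_function p a b k z =
     (\<Prod>i=1..p. Gamma (1 - b i + a k)) / (\<Prod>i\<in>{1..p} - {k}. Gamma (1 - a i + a k)) *
     eval_fps (fps_hypergeo (map (\<lambda>i. 1 - b i + a k) [1..<Suc p])
                            (map (\<lambda>i. 1 - a i + a k) (filter (\<lambda>i. i \<noteq> k) [1..<Suc p])) 1) z"

definition buhring_expansion ::
    "nat \<Rightarrow> (nat \<Rightarrow> complex) \<Rightarrow> (nat \<Rightarrow> complex) \<Rightarrow> nat \<Rightarrow>
     (nat \<Rightarrow> complex) \<Rightarrow> (nat \<Rightarrow> complex) \<Rightarrow> bool" where
  "buhring_expansion p a b k f h \<longleftrightarrow>
     (\<forall>\<^sub>F z::real in at_left 1.
        summable (\<lambda>n. f n * of_real (1 - z) ^ n) \<and>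
        summable (\<lambda>n. h n * of_real (1 - z) ^ n) \<and>
        buhring_function p a b k (of_real z) =
          of_real (1 - z) powr (psi p a b - 1) * (\<Sum>n. f n * of_real (1 - z) ^ n) +
          (\<Sum>n. h n * of_real (1 - z) ^ n))"

definition buhring_h0 ::
    "nat \<Rightarrow> (nat \<Rightarrow> complex) \<Rightarrow> (nat \<Rightarrow> complex) \<Rightarrow> nat \<Rightarrow> nat \<Rightarrow> complex" where
  "buhring_h0 p a b k = (THE h. \<exists>f. buhring_expansion p a b k f h)"

definition buhring_h ::
    "nat \<Rightarrow> (nat \<Rightarrow> complex) \<Rightarrow> (nat \<Rightarrow> complex) \<Rightarrow> nat \<Rightarrow> nat \<Rightarrow> complex" where
  "buhring_h p a b k n =
     (if psi p a b \<notin> \<int> then buhring_h0 p a b k n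
      else continuation (\<lambda>w. buhring_h0 p a (b(1 := w)) k n) (b 1))"

text \<open>
  The parameters for which \<^const>\<open>buhring_h\<close> has its intended meaning: the gamma functions in the
  numerator are finite and, if \<open>\<psi>_p\<close> is an integer, the singularity in \<open>b_1\<close> is removable (in
  general the coefficients have poles at integer \<open>\<psi>_p\<close>, where logarithmic terms appear). For
  \<open>\<psi>_p\<close> not an integer the expansion always exists, so nothing else is required.
\<close>

definition buhring_h_defined ::
    "nat \<Rightarrow> (nat \<Rightarrow> complex) \<Rightarrow> (nat \<Rightarrow> complex) \<Rightarrow> nat \<Rightarrow> nat \<Rightarrow> bool" where
  "buhring_h_defined p a b k n \<longleftrightarrow>
     (\<forall>i\<in>{1..p}. 1 - b i + a k \<notin> \<int>\<^sub>\<le>\<^sub>0) \<and>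
     (psi p a b \<in> \<int> \<longrightarrow>
        (\<exists>v. continues_to (\<lambda>w. buhring_h0 p a (b(1 := w)) k n) (b 1) v))"


definition sine_ratio ::
    "nat \<Rightarrow> (nat \<Rightarrow> complex) \<Rightarrow> (nat \<Rightarrow> complex) \<Rightarrow> nat \<Rightarrow> complex" where
  "sine_ratio p a b k =
     (\<Prod>i=1..p. sin (of_real pi * (b i - a k))) /
     (\<Prod>i\<in>{1..p} - {k}. sin (of_real pi * (a i - a k)))"

end

theory Submission
  imports Defs
begin

text \<open>
  By residues, \<open>G^{p,0}_{p,p} = u\<close> with \<open>u = \<Sum>_k c_k z^{a_k} F_k\<close>, where the \<open>z^{a_k} F_k\<close> are the solutions at
  \<open>z = 0\<close> of the hypergeometric equation; up to gamma factors \<open>c_k\<close> is the sine ratio of the theorem.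
  The key fact is that \<open>u\<close> is \<open>(1 - z) powr (\<psi>_p - 1)\<close> times a power series in \<open>1 - z\<close>. For large
  \<open>Re \<psi>_p\<close> let \<open>\<Sum>_k d_k z^{a_k} F_k\<close> be the Frobenius solution at \<open>z = 1\<close> with exponent \<open>\<psi>_p - 1\<close>.
  Its Mellin transform satisfies the recurrence of \<open>\<Prod>_i \<Gamma>(a_i + s) / \<Gamma>(b_i + s)\<close>, and Watson's lemma shows
  that the periodic factor between the two is constant; comparing residues, \<open>d_k\<close> is proportional to
  \<open>c_k\<close>. A contiguity relation in \<open>b_1\<close> then reaches all other values of \<open>\<psi>_p\<close>.

  Consequently \<open>z^{a_s} \<Sum>_n g^s_p(n) (1 - z)^n / (\<psi>_p)_n\<close> does not depend on \<open>s\<close>, and the second identity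
  reduces to \<open>\<Sum>_k sine_ratio_k = sin (\<pi> \<psi>_p)\<close>, which is Lagrange interpolation at the points
  \<open>exp (2 \<pi> i a_k)\<close>. The first identity says that the part of \<open>u\<close> holomorphic at \<open>z = 1\<close> vanishes.
  Exceptional values of \<open>\<psi>_p\<close> follow by continuity in \<open>b_1\<close>.
\<close>

subsection \<open>Uniqueness of generalized power series\<close>

text \<open>The cancellation of the holomorphic parts in \<open>u\<close> is not visible term by
  term, so the connection is read backwards: the solution with exponent psi_p - 1 is singled out at
  z = 1, and only its coefficients at z = 0 are computed. Large Re psi_p makes this possible: the
  coefficients of F_k are O(n^(-Re psi_p)), so y, theta y, ..., theta^(p-1) y extend to z = 1, and
  for the special solution all of them vanish there. These p conditions remove the boundary terms of
  partial integration, and P(theta) y = z Q(theta) y becomes P(-s) T(s) = Q(-s-1) T(s+1) for the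
  Mellin transform T. Evaluated at s = -a_k this relation also yields the coefficients d_k.
  Contiguity runs in the useful direction: u for b_1 is (b_1 - theta) applied to u for b_1 + 1, and
  theta lowers the exponent at z = 1 by one. With coefficients normalised by 1 / Gamma(psi_p + n)
  this step divides by nothing, so it passes through the integers without exception and keeps
  everything holomorphic in b_1.\<close>

lemma vandermonde_zero:
  fixes mu v :: "'i \<Rightarrow> complex"
  assumes "finite I" "inj_on mu I" "\<And>n. (\<Sum>i\<in>I. mu i ^ n * v i) = 0" "k \<in> I"
  shows "v k = 0"
proof -
  have poly0: "(\<Sum>i\<in>I. poly P (mu i) * v i) = 0" for P
  proof -
    have "(\<Sum>i\<in>I. poly P (mu i) * v i) = (\<Sum>i\<in>I. \<Sum>n\<le>degree P. coeff P n * (mu i ^ n * v i))"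
      by (simp add: poly_altdef sum_distrib_right mult.assoc)
    also have "\<dots> = (\<Sum>n\<le>degree P. coeff P n * (\<Sum>i\<in>I. mu i ^ n * v i))"
      by (subst sum.swap) (simp add: sum_distrib_left)
    finally show ?thesis using assms(3) by simp
  qed
  \<comment> \<open>Linear combinations extend the hypothesis from powers to polynomials; this
    polynomial vanishes at every node except \<open>mu k\<close>.\<close>
  define P where "P = (\<Prod>j\<in>I - {k}. [:- mu j, 1:])"
  have P: "poly P x = (\<Prod>j\<in>I - {k}. x - mu j)" for x
    by (simp add: P_def poly_prod)
  have "(\<Sum>i\<in>I. poly P (mu i) * v i) = poly P (mu k) * v k"
  proof (rule sum.remove[OF assms(1,4), THEN trans], simp)
    have "poly P (mu i) = 0" if "i \<in> I - {k}" for i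
      using that assms(1) by (auto simp: P)
    then show "(\<Sum>i\<in>I - {k}. poly P (mu i) * v i) = 0" by (intro sum.neutral) auto
  qed
  then have "poly P (mu k) * v k = 0" using poly0[of P] by simp
  moreover have "poly P (mu k) \<noteq> 0"
    using assms(1,2,4) by (auto simp: P inj_on_def)
  ultimately show ?thesis by simp
qed

text \<open>The value at 0 is left open because the lemma is applied with \<open>z = exp w\<close>,
  which misses 0. Multiplying by \<open>fps_X\<close> makes the function vanish at 0 as
  well.\<close>

lemma fps_eq_0_if_eval_0:
  fixes H :: "complex fps"
  assumes r: "0 < r" "ereal r \<le> fps_conv_radius H"
    and z: "\<And>z. z \<noteq> 0 \<Longrightarrow> norm z < r \<Longrightarrow> eval_fps H z = 0"
  shows "H = 0"
proof -
  have rad: "fps_conv_radius (fps_X * H) > 0"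
    using r fps_conv_radius_mult[of fps_X H]
    by (simp add: min_def split: if_splits) (metis ereal_less(2) less_le_trans)
  have "eval_fps (fps_X * H) z = 0" if "norm z < r" for z
  proof -
    have zr: "ereal (norm z) < fps_conv_radius H" using that r
      by (meson ereal_less_le less_eq_ereal_def less_le_trans ereal_less_eq(3) less_ereal.simps(1))
    have "eval_fps (fps_X * H) z = z * eval_fps H z"
      using zr by (subst eval_fps_mult) auto
    then show ?thesis using z[of z] that by (cases "z = 0") auto
  qed
  then have "eventually (\<lambda>z. eval_fps (fps_X * H) z = eval_fps 0 z) (nhds 0)"
    using r by (auto simp: eventually_nhds_metric intro!: exI[of _ r])
  then have "fps_X * H = 0"
    using rad by (intro eval_fps_eqD) auto
  then show ?thesis by simp
qed

lemma eventually_less_conv_radius: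
  fixes g :: "complex fps"
  assumes "fps_conv_radius g > 0"
  shows "\<forall>\<^sub>F x::real in at_right 0. ereal (norm (complex_of_real x)) < fps_conv_radius g"
proof -
  obtain r where r: "ereal 0 < ereal r" "ereal r < fps_conv_radius g"
    using assms ereal_dense2[of 0 "fps_conv_radius g"] by (auto simp: zero_ereal_def)
  have "eventually (\<lambda>x::real. 0 < x \<and> x < r) (at_right 0)"
    using r by (auto simp: eventually_at_right_field intro: exI[of _ r])
  then show ?thesis by eventually_elim (use r in \<open>auto intro: less_trans[of _ "ereal r"]\<close>)
qed

text \<open>
  Continue analytically through \<open>z = exp w\<close>: the translations \<open>w \<mapsto> w + 2 \<pi> i n\<close> multiply the
  summands by the powers of distinct numbers \<open>exp (2 \<pi> i e_k)\<close>, so each summand vanishes.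
\<close>
lemma generalized_power_series_unique:
  fixes H :: "'i \<Rightarrow> complex fps" and e :: "'i \<Rightarrow> complex"
  assumes fin: "finite I"
    and e: "\<And>i j. i \<in> I \<Longrightarrow> j \<in> I \<Longrightarrow> i \<noteq> j \<Longrightarrow> e i - e j \<notin> \<int>"
    and rad: "\<And>i. i \<in> I \<Longrightarrow> fps_conv_radius (H i) > 0"
    and ev: "\<forall>\<^sub>F x::real in at_right 0. (\<Sum>i\<in>I. of_real x powr e i * eval_fps (H i) (of_real x)) = 0"
    and k: "k \<in> I"
  shows "H k = 0"
proof -
  have "\<forall>\<^sub>F x::real in at_right 0. (\<forall>i\<in>I. ereal (norm (complex_of_real x)) < fps_conv_radius (H i)) \<and>
      (\<Sum>i\<in>I. of_real x powr e i * eval_fps (H i) (of_real x)) = 0"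
    using fin rad by (intro eventually_conj ev eventually_ball_finite ballI eventually_less_conv_radius) auto
  then obtain r2 where r2: "r2 > 0" "\<And>x i. 0 < x \<Longrightarrow> x < r2 \<Longrightarrow> i \<in> I \<Longrightarrow> ereal (norm (complex_of_real x)) < fps_conv_radius (H i)"
    "\<And>x. 0 < x \<Longrightarrow> x < r2 \<Longrightarrow> (\<Sum>i\<in>I. of_real x powr e i * eval_fps (H i) (of_real x)) = 0"
    unfolding eventually_at_right_field by blast
  \<comment> \<open>Staying below \<open>r2\<close> makes \<open>r\<close> itself an admissible
    point in \<open>r2(2)\<close>, so every radius of convergence exceeds \<open>r\<close>.\<close>
  define r where "r = r2 / 2"
  have r: "r > 0" "r < r2" using r2(1) by (auto simp: r_def)
  have radr: "ereal (norm z) < fps_conv_radius (H i)" if "i \<in> I" "norm z < r" for z :: complex and i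
  proof -
    have "ereal (norm z) \<le> ereal (norm (complex_of_real r))" using that r by auto
    then show ?thesis using r2(2)[OF r that(1)] by (rule le_less_trans)
  qed
  \<comment> \<open>\<open>exp\<close> maps this half-plane onto the punctured disc of radius
    \<open>r\<close>. The half-plane is invariant under vertical translations, and on it
    \<open>exp (e i * w)\<close> is a single-valued substitute for the power with exponent
    \<open>e i\<close>.\<close>
  define S where "S = {w. Re w < ln r}"
  define \<Phi> where "\<Phi> i w = exp (e i * w) * eval_fps (H i) (exp w)" for i w
  have expS: "norm (exp w) < r" if "w \<in> S" for w
    using that r by (simp add: S_def) (metis exp_less_cancel_iff exp_ln)
  have S: "open S" "convex S"
    by (auto simp: S_def open_halfspace_Re_lt convex_halfspace_Re_lt)
  have hol: "\<Phi> i holomorphic_on S" if "i \<in> I" for i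
  proof -
    have "(eval_fps (H i) \<circ> exp) holomorphic_on S"
    proof (rule holomorphic_on_compose_gen)
      show "eval_fps (H i) holomorphic_on eball 0 (fps_conv_radius (H i))"
        by (rule holomorphic_on_eval_fps) auto
      show "exp ` S \<subseteq> eball 0 (fps_conv_radius (H i))"
        using expS radr[OF that] by (auto simp: in_eball_iff simp del: norm_exp_eq_Re)
    qed (intro holomorphic_intros)
    then show ?thesis unfolding \<Phi>_def by (intro holomorphic_intros) (simp add: o_def)
  qed
  define U where "U = complex_of_real ` {..<ln r}"
  have sum0: "(\<Sum>i\<in>I. \<Phi> i w) = 0" if "w \<in> S" for w
  proof (rule analytic_continuation[where f = "\<lambda>w. \<Sum>i\<in>I. \<Phi> i w" and S = S and U = U and \<xi> = "of_real (ln r - 1)"])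
    show "(\<lambda>w. \<Sum>i\<in>I. \<Phi> i w) holomorphic_on S" using hol by (intro holomorphic_intros)
    show "open S" "connected S" using S by (auto intro: convex_connected)
    show "U \<subseteq> S" by (auto simp: U_def S_def)
    show "complex_of_real (ln r - 1) \<in> S" by (simp add: S_def)
    have "(ln r - 1) islimpt {..<ln r}"
      by (rule interior_limit_point) (simp add: interior_open)
    then show "complex_of_real (ln r - 1) islimpt U"
      unfolding U_def by (rule islimpt_isCont_image) (auto simp: eventually_at_filter simp del: of_real_diff)
    show "w \<in> S" by fact
    fix z assume "z \<in> U"
    then obtain t where t: "z = of_real t" "t < ln r" by (auto simp: U_def)
    have "exp t < exp (ln r)" using t(2) by (simp only: exp_less_cancel_iff)
    then have et: "0 < exp t" "exp t < r2" using r by auto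
    have "\<Phi> i z = of_real (exp t) powr e i * eval_fps (H i) (of_real (exp t))" for i
    proof -
      have "Ln (complex_of_real (exp t)) = of_real t" by (subst Ln_of_real) auto
      then show ?thesis using t by (simp add: \<Phi>_def powr_def exp_of_real)
    qed
    then show "(\<Sum>i\<in>I. \<Phi> i z) = 0" using r2(3)[OF et] by simp
  qed
  have \<Phi>0: "\<Phi> k w = 0" if w: "w \<in> S" for w
  proof (rule vandermonde_zero[where mu = "\<lambda>i. exp (2 * of_real pi * \<i> * e i)" and I = I])
    show "finite I" "k \<in> I" by fact+
    show "inj_on (\<lambda>i. exp (2 * of_real pi * \<i> * e i)) I"
    proof (rule inj_onI, rule ccontr)
      fix i j assume ij: "i \<in> I" "j \<in> I" "i \<noteq> j"
        "exp (2 * of_real pi * \<i> * e i) = exp (2 * of_real pi * \<i> * e j)"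
      then obtain n :: int where "2 * of_real pi * \<i> * e i = 2 * of_real pi * \<i> * e j + (of_int (2 * n) * of_real pi) * \<i>"
        by (auto simp: exp_eq)
      then have "(2 * of_real pi * \<i>) * (e i - e j) = (2 * of_real pi * \<i>) * of_int n"
        by (simp add: algebra_simps)
      then have "e i - e j = of_int n" by (subst (asm) mult_cancel_left) auto
      then show False using e[OF ij(1-3)] by simp
    qed
    fix n
    have per: "\<Phi> i (w + 2 * of_real pi * \<i> * of_nat n) = exp (2 * of_real pi * \<i> * e i) ^ n * \<Phi> i w" for i
    proof -
      have "exp (w + 2 * of_real pi * \<i> * of_nat n) = exp w"
        using exp_eq[of "w + 2 * of_real pi * \<i> * of_nat n" w]
        by (auto intro!: exI[of _ "int n"])
      then show ?thesis
        by (simp add: \<Phi>_def algebra_simps exp_add flip: exp_of_nat_mult)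
    qed
    have "w + 2 * of_real pi * \<i> * of_nat n \<in> S" using w by (simp add: S_def)
    from sum0[OF this] show "(\<Sum>i\<in>I. exp (2 * of_real pi * \<i> * e i) ^ n * \<Phi> i w) = 0"
      by (simp add: per)
  qed
  show ?thesis
  proof (rule fps_eq_0_if_eval_0[of r])
    show "0 < r" by fact
    show "ereal r \<le> fps_conv_radius (H k)" using r2(2)[OF r k] r by simp
    fix z :: complex assume "z \<noteq> 0" "norm z < r"
    then have "Ln z \<in> S" using r by (simp add: S_def)
    from \<Phi>0[OF this] show "eval_fps (H k) z = 0" using \<open>z \<noteq> 0\<close> by (simp add: \<Phi>_def)
  qed
qed

subsection \<open>The sine ratios\<close>

lemma sin_eq_exp_times:
  "sin (of_real pi * (b - a)) =
     exp (- (\<i> * of_real pi * (b + a))) * (exp (2 * \<i> * of_real pi * b) - exp (2 * \<i> * of_real pi * a)) / (2 * \<i>)"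
  by (simp add: sin_exp_eq algebra_simps flip: exp_add)

text \<open>The products of \<open>B i - x\<close> and of \<open>A i - x\<close> have the same
  leading coefficient, so their difference has degree below \<open>card I\<close> and is
  interpolated by its values at the \<open>A k\<close>, where the second product vanishes. The
  identity is this interpolation formula at x = 0, divided by the product of the
  \<open>A i\<close>.\<close>

lemma lagrange_at_0:
  fixes A B :: "'i \<Rightarrow> complex"
  assumes fin: "finite I" and inj: "inj_on A I" and ne: "I \<noteq> {}" and nz: "\<And>i. i \<in> I \<Longrightarrow> A i \<noteq> 0"
  shows "(\<Sum>k\<in>I. (\<Prod>i\<in>I. B i - A k) / (A k * (\<Prod>i\<in>I-{k}. A i - A k))) = (\<Prod>i\<in>I. B i) / (\<Prod>i\<in>I. A i) - 1"
proof -
  define P where "P c = (\<Prod>i\<in>I. [:c i, -1:])" for c :: "'i \<Rightarrow> complex"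
  define L where "L k = (\<Prod>i\<in>I-{k}. smult (1 / (A i - A k)) [:A i, -1:])" for k
  define R where "R = (\<Sum>k\<in>I. smult (poly (P B) (A k)) (L k))"
  have "degree (\<Prod>i\<in>J. [:c i, -1:]) = card J \<and> coeff (\<Prod>i\<in>J. [:c i, -1:]) (card J) = (-1) ^ card J"
    if "finite J" for c :: "'i \<Rightarrow> complex" and J
    using that
  proof induction
    case (insert x F)
    have "lead_coeff (\<Prod>i\<in>F. [:c i, -1:]) = (-1) ^ card F" using insert by simp
    moreover have "degree ([:c x, -1:] * (\<Prod>i\<in>F. [:c i, -1:])) = Suc (card F)"
      using insert by (subst degree_mult_eq) auto
    ultimately show ?case using insert lead_coeff_mult[of "[:c x, -1:]" "\<Prod>i\<in>F. [:c i, -1:]"]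
      by simp
  qed auto
  then have degP: "degree (P c) = card I" "coeff (P c) (card I) = (-1) ^ card I" for c
    using fin by (simp_all add: P_def)
  have "degree (L k) < card I" if "k \<in> I" for k
  proof -
    have "degree (L k) \<le> (\<Sum>i\<in>I-{k}. degree (smult (1 / (A i - A k)) [:A i, -1:]))"
      unfolding L_def using fin degree_prod_sum_le[of "I-{k}" "\<lambda>i. smult (1 / (A i - A k)) [:A i, -1:]"] by (simp add: o_def)
    also have "\<dots> \<le> (\<Sum>i\<in>I-{k}. 1)" by (intro sum_mono) simp
    also have "\<dots> < card I" using card_Diff1_less[OF fin that] by simp
    finally show ?thesis .
  qed
  then have degR: "degree R < card I" unfolding R_def
    using fin ne by (intro degree_sum_less) (auto intro: le_less_trans[OF degree_smult_le] simp: card_gt_0_iff)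
  have polyL: "poly (L k) x = (\<Prod>i\<in>I-{k}. (A i - x) / (A i - A k))" for k x
    by (simp add: L_def poly_prod diff_divide_distrib)
  have Lk: "poly (L k) (A j) = (if j = k then 1 else 0)" if "j \<in> I" "k \<in> I" for j k
  proof (cases "j = k")
    case True
    have "A i - A k \<noteq> 0" if "i \<in> I - {k}" for i using that inj \<open>k \<in> I\<close> by (auto simp: inj_on_def)
    then show ?thesis using True by (auto simp: polyL intro!: prod.neutral)
  next
    case False
    then show ?thesis using that fin by (auto simp: polyL intro!: bexI[of _ j])
  qed
  have "P B = P A + R"
  proof (rule poly_eqI_degree_lead_coeff[where A = "A ` I" and n = "card I"])
    show "coeff (P B) (card I) = coeff (P A + R) (card I)" using degP degR by (simp add: coeff_eq_0)
    show "degree (P A + R) \<le> card I" using degP degR by (intro degree_add_le) auto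
    fix x assume "x \<in> A ` I"
    then obtain j where j: "j \<in> I" "x = A j" by auto
    have "poly (P A) x = 0" using j fin by (auto simp: P_def poly_prod)
    moreover have "poly R x = poly (P B) x"
      using j fin by (simp add: R_def poly_sum Lk if_distrib cong: if_cong)
    ultimately show "poly (P B) x = poly (P A + R) x" by simp
  qed (use inj degP in \<open>auto simp: card_image\<close>)
  then have "poly (P B) 0 = poly (P A + R) 0" by (simp only:)
  also have "\<dots> = poly (P A) 0 + (\<Sum>k\<in>I. poly (P B) (A k) * poly (L k) 0)"
    by (simp add: R_def poly_sum)
  also have "(\<Sum>k\<in>I. poly (P B) (A k) * poly (L k) 0) =
      (\<Sum>k\<in>I. (\<Prod>i\<in>I. A i) * ((\<Prod>i\<in>I. B i - A k) / (A k * (\<Prod>i\<in>I-{k}. A i - A k))))"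
  proof (rule sum.cong)
    fix k assume k: "k \<in> I"
    have "(\<Prod>i\<in>I. A i) = A k * (\<Prod>i\<in>I-{k}. A i)" using k fin by (simp add: prod.remove)
    then show "poly (P B) (A k) * poly (L k) 0 =
        (\<Prod>i\<in>I. A i) * ((\<Prod>i\<in>I. B i - A k) / (A k * (\<Prod>i\<in>I-{k}. A i - A k)))"
      using nz[OF k] by (simp add: polyL prod_dividef P_def poly_prod)
  qed simp
  finally have "(\<Prod>i\<in>I. B i) = (\<Prod>i\<in>I. A i) + (\<Prod>i\<in>I. A i) *
      (\<Sum>k\<in>I. (\<Prod>i\<in>I. B i - A k) / (A k * (\<Prod>i\<in>I-{k}. A i - A k)))"
    by (simp add: sum_distrib_left P_def poly_prod)
  moreover have "(\<Prod>i\<in>I. A i) \<noteq> 0" using nz fin by simp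
  ultimately show ?thesis by (simp add: field_simps)
qed

lemma sum_sine_ratio:
  assumes p: "p \<ge> 1" and a: "\<And>i j. i \<in> {1..p} \<Longrightarrow> j \<in> {1..p} \<Longrightarrow> i \<noteq> j \<Longrightarrow> a i - a j \<notin> \<int>"
  shows "(\<Sum>k=1..p. sine_ratio p a b k) = sin (of_real pi * psi p a b)"
proof -
  define e where "e x = exp (2 * \<i> * of_real pi * x)" for x :: complex
  define A where "A i = e (a i)" for i
  define B where "B i = e (b i)" for i
  define c where "c x = exp (- (\<i> * of_real pi * x))" for x :: complex
  have c_sum: "(\<Prod>i\<in>X. c (f i)) = c (\<Sum>i\<in>X. f i)" if "finite X" for X and f :: "nat \<Rightarrow> complex"
    using that by (induction X rule: finite_induct) (auto simp: c_def ring_distribs exp_add[symmetric] exp_diff)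
  have e_sum: "(\<Prod>i\<in>X. e (f i)) = e (\<Sum>i\<in>X. f i)" if "finite X" for X and f :: "nat \<Rightarrow> complex"
    using that by (induction X rule: finite_induct) (auto simp: e_def ring_distribs exp_add)
  have sine: "sine_ratio p a b k = c (psi p a b) / (2 * \<i>) *
      ((\<Prod>i=1..p. B i - A k) / (A k * (\<Prod>i\<in>{1..p}-{k}. A i - A k)))" if k: "k \<in> {1..p}" for k
  proof -
    have f1: "(\<Prod>i=1..p. sin (of_real pi * (b i - a k))) =
        c (\<Sum>i=1..p. b i + a k) / (2 * \<i>) ^ p * (\<Prod>i=1..p. B i - A k)"
      unfolding sin_eq_exp_times prod_dividef prod.distrib
      by (simp add: A_def B_def e_def flip: c_sum) (simp add: c_def)
    have f2: "(\<Prod>i\<in>{1..p}-{k}. sin (of_real pi * (a i - a k))) =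
        c (\<Sum>i\<in>{1..p}-{k}. a i + a k) / (2 * \<i>) ^ (p - 1) * (\<Prod>i\<in>{1..p}-{k}. A i - A k)"
      unfolding sin_eq_exp_times prod_dividef prod.distrib using k
      by (simp add: A_def B_def e_def card_Diff_singleton flip: c_sum) (simp add: c_def)
    \<comment> \<open>The exponents of the two prefactors differ by
      \<open>psi p a b + 2 * a k\<close>. The part that depends on \<open>k\<close> becomes
      \<open>1 / A k\<close>, which is the weight occurring in \<open>lagrange_at_0\<close>; the
      rest is common to all summands.\<close>
    have f3: "c (\<Sum>i=1..p. b i + a k) = c (\<Sum>i\<in>{1..p}-{k}. a i + a k) * (c (psi p a b) / A k)"
    proof -
      have "c (x + y + 2 * z) = c y * (c x / e z)" for x y z
        by (simp add: c_def e_def field_simps flip: exp_add exp_diff)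
      moreover have "(\<Sum>i=1..p. b i + a k) = psi p a b + (\<Sum>i\<in>{1..p}-{k}. a i + a k) + 2 * a k"
        using sum.remove[of "{1..p}" k a] k p
        by (simp add: psi_def sum.distrib sum_subtractf card_Diff_singleton of_nat_diff algebra_simps)
      ultimately show ?thesis by (simp add: A_def)
    qed
    have f4: "(2 * \<i>) ^ p = (2 * \<i>) ^ (p - 1) * (2 * \<i>)" using power_minus_mult[of p "2 * \<i>"] p by simp
    have aux: "S1 / S2 = cp / T * (P1 / (Ak * P2))"
      if "S1 = C1 / Tp * P1" "S2 = C2 / Tq * P2" "C1 = C2 * (cp / Ak)" "Tp = Tq * T" "C2 \<noteq> 0" "Tq \<noteq> 0"
      for S1 S2 cp T P1 Ak P2 C1 C2 Tp Tq :: complex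
      using that by simp
    have f5: "c (\<Sum>i\<in>{1..p}-{k}. a i + a k) \<noteq> 0" by (simp add: c_def)
    show ?thesis unfolding sine_ratio_def by (rule aux[OF f1 f2 f3 f4 f5]) simp
  qed
  have inj: "inj_on A {1..p}"
  proof (rule inj_onI, rule ccontr)
    fix i j assume ij: "i \<in> {1..p}" "j \<in> {1..p}" "i \<noteq> j" "A i = A j"
    then obtain n :: int where "2 * \<i> * of_real pi * a i = 2 * \<i> * of_real pi * a j + (of_int (2 * n) * of_real pi) * \<i>"
      by (auto simp: A_def e_def exp_eq)
    then have "(2 * of_real pi * \<i>) * (a i - a j) = (2 * of_real pi * \<i>) * of_int n"
      by (simp add: algebra_simps)
    then have "a i - a j = of_int n" by (subst (asm) mult_cancel_left) auto
    then show False using a[OF ij(1-3)] by simp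
  qed
  have "(\<Sum>k=1..p. sine_ratio p a b k) = c (psi p a b) / (2 * \<i>) *
      (\<Sum>k=1..p. (\<Prod>i=1..p. B i - A k) / (A k * (\<Prod>i\<in>{1..p}-{k}. A i - A k)))"
    by (simp add: sine sum_distrib_left)
  also have "\<dots> = c (psi p a b) / (2 * \<i>) * (e (psi p a b) - 1)"
  proof (subst lagrange_at_0[OF _ inj])
    have "(\<Prod>i=1..p. B i) / (\<Prod>i=1..p. A i) = e (psi p a b)"
      by (simp add: A_def B_def e_sum psi_def sum_subtractf) (simp add: e_def ring_distribs exp_diff)
    then show "c (psi p a b) / (2 * \<i>) * ((\<Prod>i=1..p. B i) / (\<Prod>i=1..p. A i) - 1) =
       c (psi p a b) / (2 * \<i>) * (e (psi p a b) - 1)" by simp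
  qed (use p in \<open>auto simp: A_def e_def\<close>)
  also have "\<dots> = sin (of_real pi * psi p a b)"
    using sin_eq_exp_times[of "psi p a b" 0] by (simp add: c_def e_def)
  finally show ?thesis .
qed

subsection \<open>The hypergeometric equation as a first-order system\<close>

text \<open>Gaussian elimination: a vector with nonzero last coordinate clears that coordinate from
  all the others, to which the induction hypothesis applies.\<close>

lemma linear_dependence:
  fixes v :: "'i \<Rightarrow> nat \<Rightarrow> complex"
  assumes "finite I" "card I > p"
  shows "\<exists>c. (\<exists>i\<in>I. c i \<noteq> 0) \<and> (\<forall>j<p. (\<Sum>i\<in>I. c i * v i j) = 0)"
  using assms
proof (induction p arbitrary: v I)
  case 0
  then have "I \<noteq> {}" by auto
  then show ?case by (intro exI[of _ "\<lambda>_. 1"]) auto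
next
  case (Suc p)
  show ?case
  proof (cases "\<forall>i\<in>I. v i p = 0")
    case True
    obtain c where c: "\<exists>i\<in>I. c i \<noteq> 0" "\<forall>j<p. (\<Sum>i\<in>I. c i * v i j) = 0"
      using Suc.IH[of I v] Suc.prems by auto
    then show ?thesis using True by (intro exI[of _ c]) (auto simp: less_Suc_eq)
  next
    case False
    then obtain k where k: "k \<in> I" "v k p \<noteq> 0" by auto
    define J where "J = I - {k}"
    have J: "finite J" "card J > p" "k \<notin> J" and IJ: "I = insert k J"
      using Suc.prems k by (auto simp: J_def card_Diff_singleton)
    obtain c where c: "\<exists>i\<in>J. c i \<noteq> 0"
      "\<forall>j<p. (\<Sum>i\<in>J. c i * (v i j - v i p / v k p * v k j)) = 0"
      using Suc.IH[of J "\<lambda>i j. v i j - v i p / v k p * v k j"] J by auto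
    define c' where "c' = c(k := - (\<Sum>i\<in>J. c i * v i p) / v k p)"
    have c'J: "(\<Sum>i\<in>J. c' i * v i j) = (\<Sum>i\<in>J. c i * v i j)" for j
      using J by (intro sum.cong) (auto simp: c'_def)
    have "(\<Sum>i\<in>I. c' i * v i j) = 0" if "j < Suc p" for j
    proof (cases "j = p")
      case True
      then show ?thesis using J k c'J[of j] by (simp add: IJ c'_def)
    next
      case False
      then have "(\<Sum>i\<in>J. c i * (v i j - v i p / v k p * v k j)) = 0"
        using that c by auto
      moreover have "(\<Sum>i\<in>J. c i * (v i j - v i p / v k p * v k j)) =
          (\<Sum>i\<in>J. c i * v i j) - (\<Sum>i\<in>J. c i * v i p) / v k p * v k j"
        by (simp add: algebra_simps sum_subtractf sum_distrib_left sum_divide_distrib)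
      ultimately show ?thesis using J k c'J[of j] by (simp add: IJ c'_def)
    qed
    moreover have "\<exists>i\<in>I. c' i \<noteq> 0" using c J by (auto simp: IJ c'_def)
    ultimately show ?thesis by blast
  qed
qed

text \<open>The equation is singular only at 0, 1 and infinity, so local series at 0 and at 1
  converge up to distance 1. A fixed radius closed under the ring operations lets evaluation be done
  by simplification.\<close>

definition on_disc :: "complex fps \<Rightarrow> bool" where
  "on_disc f \<longleftrightarrow> fps_conv_radius f \<ge> 1"

lemma on_disc_less: "on_disc f \<Longrightarrow> norm z < 1 \<Longrightarrow> ereal (norm (z :: complex)) < fps_conv_radius f"
  unfolding on_disc_def by (rule less_le_trans[of _ 1]) auto

lemma on_disc_const [simp, intro]: "on_disc (fps_const c)" and on_disc_X [simp, intro]: "on_disc fps_X"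
  and on_disc_0 [simp, intro]: "on_disc 0" and on_disc_1 [simp, intro]: "on_disc 1"
  by (auto simp: on_disc_def)

lemma on_disc_add [simp, intro]: "on_disc f \<Longrightarrow> on_disc g \<Longrightarrow> on_disc (f + g)"
  and on_disc_diff [simp, intro]: "on_disc f \<Longrightarrow> on_disc g \<Longrightarrow> on_disc (f - g)"
  and on_disc_mult [simp, intro]: "on_disc f \<Longrightarrow> on_disc g \<Longrightarrow> on_disc (f * g)"
  and on_disc_uminus [simp, intro]: "on_disc f \<Longrightarrow> on_disc (- f)"
  and on_disc_deriv [simp, intro]: "on_disc f \<Longrightarrow> on_disc (fps_deriv f)"
  unfolding on_disc_def
  using order_trans[OF _ fps_conv_radius_add[of f g]] order_trans[OF _ fps_conv_radius_diff[of f g]]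
    order_trans[OF _ fps_conv_radius_mult[of f g]] order_trans[OF _ fps_conv_radius_deriv[of f]]
  by auto

lemma on_disc_sum [simp, intro]: "(\<And>i. i \<in> I \<Longrightarrow> on_disc (f i)) \<Longrightarrow> on_disc (\<Sum>i\<in>I. f i)"
  by (induction I rule: infinite_finite_induct) auto

lemma on_disc_pos: "on_disc f \<Longrightarrow> fps_conv_radius f > 0"
  unfolding on_disc_def by (rule less_le_trans[of _ 1]) auto

lemma eval_disc_add [simp]: "on_disc f \<Longrightarrow> on_disc g \<Longrightarrow> norm z < 1 \<Longrightarrow> eval_fps (f + g) z = eval_fps f z + eval_fps g z"
  and eval_disc_diff [simp]: "on_disc f \<Longrightarrow> on_disc g \<Longrightarrow> norm z < 1 \<Longrightarrow> eval_fps (f - g) z = eval_fps f z - eval_fps g z"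
  and eval_disc_mult [simp]: "on_disc f \<Longrightarrow> on_disc g \<Longrightarrow> norm z < 1 \<Longrightarrow> eval_fps (f * g) z = eval_fps f z * eval_fps g z"
  and eval_disc_uminus [simp]: "on_disc f \<Longrightarrow> norm z < 1 \<Longrightarrow> eval_fps (- f) z = - eval_fps f z"
  using on_disc_less[of f z] on_disc_less[of g z]
  by (simp_all add: eval_fps_add eval_fps_diff eval_fps_mult eval_fps_minus)

lemma eval_disc_sum [simp]:
  "(\<And>i. i \<in> I \<Longrightarrow> on_disc (f i)) \<Longrightarrow> norm z < 1 \<Longrightarrow> eval_fps (\<Sum>i\<in>I. f i) z = (\<Sum>i\<in>I. eval_fps (f i) z)"
  by (induction I rule: infinite_finite_induct) auto

lemma eval_disc_deriv [derivative_intros]: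
  assumes "on_disc f" "norm (g z) < 1" "(g has_field_derivative g') (at z)"
  shows "((\<lambda>z. eval_fps f (g z)) has_field_derivative eval_fps (fps_deriv f) (g z) * g') (at z)"
  using DERIV_chain2[OF has_field_derivative_eval_fps[OF on_disc_less[OF assms(1,2)]] assms(3)] .

lemma on_disc_sums: "on_disc f \<Longrightarrow> norm z < 1 \<Longrightarrow> (\<lambda>n. fps_nth f n * z ^ n) sums eval_fps f z"
  by (rule sums_eval_fps) (rule on_disc_less)

text \<open>A ratio test for a majorant. For the vector recurrence at z = 1 only the sum of the
  norms of all components has controlled ratios, not a single component.\<close>

lemma on_disc_growth:
  fixes s c :: "nat \<Rightarrow> real"
  assumes f: "\<And>n. norm (fps_nth f n) \<le> s n"
    and s: "eventually (\<lambda>n. s (Suc n) \<le> c n * s n) sequentially"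
    and c: "c \<longlonglongrightarrow> 1"
  shows "on_disc f"
  unfolding on_disc_def fps_conv_radius_def
proof (rule conv_radius_geI_ex)
  fix r :: real assume r: "0 < r" "ereal r < 1"
  then have r1: "r < 1" by simp
  define q where "q = (1 + r) / 2"
  have q: "q < 1" "r < q" using r1 by (auto simp: q_def)
  have s0: "s n \<ge> 0" for n using f[of n] norm_ge_zero order_trans by blast
  have "(\<lambda>n. c n * r) \<longlonglongrightarrow> 1 * r" by (intro tendsto_intros c)
  then have "eventually (\<lambda>n. c n * r < q) sequentially"
    using q by (intro order_tendstoD(2)) auto
  with s have "eventually (\<lambda>n. norm (s (Suc n) * r ^ Suc n) \<le> q * norm (s n * r ^ n)) sequentially"
  proof eventually_elim
    case (elim n)
    have "s (Suc n) * r ^ Suc n \<le> (c n * s n) * r ^ Suc n"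
      using elim r by (intro mult_right_mono) auto
    also have "\<dots> = (c n * r) * (s n * r ^ n)" by simp
    also have "\<dots> \<le> q * (s n * r ^ n)" using elim s0[of n] r by (intro mult_right_mono) auto
    finally show ?case using s0[of n] s0[of "Suc n"] r by (simp add: abs_mult)
  qed
  then obtain N where "\<And>n. n \<ge> N \<Longrightarrow> norm (s (Suc n) * r ^ Suc n) \<le> q * norm (s n * r ^ n)"
    by (auto simp: eventually_at_top_linorder)
  then have "summable (\<lambda>n. s n * r ^ n)" using q by (intro summable_ratio_test[of q N]) auto
  then have "summable (\<lambda>n. fps_nth f n * of_real r ^ n)"
    by (rule summable_comparison_test') (use f r in \<open>auto simp: norm_mult norm_power intro!: mult_right_mono\<close>)
  then show "\<exists>z. norm z = r \<and> summable (\<lambda>n. fps_nth f n * z ^ n)"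
    using r by (intro exI[of _ "of_real r"]) auto
qed

text \<open>The common domain of the expansions in \<open>z\<close> and in \<open>1 - z\<close>. It
  is convex, and both \<open>z\<close> and \<open>1 - z\<close> have positive real part on it, so
  the principal powers of both are holomorphic there.\<close>

definition lens :: "complex set" where "lens = ball 0 1 \<inter> ball 1 1"

lemma lens_iff: "z \<in> lens \<longleftrightarrow> norm z < 1 \<and> norm (1 - z) < 1"
  by (auto simp: lens_def dist_norm)

lemma open_lens: "open lens" and connected_lens: "connected lens"
  by (auto simp: lens_def intro!: convex_connected convex_Int)

lemma of_real_lens [simp]: "complex_of_real t \<in> lens \<longleftrightarrow> 0 < t \<and> t < 1"
proof -
  have "1 - complex_of_real t = of_real (1 - t)" by simp
  then have "norm (1 - complex_of_real t) = \<bar>1 - t\<bar>" by (metis norm_of_real)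
  then show ?thesis by (auto simp: lens_iff)
qed

lemma lensD:
  assumes "z \<in> lens"
  shows "norm z < 1" "norm (1 - z) < 1" "z \<noteq> 0" "z \<noteq> 1" "Re z > 0" "Re (1 - z) > 0"
    "z \<notin> \<real>\<^sub>\<le>\<^sub>0" "1 - z \<notin> \<real>\<^sub>\<le>\<^sub>0"
proof -
  show *: "norm z < 1" "norm (1 - z) < 1" using assms by (auto simp: lens_iff)
  then show "z \<noteq> 0" "z \<noteq> 1" by auto
  have "Re z < 1" "Re (1 - z) < 1"
    using * complex_Re_le_cmod[of z] complex_Re_le_cmod[of "1 - z"] by linarith+
  then show **: "Re z > 0" "Re (1 - z) > 0" by auto
  then show "z \<notin> \<real>\<^sub>\<le>\<^sub>0" "1 - z \<notin> \<real>\<^sub>\<le>\<^sub>0" by (auto simp: complex_nonpos_Reals_iff)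
qed

lemma higher_deriv_sum:
  assumes "finite I" "\<And>i. i \<in> I \<Longrightarrow> f i holomorphic_on S" "open S" "z \<in> S"
  shows "(deriv ^^ n) (\<lambda>w. \<Sum>i\<in>I. f i w) z = (\<Sum>i\<in>I. (deriv ^^ n) (f i) z)"
  using assms(1,2)
proof (induction I)
  case (insert i I)
  have "(deriv ^^ n) (\<lambda>w. f i w + (\<Sum>i\<in>I. f i w)) z = (deriv ^^ n) (f i) z + (deriv ^^ n) (\<lambda>w. \<Sum>i\<in>I. f i w) z"
    using insert.prems by (intro higher_deriv_add[OF _ _ assms(3,4)] holomorphic_intros) auto
  then show ?case using insert by simp
qed simp

text \<open>Differentiating the system with Leibniz' rule shows by induction that all derivatives of
  all \<open>Y j\<close> vanish at \<open>c\<close>; the identity theorem does the rest.\<close>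

lemma linear_ode_zero:
  fixes Y :: "nat \<Rightarrow> complex \<Rightarrow> complex" and A :: "nat \<Rightarrow> nat \<Rightarrow> complex \<Rightarrow> complex"
  assumes S: "open S" "connected S"
    and A: "\<And>j l. j < p \<Longrightarrow> l < p \<Longrightarrow> A j l holomorphic_on S"
    and Y: "\<And>j z. j < p \<Longrightarrow> z \<in> S \<Longrightarrow> (Y j has_field_derivative (\<Sum>l<p. A j l z * Y l z)) (at z)"
    and c: "c \<in> S" "\<And>j. j < p \<Longrightarrow> Y j c = 0"
    and j: "j < p" and w: "w \<in> S"
  shows "Y j w = 0"
proof -
  have hol: "Y j holomorphic_on S" if "j < p" for j
    using Y[OF that] S(1) by (auto simp: holomorphic_on_open)
  have "\<forall>j<p. (deriv ^^ n) (Y j) c = 0" for n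
  proof (induction n rule: less_induct)
    case (less n)
    show ?case
    proof (cases n)
      case 0
      then show ?thesis using c by simp
    next
      case (Suc m)
      have "(deriv ^^ Suc m) (Y j) c = 0" if j: "j < p" for j
      proof -
        have holA: "(\<lambda>z. A j l z * Y l z) holomorphic_on S" if "l < p" for l
          using A[OF j that] hol[OF that] by (intro holomorphic_intros)
        have "(deriv ^^ Suc m) (Y j) c = (deriv ^^ m) (deriv (Y j)) c"
          by (simp add: funpow_Suc_right del: funpow.simps)
        also have "\<dots> = (deriv ^^ m) (\<lambda>z. \<Sum>l<p. A j l z * Y l z) c"
          using hol[OF j] S c Y[OF j] holA
          by (intro higher_deriv_transform_within_open[of _ S] holomorphic_deriv holomorphic_on_sum)
            (auto intro: DERIV_imp_deriv)
        also have "\<dots> = (\<Sum>l<p. (deriv ^^ m) (\<lambda>z. A j l z * Y l z) c)"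
          using S c holA by (intro higher_deriv_sum[of _ _ S]) auto
        also have "\<dots> = 0"
        proof (intro sum.neutral ballI)
          fix l assume l: "l \<in> {..<p}"
          have "(deriv ^^ i) (Y l) c = 0" if "i \<le> m" for i using less.IH[of i] that l Suc by auto
          then show "(deriv ^^ m) (\<lambda>z. A j l z * Y l z) c = 0"
            using l by (subst higher_deriv_mult[OF A[OF j] hol S(1) c(1)]) auto
        qed
        finally show ?thesis .
      qed
      then show ?thesis using Suc by simp
    qed
  qed
  then show ?thesis
    using holomorphic_fun_eq_0_on_connected[OF hol[OF j] S _ c(1) w] j by blast
qed

text \<open>The coefficient below the leading one is included because its difference for
  \<open>P\<close> and \<open>Q\<close> is the exponent \<open>rho\<close> of the system at z =
  1.\<close>

lemma coeff_prod_monic: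
  fixes c :: "'i \<Rightarrow> complex"
  assumes "finite I"
  shows "degree (\<Prod>i\<in>I. [:c i, 1:]) = card I \<and> coeff (\<Prod>i\<in>I. [:c i, 1:]) (card I) = 1 \<and>
    (card I > 0 \<longrightarrow> coeff (\<Prod>i\<in>I. [:c i, 1:]) (card I - 1) = (\<Sum>i\<in>I. c i))"
  using assms
proof induction
  case (insert x F)
  let ?R = "\<Prod>i\<in>F. [:c i, 1:]"
  have "degree ([:c x, 1:] * ?R) = Suc (card F)"
    using insert by (subst degree_mult_eq) auto
  moreover have "coeff ([:c x, 1:] * ?R) (Suc (card F)) = c x * coeff ?R (Suc (card F)) + coeff ?R (card F)"
    by simp
  moreover have "coeff ?R (Suc (card F)) = 0" using insert by (intro coeff_eq_0) auto
  moreover have "coeff ([:c x, 1:] * ?R) (card F) = c x + (\<Sum>i\<in>F. c i)"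
    using insert by (cases "card F") auto
  ultimately show ?case using insert by simp
qed auto

lemma ratio_tendsto_1: "(\<lambda>n. (c + of_nat n) / (d + of_nat n)) \<longlonglongrightarrow> (1 :: complex)"
proof -
  have *: "(\<lambda>n. (c / of_nat n + 1) / (d / of_nat n + 1)) \<longlonglongrightarrow> (0 + 1) / (0 + (1 :: complex))"
    by (intro tendsto_intros tendsto_divide_0[OF tendsto_const] tendsto_of_nat) auto
  have ev: "eventually (\<lambda>n. (c / of_nat n + 1) / (d / of_nat n + 1) = (c + of_nat n) / (d + of_nat n)) sequentially"
    using eventually_gt_at_top[of 0]
  proof eventually_elim
    case (elim n)
    then have "x / of_nat n + 1 = (x + of_nat n) / of_nat n" for x :: complex by (simp add: field_simps)
    then show ?case using elim by simp
  qed
  show ?thesis using Lim_transform_eventually[OF * ev] by simp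
qed

lemma inverse_norm_tendsto_0: "(\<lambda>n. 1 / norm (of_nat n + (c :: complex))) \<longlonglongrightarrow> 0"
proof -
  have "filterlim (\<lambda>n. of_nat n + c) at_infinity sequentially"
    by (rule tendsto_add_filterlim_at_infinity'[OF tendsto_of_nat tendsto_const])
  then have "(\<lambda>n. inverse (of_nat n + c)) \<longlonglongrightarrow> 0"
    using tendsto_inverse_0 filterlim_compose by blast
  then show ?thesis using tendsto_norm_zero by (fastforce simp: norm_inverse divide_inverse)
qed

section \<open>The hypergeometric equation and spanning sets of solutions\<close>

locale hypergeo =
  fixes p :: nat and a b :: "nat \<Rightarrow> complex"
  assumes p_pos: "p \<ge> 1"
    and a_diff: "\<And>i j. \<lbrakk>i \<in> {1..p}; j \<in> {1..p}; i \<noteq> j\<rbrakk> \<Longrightarrow> a i - a j \<notin> \<int>"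
begin

definition P :: "complex poly" where "P = (\<Prod>i=1..p. [:- a i, 1:])"
definition Q :: "complex poly" where "Q = (\<Prod>i=1..p. [:1 - b i, 1:])"

text \<open>
  The equation \<open>P(\<theta>) y = z Q(\<theta>) y\<close> with \<open>\<theta> = z d/dz\<close>, written as a system for \<open>Y j = \<theta>\<^sup>j y\<close>, \<open>j < p\<close>.
\<close>
definition rhs :: "(nat \<Rightarrow> complex \<Rightarrow> complex) \<Rightarrow> nat \<Rightarrow> complex \<Rightarrow> complex" where
  "rhs Y j z = (if Suc j < p then Y (Suc j) z / z
     else (\<Sum>l<p. (z * coeff Q l - coeff P l) * Y l z) / (z * (1 - z)))"

definition sol :: "(nat \<Rightarrow> complex \<Rightarrow> complex) \<Rightarrow> bool" where
  "sol Y \<longleftrightarrow> (\<forall>j<p. \<forall>z\<in>lens. (Y j has_field_derivative rhs Y j z) (at z))"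

text \<open>The exponent at z = 1 of the last component theta^(p-1) y when y has exponent psi_p - 1,
  since every theta lowers the exponent by one.\<close>

definition rho :: complex where "rho = psi p a b - of_nat p"

lemma poly_P: "poly P x = (\<Prod>i=1..p. x - a i)" and poly_Q: "poly Q x = (\<Prod>i=1..p. x + 1 - b i)"
  by (simp_all add: P_def Q_def poly_prod algebra_simps)

lemma degree_P: "degree P = p" and degree_Q: "degree Q = p"
  and coeff_P_p: "coeff P p = 1" and coeff_Q_p: "coeff Q p = 1"
  using coeff_prod_monic[of "{1..p}" "\<lambda>i. - a i"] coeff_prod_monic[of "{1..p}" "\<lambda>i. 1 - b i"]
  by (simp_all add: P_def Q_def)

lemma rho_eq: "coeff P (p - 1) - coeff Q (p - 1) = rho"
  using coeff_prod_monic[of "{1..p}" "\<lambda>i. - a i"] coeff_prod_monic[of "{1..p}" "\<lambda>i. 1 - b i"] p_pos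
  by (simp add: P_def Q_def rho_def psi_def sum_subtractf sum_negf)

lemma poly_P_altdef: "poly P x = (\<Sum>l<p. coeff P l * x ^ l) + x ^ p"
  and poly_Q_altdef: "poly Q x = (\<Sum>l<p. coeff Q l * x ^ l) + x ^ p"
  using poly_altdef[of P x] poly_altdef[of Q x]
  by (simp_all add: degree_P degree_Q coeff_P_p coeff_Q_p flip: lessThan_Suc_atMost)

lemma sol_zero:
  assumes Y: "sol Y" and z0: "z0 \<in> lens" "\<And>j. j < p \<Longrightarrow> Y j z0 = 0" and j: "j < p" and w: "w \<in> lens"
  shows "Y j w = 0"
proof -
  define A where "A j l z = (if Suc j < p then (if l = Suc j then 1 / z else 0)
    else (z * coeff Q l - coeff P l) / (z * (1 - z)))" for j l and z :: complex
  have eq: "rhs Y j z = (\<Sum>l<p. A j l z * Y l z)" for j z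
    by (auto simp: A_def rhs_def if_distrib[of "\<lambda>x. x * _"] sum_divide_distrib cong: if_cong)
  show ?thesis
  proof (rule linear_ode_zero[where A = A and S = lens and p = p and Y = Y and c = z0])
    fix j l show "A j l holomorphic_on lens"
      unfolding A_def by (cases "Suc j < p"; cases "l = Suc j") (auto intro!: holomorphic_intros dest: lensD)
  qed (use assms open_lens connected_lens in \<open>auto simp: sol_def eq\<close>)
qed

lemma sol_sum:
  assumes "finite I" "\<And>i. i \<in> I \<Longrightarrow> sol (Ys i)"
  shows "sol (\<lambda>j z. \<Sum>i\<in>I. c i * Ys i j z)"
  unfolding sol_def
proof (intro allI impI ballI)
  fix j z assume jz: "j < p" "z \<in> lens"
  have "((\<lambda>z. \<Sum>i\<in>I. c i * Ys i j z) has_field_derivative (\<Sum>i\<in>I. c i * rhs (Ys i) j z)) (at z)"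
    using assms jz by (intro DERIV_sum DERIV_cmult) (auto simp: sol_def)
  moreover have "(\<Sum>i\<in>I. c i * rhs (Ys i) j z) = rhs (\<lambda>j z. \<Sum>i\<in>I. c i * Ys i j z) j z"
  proof (cases "Suc j < p")
    case False
    have "(\<Sum>i\<in>I. c i * (\<Sum>l<p. (z * coeff Q l - coeff P l) * Ys i l z)) =
      (\<Sum>l<p. (z * coeff Q l - coeff P l) * (\<Sum>i\<in>I. c i * Ys i l z))"
      unfolding sum_distrib_left by (subst sum.swap) (simp add: algebra_simps)
    then show ?thesis using False by (simp add: rhs_def sum_divide_distrib[symmetric])
  qed (simp add: rhs_def sum_divide_distrib)
  ultimately show "((\<lambda>z. \<Sum>i\<in>I. c i * Ys i j z) has_field_derivative rhs (\<lambda>j z. \<Sum>i\<in>I. c i * Ys i j z) j z) (at z)"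
    by simp
qed

text \<open>At one point the p + 1 value vectors of \<open>Z\<close> and the \<open>Ys i\<close> are
  linearly dependent, and by \<open>sol_zero\<close> this dependence persists on
  \<open>lens\<close>. Independence of the \<open>Ys i\<close> forces the coefficient of
  \<open>Z\<close> to be nonzero.\<close>

lemma sol_span:
  fixes Ys :: "'i \<Rightarrow> nat \<Rightarrow> complex \<Rightarrow> complex"
  assumes I: "finite I" "card I = p" and Ys: "\<And>i. i \<in> I \<Longrightarrow> sol (Ys i)"
    and indep: "\<And>c. (\<And>j z. j < p \<Longrightarrow> z \<in> lens \<Longrightarrow> (\<Sum>i\<in>I. c i * Ys i j z) = 0) \<Longrightarrow> (\<forall>i\<in>I. c i = 0)"
    and Z: "sol Z"
  shows "\<exists>d. \<forall>j<p. \<forall>z\<in>lens. Z j z = (\<Sum>i\<in>I. d i * Ys i j z)"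
proof -
  define W where "W x = (case x of None \<Rightarrow> Z | Some i \<Rightarrow> Ys i)" for x
  define z0 :: complex where "z0 = of_real (1/2)"
  have z0: "z0 \<in> lens" unfolding z0_def of_real_lens by simp
  let ?J = "insert None (Some ` I)"
  have J: "finite ?J" "card ?J > p" using I by (auto simp: card_image)
  obtain c where c: "\<exists>x\<in>?J. c x \<noteq> 0" "\<forall>j<p. (\<Sum>x\<in>?J. c x * W x j z0) = 0"
    using linear_dependence[OF J, of "\<lambda>x j. W x j z0"] by blast
  have solW: "sol (\<lambda>j z. \<Sum>x\<in>?J. c x * W x j z)"
    using J Ys Z by (intro sol_sum) (auto simp: W_def)
  have split: "(\<Sum>x\<in>?J. c x * W x j z) = c None * Z j z + (\<Sum>i\<in>I. c (Some i) * Ys i j z)" for j z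
    using I by (simp add: sum.reindex W_def)
  have 0: "c None * Z j z + (\<Sum>i\<in>I. c (Some i) * Ys i j z) = 0" if "j < p" "z \<in> lens" for j z
    using sol_zero[OF solW z0 _ that] c(2) unfolding split by auto
  have "c None \<noteq> 0"
  proof
    assume "c None = 0"
    then have "\<forall>i\<in>I. c (Some i) = 0" using 0 indep[of "\<lambda>i. c (Some i)"] by simp
    then show False using c(1) \<open>c None = 0\<close> by auto
  qed
  then have *: "Z j z = (\<Sum>i\<in>I. (- c (Some i) / c None) * Ys i j z)" if "j < p" "z \<in> lens" for j z
    using 0[OF that] by (simp add: field_simps sum_divide_distrib[symmetric] sum_negf eq_neg_iff_add_eq_0)
  show ?thesis by (intro exI[of _ "\<lambda>i. - c (Some i) / c None"]) (use * in simp)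
qed

text \<open>Taylor coefficients of the function pFp-1 belonging to \<open>a k\<close>: the factor
  \<open>i = k\<close> of the denominator is \<open>pochhammer 1 n\<close>, that is n!.\<close>

definition F :: "nat \<Rightarrow> nat \<Rightarrow> complex" where
  "F k n = (\<Prod>i=1..p. pochhammer (1 - b i + a k) n / pochhammer (1 - a i + a k) n)"

text \<open>\<open>z powr a k\<close> times \<open>G k j\<close> is theta^j applied to the solution
  with exponent \<open>a k\<close>, because theta (z^a g) = z^a (a g + z g').\<close>

primrec G :: "nat \<Rightarrow> nat \<Rightarrow> complex fps" where
  "G k 0 = Abs_fps (F k)"
| "G k (Suc j) = fps_const (a k) * G k j + fps_X * fps_deriv (G k j)"

definition Y0 :: "nat \<Rightarrow> nat \<Rightarrow> complex \<Rightarrow> complex" where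
  "Y0 k j z = z powr a k * eval_fps (G k j) z"

lemma a_add_nat_not_0:
  assumes "i \<in> {1..p}" "k \<in> {1..p}"
  shows "1 - a i + a k + of_nat n \<noteq> 0"
proof
  assume *: "1 - a i + a k + of_nat n = 0"
  then have "a i - a k = of_nat (Suc n)" by (simp add: algebra_simps)
  then have "a i - a k \<in> \<int>" by (metis Ints_of_nat)
  then have "i = k" using a_diff[OF assms] by auto
  then have "of_nat (Suc n) = (0 :: complex)" using * by simp
  then show False by (subst (asm) of_nat_eq_0_iff) simp
qed

lemma F_Suc':
  "F k (Suc n) = F k n * (\<Prod>i=1..p. ((1 - b i + a k) + of_nat n) / ((1 - a i + a k) + of_nat n))"
  by (simp add: F_def pochhammer_Suc flip: prod.distrib)

text \<open>The coefficient form of P(theta) y = z Q(theta) y for the solution with exponent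
  \<open>a k\<close>.\<close>

lemma F_Suc:
  assumes k: "k \<in> {1..p}"
  shows "poly P (a k + of_nat (Suc n)) * F k (Suc n) = poly Q (a k + of_nat n) * F k n"
    "poly P (a k + of_nat (Suc n)) \<noteq> 0"
proof -
  have P: "poly P (a k + of_nat (Suc n)) = (\<Prod>i=1..p. 1 - a i + a k + of_nat n)"
    by (simp add: poly_P algebra_simps)
  show nz: "poly P (a k + of_nat (Suc n)) \<noteq> 0" unfolding P using a_add_nat_not_0[OF _ k] by auto
  have "F k (Suc n) = F k n * (\<Prod>i=1..p. (1 - b i + a k + of_nat n) / (1 - a i + a k + of_nat n))"
    by (rule F_Suc')
  also have "(\<Prod>i=1..p. (1 - b i + a k + of_nat n) / (1 - a i + a k + of_nat n)) =
      poly Q (a k + of_nat n) / poly P (a k + of_nat (Suc n))"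
    unfolding P poly_Q prod_dividef by (simp add: algebra_simps)
  finally show "poly P (a k + of_nat (Suc n)) * F k (Suc n) = poly Q (a k + of_nat n) * F k n"
    using nz by simp
qed

lemma P_a [simp]: "k \<in> {1..p} \<Longrightarrow> poly P (a k) = 0"
  by (auto simp: poly_P)

lemma F_0 [simp]: "F k 0 = 1" by (simp add: F_def)

lemma on_disc_F: "k \<in> {1..p} \<Longrightarrow> on_disc (Abs_fps (F k))"
proof (rule on_disc_growth[where s = "\<lambda>n. norm (F k n)" and c = "\<lambda>n. norm (\<Prod>i=1..p. ((1 - b i + a k) + of_nat n) / ((1 - a i + a k) + of_nat n))"])
  have "(\<lambda>n. norm (\<Prod>i=1..p. ((1 - b i + a k) + of_nat n) / ((1 - a i + a k) + of_nat n))) \<longlonglongrightarrow> norm (\<Prod>i=1..p. 1 :: complex)"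
    by (intro tendsto_intros ratio_tendsto_1)
  then show "(\<lambda>n. norm (\<Prod>i=1..p. ((1 - b i + a k) + of_nat n) / ((1 - a i + a k) + of_nat n))) \<longlonglongrightarrow> 1" by simp
  show "eventually (\<lambda>n. norm (F k (Suc n)) \<le> norm (\<Prod>i=1..p. ((1 - b i + a k) + of_nat n) / ((1 - a i + a k) + of_nat n)) * norm (F k n)) sequentially"
    unfolding F_Suc' norm_mult by (simp add: mult.commute)
qed auto

lemma on_disc_G [simp, intro]: "k \<in> {1..p} \<Longrightarrow> on_disc (G k j)"
  by (induction j) (auto simp: on_disc_F)

lemma G_nth: "fps_nth (G k j) n = (a k + of_nat n) ^ j * F k n"
  by (induction j arbitrary: n) (auto simp: algebra_simps split: nat.splits)

text \<open>The last row of the system with the power of z stripped off, the monic terms of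
  \<open>P\<close> and \<open>Q\<close> being collected on the left. The constant term is the
  indicial equation \<open>poly P (a k) = 0\<close>; the others are \<open>F_Suc\<close>.\<close>

lemma G_p:
  assumes k: "k \<in> {1..p}"
  shows "(1 - fps_X) * G k p = (\<Sum>l<p. (fps_const (coeff Q l) * fps_X - fps_const (coeff P l)) * G k l)"
proof (rule fps_ext)
  fix n
  show "fps_nth ((1 - fps_X) * G k p) n =
    fps_nth (\<Sum>l<p. (fps_const (coeff Q l) * fps_X - fps_const (coeff P l)) * G k l) n"
  proof (cases n)
    case 0
    have "(\<Sum>l<p. coeff P l * a k ^ l) = - (a k ^ p)" using P_a[OF k] poly_P_altdef[of "a k"]
      by (simp add: eq_neg_iff_add_eq_0)
    then show ?thesis using 0 by (simp add: fps_sum_nth G_nth ring_distribs sum_negf mult.assoc)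
  next
    case (Suc m)
    let ?x = "a k + of_nat m" and ?y = "a k + of_nat (Suc m)"
    have "fps_nth (\<Sum>l<p. (fps_const (coeff Q l) * fps_X - fps_const (coeff P l)) * G k l) n =
       (\<Sum>l<p. coeff Q l * (?x ^ l * F k m) - coeff P l * (?y ^ l * F k (Suc m)))"
      using Suc by (simp add: fps_sum_nth G_nth left_diff_distrib mult.assoc)
    also have "\<dots> = (poly Q ?x - ?x ^ p) * F k m - (poly P ?y - ?y ^ p) * F k (Suc m)"
      by (simp add: poly_P_altdef poly_Q_altdef sum_subtractf sum_distrib_right mult.assoc)
    also have "\<dots> = ?y ^ p * F k (Suc m) - ?x ^ p * F k m"
      using F_Suc(1)[OF k, of m] by (simp add: algebra_simps)
    also have "\<dots> = fps_nth ((1 - fps_X) * G k p) n"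
      using Suc by (simp add: left_diff_distrib G_nth)
    finally show ?thesis ..
  qed
qed

lemma Y0_deriv:
  assumes "k \<in> {1..p}" "z \<in> lens"
  shows "(Y0 k j has_field_derivative Y0 k (Suc j) z / z) (at z)"
proof -
  note z = lensD[OF assms(2)]
  have "((\<lambda>z. z powr a k) has_field_derivative a k * z powr (a k - 1)) (at z)"
    using z by (auto intro!: derivative_eq_intros)
  moreover have "((\<lambda>z. eval_fps (G k j) z) has_field_derivative eval_fps (fps_deriv (G k j)) z * 1) (at z)"
    using z assms by (intro eval_disc_deriv on_disc_G) auto
  ultimately have "((\<lambda>z. z powr a k * eval_fps (G k j) z) has_field_derivative
      a k * z powr (a k - 1) * eval_fps (G k j) z + eval_fps (fps_deriv (G k j)) z * 1 * z powr a k) (at z)"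
    by (rule DERIV_mult)
  moreover have "z powr (a k - 1) = z powr a k / z" using z by (simp add: powr_diff)
  ultimately show ?thesis using z assms unfolding Y0_def
    by (simp add: field_simps)
qed

lemma sol_Y0:
  assumes k: "k \<in> {1..p}"
  shows "sol (Y0 k)"
  unfolding sol_def
proof (intro allI impI ballI)
  fix j z assume jz: "j < p" "z \<in> lens"
  note z = lensD[OF jz(2)]
  have "Y0 k (Suc j) z / z = rhs (Y0 k) j z"
  proof (cases "Suc j < p")
    case False
    then have "Suc j = p" using jz by simp
    have "eval_fps ((1 - fps_X) * G k p) z =
      eval_fps (\<Sum>l<p. (fps_const (coeff Q l) * fps_X - fps_const (coeff P l)) * G k l) z"
      by (simp only: G_p[OF k])
    then have "(1 - z) * eval_fps (G k p) z = (\<Sum>l<p. (coeff Q l * z - coeff P l) * eval_fps (G k l) z)"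
      using z k by simp
    then have "z powr a k * ((1 - z) * eval_fps (G k p) z) =
        (\<Sum>l<p. z powr a k * ((coeff Q l * z - coeff P l) * eval_fps (G k l) z))"
      by (simp only: sum_distrib_left)
    then have "(1 - z) * Y0 k p z = (\<Sum>l<p. (z * coeff Q l - coeff P l) * Y0 k l z)"
      by (simp add: Y0_def mult_ac)
    then have "Y0 k p z = (\<Sum>l<p. (z * coeff Q l - coeff P l) * Y0 k l z) / (1 - z)"
      using z by (simp add: eq_divide_eq mult.commute)
    then show ?thesis unfolding rhs_def \<open>Suc j = p\<close> by (simp add: divide_divide_eq_left mult.commute)
  qed (simp add: rhs_def)
  then show "(Y0 k j has_field_derivative rhs (Y0 k) j z) (at z)"
    using Y0_deriv[OF k jz(2), of j] by simp
qed

lemma Y0_indep: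
  assumes c: "\<And>z. z \<in> lens \<Longrightarrow> (\<Sum>k=1..p. c k * Y0 k 0 z) = 0" and k: "k \<in> {1..p}"
  shows "c k = 0"
proof -
  have "fps_const (c k) * G k 0 = 0"
  proof (rule generalized_power_series_unique[where I = "{1..p}" and e = a and H = "\<lambda>k. fps_const (c k) * G k 0"])
    show "\<forall>\<^sub>F x::real in at_right 0. (\<Sum>i=1..p. of_real x powr a i * eval_fps (fps_const (c i) * G i 0) (of_real x)) = 0"
      unfolding eventually_at_right_field
    proof (intro exI[of _ 1] conjI allI impI)
      fix x :: real assume x: "0 < x" "x < 1"
      have "(\<Sum>i=1..p. of_real x powr a i * eval_fps (fps_const (c i) * G i 0) (of_real x)) = (\<Sum>k=1..p. c k * Y0 k 0 (of_real x))"
        using x by (intro sum.cong) (auto simp: Y0_def on_disc_F)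
      then show "(\<Sum>i=1..p. of_real x powr a i * eval_fps (fps_const (c i) * G i 0) (of_real x)) = 0"
        using c[of "of_real x"] x by simp
    qed auto
    fix i assume "i \<in> {1..p}"
    then show "fps_conv_radius (fps_const (c i) * G i 0) > 0" by (intro on_disc_pos on_disc_mult on_disc_const on_disc_G)
  qed (use a_diff k in auto)
  then have "fps_nth (fps_const (c k) * G k 0) 0 = 0" by (simp only: fps_zero_nth)
  then show ?thesis by simp
qed

text \<open>
  In terms of \<open>x = 1 - z\<close> the system reads \<open>x (1 - x) dY/dx = (B\<^sub>0 + x B\<^sub>1) Y\<close>, which gives a two-term
  recurrence for the coefficient vectors of the solutions \<open>x\<^sup>s \<Sum>_n (frob s v n) x\<^sup>n\<close>.
\<close>
definition frob_step :: "complex \<Rightarrow> nat \<Rightarrow> (nat \<Rightarrow> complex) \<Rightarrow> nat \<Rightarrow> complex" where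
  "frob_step s n v j = ((of_nat n + s) * v j - v (Suc j)) / (of_nat n + 1 + s)"

text \<open>The last component is determined after the others because its equation contains their
  new values. Its own new value appears there with coefficient \<open>rho\<close> by
  \<open>rho_eq\<close>, hence the shifted divisor.\<close>

primrec frob :: "complex \<Rightarrow> (nat \<Rightarrow> complex) \<Rightarrow> nat \<Rightarrow> nat \<Rightarrow> complex" where
  "frob s v 0 = v"
| "frob s v (Suc n) = (\<lambda>j. if Suc j < p then frob_step s n (frob s v n) j
     else ((\<Sum>l<p - 1. (coeff P l - coeff Q l) * frob_step s n (frob s v n) l)
        + (of_nat n + s) * frob s v n (p - 1) + (\<Sum>l<p. coeff Q l * frob s v n l)) / (of_nat n + 1 + s - rho))"

definition X1 :: "complex \<Rightarrow> (nat \<Rightarrow> complex) \<Rightarrow> nat \<Rightarrow> complex fps" where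
  "X1 s v j = Abs_fps (\<lambda>n. frob s v n j)"

definition Y1 :: "complex \<Rightarrow> (nat \<Rightarrow> complex) \<Rightarrow> nat \<Rightarrow> complex \<Rightarrow> complex" where
  "Y1 s v j z = (1 - z) powr s * eval_fps (X1 s v j) (1 - z)"

text \<open>The second and third conditions say that \<open>v\<close> satisfies B_0 v = s v, the
  indicial equation at x = 0; the first one excludes resonance at all later steps.\<close>

definition frob_start :: "complex \<Rightarrow> (nat \<Rightarrow> complex) \<Rightarrow> bool" where
  "frob_start s v \<longleftrightarrow> (\<forall>n. of_nat n + 1 + s \<noteq> 0 \<and> of_nat n + 1 + s - rho \<noteq> 0) \<and>
     (\<forall>j. Suc j < p \<longrightarrow> s * v j = 0) \<and> (\<Sum>l<p. (coeff P l - coeff Q l) * v l) = s * v (p - 1)"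

text \<open>Every new component is the old one plus a correction divided by a quantity growing like
  n. Hence the sum \<open>S\<close> of all norms grows by factors \<open>c n\<close> that tend to
  1.\<close>

lemma on_disc_X1:
  assumes "frob_start s v" "j < p"
  shows "on_disc (X1 s v j)"
proof -
  define S where "S n = (\<Sum>l<p. norm (frob s v n l))" for n
  define R where "R = (\<Sum>l<p - 1. norm (coeff P l - coeff Q l))"
  define B where "B = (\<Sum>l<p. norm (coeff Q l))"
  define e1 where "e1 n = 1 / norm (of_nat n + (1 + s))" for n
  define e2 where "e2 n = 1 / norm (of_nat n + (1 + s - rho))" for n
  define c where "c n = 1 + real p * (2 * e1 n) + e2 n * (R * (1 + 2 * e1 n) + norm (rho - 1) + B)" for n
  have nz: "of_nat n + 1 + s \<noteq> 0" "of_nat n + 1 + s - rho \<noteq> 0" for n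
    using assms by (auto simp: frob_start_def)
  have S0: "S n \<ge> 0" and e0: "e1 n \<ge> 0" "e2 n \<ge> 0" for n by (auto simp: S_def e1_def e2_def intro!: sum_nonneg)
  have le: "norm (frob s v n l) \<le> S n" if "l < p" for n l
    unfolding S_def using that by (intro member_le_sum) auto
  have step: "norm (frob_step s n (frob s v n) l) \<le> norm (frob s v n l) + 2 * e1 n * S n" if "Suc l < p" for n l
  proof -
    have "frob_step s n (frob s v n) l = frob s v n l - (frob s v n l + frob s v n (Suc l)) / (of_nat n + 1 + s)"
      using nz(1)[of n] by (simp add: frob_step_def field_simps)
    also have "norm \<dots> \<le> norm (frob s v n l) + norm ((frob s v n l + frob s v n (Suc l)) / (of_nat n + 1 + s))"
      by (rule norm_triangle_ineq4)
    also have "norm ((frob s v n l + frob s v n (Suc l)) / (of_nat n + 1 + s)) = norm (frob s v n l + frob s v n (Suc l)) * e1 n"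
      by (simp add: norm_divide e1_def add.assoc)
    also have "\<dots> \<le> (S n + S n) * e1 n"
      using le[of l n] le[of "Suc l" n] that norm_triangle_ineq[of "frob s v n l" "frob s v n (Suc l)"] e0
      by (intro mult_right_mono) auto
    finally show ?thesis by (simp add: algebra_simps)
  qed
  have last: "norm (frob s v (Suc n) (p - 1)) \<le> norm (frob s v n (p - 1)) + e2 n * (R * (1 + 2 * e1 n) + norm (rho - 1) + B) * S n" for n
  proof -
    let ?A = "\<Sum>l<p - 1. (coeff P l - coeff Q l) * frob_step s n (frob s v n) l"
    let ?B = "\<Sum>l<p. coeff Q l * frob s v n l"
    have "norm ?A \<le> (\<Sum>l<p - 1. norm (coeff P l - coeff Q l) * ((1 + 2 * e1 n) * S n))"
    proof (intro sum_norm_le)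
      fix l assume l: "l \<in> {..<p - 1}"
      then have "norm (frob_step s n (frob s v n) l) \<le> (1 + 2 * e1 n) * S n"
        using step[of l n] le[of l n] by (cases p) (auto simp: algebra_simps)
      then show "norm ((coeff P l - coeff Q l) * frob_step s n (frob s v n) l) \<le> norm (coeff P l - coeff Q l) * ((1 + 2 * e1 n) * S n)"
        by (simp add: norm_mult mult_left_mono)
    qed
    then have A: "norm ?A \<le> R * (1 + 2 * e1 n) * S n" by (simp add: R_def sum_distrib_right mult.assoc)
    have "norm ?B \<le> (\<Sum>l<p. norm (coeff Q l) * S n)"
      using le by (intro sum_norm_le) (auto simp: norm_mult intro!: mult_left_mono)
    then have B: "norm ?B \<le> B * S n" by (simp add: B_def sum_distrib_right)
    have C: "norm ((rho - 1) * frob s v n (p - 1)) \<le> norm (rho - 1) * S n"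
      using le[of "p - 1" n] p_pos by (simp add: norm_mult mult_left_mono)
    \<comment> \<open>Splitting \<open>of_nat n + s\<close> into
      \<open>of_nat n + 1 + s - rho\<close> and \<open>rho - 1\<close> separates the old value from
      the correction.\<close>
    let ?T = "?A + (rho - 1) * frob s v n (p - 1) + ?B"
    have T: "norm ?T \<le> (R * (1 + 2 * e1 n) + norm (rho - 1) + B) * S n"
      using A B C norm_triangle_ineq[of "?A + (rho - 1) * frob s v n (p - 1)" ?B]
        norm_triangle_ineq[of ?A "(rho - 1) * frob s v n (p - 1)"] unfolding distrib_right by linarith
    have eq: "frob s v (Suc n) (p - 1) = frob s v n (p - 1) + ?T / (of_nat n + 1 + s - rho)"
      using nz(2)[of n] p_pos by (simp add: field_simps)
    have "norm ?T * e2 n \<le> (R * (1 + 2 * e1 n) + norm (rho - 1) + B) * S n * e2 n"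
      using T e0(2)[of n] by (rule mult_right_mono)
    moreover have "norm (?T / (of_nat n + 1 + s - rho)) = norm ?T * e2 n"
      by (simp add: norm_divide e2_def add_diff_eq add.assoc)
    ultimately show ?thesis unfolding eq
      using norm_triangle_ineq[of "frob s v n (p - 1)" "?T / (of_nat n + 1 + s - rho)"]
      by (simp only: mult_ac)
  qed
  show ?thesis
  proof (rule on_disc_growth[where s = S and c = c])
    show "norm (fps_nth (X1 s v j) n) \<le> S n" for n using le[OF assms(2)] by (simp add: X1_def)
    have "c \<longlonglongrightarrow> 1 + real p * (2 * 0) + 0 * (R * (1 + 2 * 0) + norm (rho - 1) + B)"
      unfolding c_def e1_def e2_def by (intro tendsto_intros inverse_norm_tendsto_0)
    then show "c \<longlonglongrightarrow> 1" by simp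
    have "S (Suc n) \<le> c n * S n" for n
    proof -
      have p: "{..<p} = insert (p - 1) {..<p - 1}" using p_pos by auto
      have Sp: "S m = norm (frob s v m (p - 1)) + (\<Sum>l<p - 1. norm (frob s v m l))" for m
        unfolding S_def by (subst p) simp
      have "(\<Sum>l<p - 1. norm (frob s v (Suc n) l)) \<le> (\<Sum>l<p - 1. norm (frob s v n l) + 2 * e1 n * S n)"
        using step by (intro sum_mono) auto
      also have "\<dots> = (\<Sum>l<p - 1. norm (frob s v n l)) + real (p - 1) * (2 * e1 n * S n)"
        by (simp add: sum.distrib)
      also have "\<dots> \<le> (\<Sum>l<p - 1. norm (frob s v n l)) + real p * (2 * e1 n * S n)"
        using e0 S0 by (intro add_left_mono mult_right_mono) auto
      finally show ?thesis using last[of n] unfolding Sp[of "Suc n"] c_def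
        by (simp only: ring_distribs mult_1) (simp add: Sp[of n] algebra_simps)
    qed
    then show "eventually (\<lambda>n. S (Suc n) \<le> c n * S n) sequentially" by auto
  qed
qed

lemma sum_last: "(\<Sum>l<p. f l) = (\<Sum>l<p - 1. f l) + (f (p - 1) :: 'a :: comm_monoid_add)"
  using p_pos by (cases p) auto

text \<open>With \<open>fps_X\<close> standing for x = 1 - z, the series on the left is x (1 - x)
  d/dx of x^s \<open>X1 s v j\<close> after removal of x^s.\<close>

lemma X1_lhs_nth:
  "fps_nth ((1 - fps_X) * (fps_const s * X1 s v j + fps_X * fps_deriv (X1 s v j))) (Suc n) =
     (of_nat n + 1 + s) * frob s v (Suc n) j - (of_nat n + s) * frob s v n j"
proof -
  have "fps_nth (fps_const s * X1 s v j + fps_X * fps_deriv (X1 s v j)) n = (of_nat n + s) * frob s v n j" for n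
    by (cases n) (auto simp: X1_def algebra_simps simp del: frob.simps)
  moreover have "fps_nth ((1 - fps_X) * H) (Suc n) = fps_nth H (Suc n) - fps_nth H n" for H :: "complex fps"
    by (simp add: left_diff_distrib)
  ultimately show ?thesis by (simp only:) (simp add: algebra_simps del: frob.simps)
qed

lemma X1_ode:
  assumes "frob_start s v" "Suc j < p"
  shows "(1 - fps_X) * (fps_const s * X1 s v j + fps_X * fps_deriv (X1 s v j)) = - (fps_X * X1 s v (Suc j))"
proof (rule fps_ext)
  fix n
  show "fps_nth ((1 - fps_X) * (fps_const s * X1 s v j + fps_X * fps_deriv (X1 s v j))) n = fps_nth (- (fps_X * X1 s v (Suc j))) n"
  proof (cases n)
    case 0
    then show ?thesis using assms by (simp add: X1_def frob_start_def)
  next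
    case (Suc m)
    have "of_nat m + 1 + s \<noteq> 0" using assms by (auto simp: frob_start_def)
    then have "(of_nat m + 1 + s) * frob s v (Suc m) j - (of_nat m + s) * frob s v m j = - frob s v m (Suc j)"
      using assms(2) by (simp add: frob_step_def)
    then show ?thesis unfolding Suc X1_lhs_nth by (simp add: X1_def)
  qed
qed

lemma X1_ode_last:
  assumes "frob_start s v"
  shows "(1 - fps_X) * (fps_const s * X1 s v (p - 1) + fps_X * fps_deriv (X1 s v (p - 1))) =
    (\<Sum>l<p. (fps_const (coeff P l - coeff Q l) + fps_const (coeff Q l) * fps_X) * X1 s v l)"
proof (rule fps_ext)
  fix n
  have nz: "of_nat m + 1 + s - rho \<noteq> 0" for m using assms by (auto simp: frob_start_def)
  show "fps_nth ((1 - fps_X) * (fps_const s * X1 s v (p - 1) + fps_X * fps_deriv (X1 s v (p - 1)))) n =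
    fps_nth (\<Sum>l<p. (fps_const (coeff P l - coeff Q l) + fps_const (coeff Q l) * fps_X) * X1 s v l) n"
  proof (cases n)
    case 0
    then show ?thesis using assms by (simp add: X1_def fps_sum_nth frob_start_def ring_distribs)
  next
    case (Suc m)
    let ?w = "frob s v (Suc m)" and ?v = "frob s v m"
    have "(\<Sum>l<p - 1. (coeff P l - coeff Q l) * ?w l) = (\<Sum>l<p - 1. (coeff P l - coeff Q l) * frob_step s m ?v l)"
      by (intro sum.cong) auto
    then have "(of_nat m + 1 + s - rho) * ?w (p - 1) = (\<Sum>l<p - 1. (coeff P l - coeff Q l) * ?w l) +
       (of_nat m + s) * ?v (p - 1) + (\<Sum>l<p. coeff Q l * ?v l)"
      using nz[of m] p_pos by (simp only: frob.simps) simp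
    then have "(of_nat m + 1 + s) * ?w (p - 1) - (of_nat m + s) * ?v (p - 1) =
        (\<Sum>l<p - 1. (coeff P l - coeff Q l) * ?w l) + rho * ?w (p - 1) + (\<Sum>l<p. coeff Q l * ?v l)"
      by (simp add: algebra_simps)
    also have "(\<Sum>l<p - 1. (coeff P l - coeff Q l) * ?w l) + rho * ?w (p - 1) = (\<Sum>l<p. (coeff P l - coeff Q l) * ?w l)"
      by (simp add: sum_last rho_eq[symmetric] del: frob.simps)
    finally have "(of_nat m + 1 + s) * ?w (p - 1) - (of_nat m + s) * ?v (p - 1) =
       (\<Sum>l<p. (coeff P l - coeff Q l) * ?w l + coeff Q l * ?v l)" by (simp only: sum.distrib)
    moreover have "fps_nth ((1 - fps_X) * (fps_const s * X1 s v (p - 1) + fps_X * fps_deriv (X1 s v (p - 1)))) n =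
       (of_nat m + 1 + s) * ?w (p - 1) - (of_nat m + s) * ?v (p - 1)"
      unfolding Suc by (rule X1_lhs_nth)
    moreover have "fps_nth (\<Sum>l<p. (fps_const (coeff P l - coeff Q l) + fps_const (coeff Q l) * fps_X) * X1 s v l) n =
       (\<Sum>l<p. (coeff P l - coeff Q l) * ?w l + coeff Q l * ?v l)"
      using Suc by (simp add: X1_def fps_sum_nth distrib_right mult.assoc del: frob.simps)
    ultimately show ?thesis by simp
  qed
qed

lemma sol_Y1:
  assumes g: "frob_start s v"
  shows "sol (Y1 s v)"
  unfolding sol_def
proof (intro allI impI ballI)
  fix j z assume jz: "j < p" "z \<in> lens"
  note z = lensD[OF jz(2)]
  let ?x = "1 - z"
  let ?D = "s * eval_fps (X1 s v j) ?x + ?x * eval_fps (fps_deriv (X1 s v j)) ?x"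
  have ps: "on_disc (X1 s v l)" if "l < p" for l using on_disc_X1[OF g that] .
  have "((\<lambda>z. (1 - z) powr s) has_field_derivative s * ?x powr (s - 1) * (-1)) (at z)"
    using z by (auto intro!: derivative_eq_intros)
  moreover have "((\<lambda>z. eval_fps (X1 s v j) (1 - z)) has_field_derivative eval_fps (fps_deriv (X1 s v j)) ?x * (-1)) (at z)"
    using z ps[OF jz(1)] by (intro eval_disc_deriv) (auto intro!: derivative_eq_intros)
  ultimately have "((\<lambda>z. (1 - z) powr s * eval_fps (X1 s v j) (1 - z)) has_field_derivative
     (s * ?x powr (s - 1) * (-1)) * eval_fps (X1 s v j) ?x + (eval_fps (fps_deriv (X1 s v j)) ?x * (-1)) * ?x powr s) (at z)"
    by (rule DERIV_mult)
  moreover have "?x powr (s - 1) = ?x powr s / ?x" using z by (simp add: powr_diff)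
  moreover have "(s * (W / x) * (-1)) * A + (B * (-1)) * W = - (W * (s * A + x * B) / x)"
    if "x \<noteq> 0" for x W A B using that by (simp add: field_simps)
  ultimately have "(Y1 s v j has_field_derivative - (?x powr s * ?D / ?x)) (at z)"
    using z unfolding Y1_def[abs_def] by simp
  moreover have "- (?x powr s * ?D / ?x) = rhs (Y1 s v) j z"
  proof (cases "Suc j < p")
    case True
    have "eval_fps ((1 - fps_X) * (fps_const s * X1 s v j + fps_X * fps_deriv (X1 s v j))) ?x = eval_fps (- (fps_X * X1 s v (Suc j))) ?x"
      by (simp only: X1_ode[OF g True])
    then have "z * ?D = - (?x * eval_fps (X1 s v (Suc j)) ?x)"
      using z ps[OF jz(1)] ps[OF True] by simp
    then have "?D = - (?x * eval_fps (X1 s v (Suc j)) ?x) / z" using z by (simp add: field_simps)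
    then show ?thesis using True z unfolding rhs_def Y1_def by simp
  next
    case False
    then have j: "j = p - 1" using jz by simp
    have "eval_fps ((1 - fps_X) * (fps_const s * X1 s v j + fps_X * fps_deriv (X1 s v j))) ?x =
        eval_fps (\<Sum>l<p. (fps_const (coeff P l - coeff Q l) + fps_const (coeff Q l) * fps_X) * X1 s v l) ?x"
      unfolding j by (simp only: X1_ode_last[OF g])
    then have "z * ?D = (\<Sum>l<p. (coeff P l - coeff Q l + coeff Q l * ?x) * eval_fps (X1 s v l) ?x)"
      using z ps[OF jz(1)] by (subst (asm) eval_disc_sum) (auto simp: ps intro!: sum.cong)
    also have "\<dots> = - (\<Sum>l<p. (z * coeff Q l - coeff P l) * eval_fps (X1 s v l) ?x)"
      unfolding sum_negf[symmetric] by (intro sum.cong) (auto simp: algebra_simps)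
    finally have "?D = - (\<Sum>l<p. (z * coeff Q l - coeff P l) * eval_fps (X1 s v l) ?x) / z" using z by (simp add: field_simps)
    then have "- (?x powr s * ?D / ?x) = (\<Sum>l<p. (z * coeff Q l - coeff P l) * Y1 s v l z) / (z * ?x)"
      by (simp add: Y1_def sum_distrib_left mult_ac)
    then show ?thesis using False by (simp add: rhs_def)
  qed
  ultimately show "(Y1 s v j has_field_derivative rhs (Y1 s v) j z) (at z)" by simp
qed

end

subsection \<open>Expansions at \<open>z = 1\<close>\<close>

lemma on_disc_I:
  assumes "\<And>x :: complex. norm x < 1 \<Longrightarrow> summable (\<lambda>n. fps_nth f n * x ^ n)"
  shows "on_disc f"
  unfolding on_disc_def fps_conv_radius_def
proof (rule conv_radius_geI_ex)
  fix r :: real assume "0 < r" "ereal r < 1"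
  then show "\<exists>z. norm z = r \<and> summable (\<lambda>n. fps_nth f n * z ^ n)"
    using assms[of "of_real r"] by (intro exI[of _ "of_real r"]) auto
qed

text \<open>The series of \<open>(1 - x) powr c\<close>; at x = 1 - z it represents
  \<open>z powr c\<close> and so adds or removes the factor belonging to the exponent at 0. Its
  coefficients are those of the theorem (\<open>binom_fps_nth\<close>), so both identities are
  statements about Cauchy products with this series.\<close>

definition binom_fps :: "complex \<Rightarrow> complex fps" where
  "binom_fps c = Abs_fps (\<lambda>n. (c gchoose n) * (-1) ^ n)"

lemma binom_fps_sums: "norm x < 1 \<Longrightarrow> (\<lambda>n. fps_nth (binom_fps c) n * x ^ n) sums (1 - x) powr c"
  using gen_binomial_complex[of "- x" c] by (simp add: binom_fps_def power_minus[of x] mult.assoc)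

lemma on_disc_binom_fps [simp, intro]: "on_disc (binom_fps c)"
  by (rule on_disc_I) (use binom_fps_sums sums_summable in blast)

lemma eval_binom_fps: "norm (1 - z) < 1 \<Longrightarrow> eval_fps (binom_fps c) (1 - z) = z powr c"
  using binom_fps_sums[of "1 - z" c] by (simp add: eval_fps_def sums_iff)

lemma binom_fps_nth: "fps_nth (binom_fps c) j = (-1) ^ j / fact j * falling c j"
  by (simp add: binom_fps_def gbinomial_prod_rev falling_def atLeast0LessThan)

lemma two_term_unique:
  fixes H S :: "complex fps"
  assumes rho: "rho \<notin> \<int>" and rad: "fps_conv_radius H > 0" "fps_conv_radius S > 0"
    and ev: "\<forall>\<^sub>F x::real in at_right 0. of_real x powr rho * eval_fps S (of_real x) + eval_fps H (of_real x) = 0"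
  shows "H = 0" "S = 0"
proof -
  have "(if k then H else S) = 0" for k
  proof (rule generalized_power_series_unique[where I = "UNIV :: bool set" and e = "\<lambda>k. if k then 0 else rho"
        and H = "\<lambda>k. if k then H else S" and k = k])
    fix i j :: bool assume "i \<noteq> j"
    then show "(if i then 0 else rho) - (if j then 0 else rho) \<notin> \<int>" using rho by (auto simp: minus_in_Ints_iff)
  next
    have "eventually (\<lambda>x::real. x > 0) (at_right 0)" by (rule eventually_at_right_less)
    with ev show "\<forall>\<^sub>F x::real in at_right 0. (\<Sum>i\<in>UNIV. of_real x powr (if i then 0 else rho) * eval_fps (if i then H else S) (of_real x)) = 0"
      by eventually_elim (simp add: UNIV_bool)
  qed (use rad in auto)
  from this[of True] this[of False] show "H = 0" "S = 0" by auto
qed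

lemma eventually_at_left_1_iff:
  fixes Q :: "real \<Rightarrow> bool"
  shows "(\<forall>\<^sub>F z in at_left 1. Q z) \<longleftrightarrow> (\<forall>\<^sub>F x in at_right 0. Q (1 - x))"
proof
  assume "\<forall>\<^sub>F z in at_left 1. Q z"
  then obtain c where c: "c < 1" "\<And>y. y > c \<Longrightarrow> y < 1 \<Longrightarrow> Q y" by (auto simp: eventually_at_left_field)
  then show "\<forall>\<^sub>F x in at_right 0. Q (1 - x)" unfolding eventually_at_right_field
    by (intro exI[of _ "1 - c"]) auto
next
  assume "\<forall>\<^sub>F x in at_right 0. Q (1 - x)"
  then obtain c where c: "c > 0" "\<And>y. y > 0 \<Longrightarrow> y < c \<Longrightarrow> Q (1 - y)" by (auto simp: eventually_at_right_field)
  have "Q y" if "y > 1 - c" "y < 1" for y using c(2)[of "1 - y"] that by simp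
  then show "\<forall>\<^sub>F z in at_left 1. Q z" unfolding eventually_at_left_field using c(1)
    by (intro exI[of _ "1 - c"]) auto
qed

lemma unit_interval_at_right: "\<forall>\<^sub>F x::real in at_right 0. 0 < x \<and> x < 1"
  and unit_interval_at_left: "\<forall>\<^sub>F x::real in at_left 1. 0 < x \<and> x < 1"
  by (auto simp: eventually_at_right_field eventually_at_left_field intro: exI[of _ 1] exI[of _ 0])

lemma conv_radius_pos_if_summable:
  assumes "summable (\<lambda>n. f n * of_real x ^ n :: complex)" "x > 0"
  shows "fps_conv_radius (Abs_fps f) > 0"
proof -
  have "conv_radius f \<ge> norm (of_real x :: complex)" by (rule conv_radius_geI) (use assms in auto)
  moreover have "ereal 0 < ereal (norm (of_real x :: complex))" using assms by simp
  ultimately show ?thesis unfolding fps_conv_radius_def fps_nth_Abs_fps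
    by (metis less_le_trans zero_ereal_def)
qed

text \<open>A competing expansion is known only near z = 1. One point where it converges yields
  positive radii, and the difference of the two expansions falls under
  \<open>two_term_unique\<close> because the exponent is not an integer.\<close>

lemma buhring_h0_eqI:
  assumes psi: "psi p a b \<notin> \<int>" and ps: "on_disc f" "on_disc h"
    and eq: "\<And>z. z \<in> lens \<Longrightarrow> buhring_function p a b k z = (1 - z) powr (psi p a b - 1) * eval_fps f (1 - z) + eval_fps h (1 - z)"
  shows "buhring_h0 p a b k = fps_nth h"
  unfolding buhring_h0_def
proof (rule the_equality)
  have "\<forall>\<^sub>F x in at_right 0. summable (\<lambda>n. fps_nth f n * complex_of_real (1 - (1 - x)) ^ n) \<and>
        summable (\<lambda>n. fps_nth h n * of_real (1 - (1 - x)) ^ n) \<and>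
        buhring_function p a b k (of_real (1 - x)) =
          of_real (1 - (1 - x)) powr (psi p a b - 1) * (\<Sum>n. fps_nth f n * of_real (1 - (1 - x)) ^ n) +
          (\<Sum>n. fps_nth h n * of_real (1 - (1 - x)) ^ n)"
    using unit_interval_at_right
  proof eventually_elim
    case (elim x)
    have "complex_of_real (1 - x) \<in> lens" using elim by (subst of_real_lens) auto
    from eq[OF this] show ?case
      using elim on_disc_sums[OF ps(1), of "of_real x"] on_disc_sums[OF ps(2), of "of_real x"] by (simp add: sums_iff)
  qed
  then show "\<exists>f. buhring_expansion p a b k f (fps_nth h)"
    unfolding buhring_expansion_def eventually_at_left_1_iff by (intro exI[of _ "fps_nth f"])
next
  fix h' assume "\<exists>f'. buhring_expansion p a b k f' h'"
  then obtain f' where ev: "buhring_expansion p a b k f' h'" ..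
  then have ev: "\<forall>\<^sub>F x in at_right 0. summable (\<lambda>n. f' n * complex_of_real x ^ n) \<and>
        summable (\<lambda>n. h' n * of_real x ^ n) \<and>
        buhring_function p a b k (of_real (1 - x)) =
          of_real x powr (psi p a b - 1) * (\<Sum>n. f' n * of_real x ^ n) + (\<Sum>n. h' n * of_real x ^ n)"
    unfolding buhring_expansion_def eventually_at_left_1_iff by simp
  note pos = unit_interval_at_right
  from eventually_happens[OF eventually_conj[OF ev pos]]
  obtain x0 :: real where x0: "0 < x0" "x0 < 1" "summable (\<lambda>n. f' n * complex_of_real x0 ^ n)"
    "summable (\<lambda>n. h' n * complex_of_real x0 ^ n)" by auto
  define S where "S = f - Abs_fps f'"
  define H where "H = h - Abs_fps h'"
  have rad: "fps_conv_radius (Abs_fps f') > 0" "fps_conv_radius (Abs_fps h') > 0"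
    using conv_radius_pos_if_summable x0 by auto
  have "H = 0"
  proof (rule two_term_unique[of "psi p a b - 1" H S])
    show "psi p a b - 1 \<notin> \<int>" using psi by (metis Ints_1 Ints_add diff_add_cancel)
    show "fps_conv_radius H > 0" "fps_conv_radius S > 0"
      using rad on_disc_pos[OF ps(1)] on_disc_pos[OF ps(2)] fps_conv_radius_diff[of h "Abs_fps h'"] fps_conv_radius_diff[of f "Abs_fps f'"]
      by (auto simp: H_def S_def min_def split: if_splits intro: less_le_trans)
    show "\<forall>\<^sub>F x::real in at_right 0. of_real x powr (psi p a b - 1) * eval_fps S (of_real x) + eval_fps H (of_real x) = 0"
      using ev pos eventually_less_conv_radius[OF rad(1)] eventually_less_conv_radius[OF rad(2)] eventually_less_conv_radius[OF on_disc_pos[OF ps(1)]] eventually_less_conv_radius[OF on_disc_pos[OF ps(2)]]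
    proof eventually_elim
      case (elim x)
      have "complex_of_real (1 - x) \<in> lens" using elim by (subst of_real_lens) auto
      note 1 = eq[OF this]
      have 2: "eval_fps S (of_real x) = eval_fps f (of_real x) - (\<Sum>n. f' n * of_real x ^ n)"
        using elim unfolding S_def by (subst eval_fps_diff) (auto simp: eval_fps_def)
      have 3: "eval_fps H (of_real x) = eval_fps h (of_real x) - (\<Sum>n. h' n * of_real x ^ n)"
        using elim unfolding H_def by (subst eval_fps_diff) (auto simp: eval_fps_def)
      have "W * (s - s') + (h - h') = 0" if "W * s + h = W * s' + h'" for W s s' h h' :: complex
        using that by (simp add: algebra_simps)
      then show ?case using 1 elim unfolding 2 3 by simp
    qed
  qed
  then have "Abs_fps h' = h" by (simp add: H_def)
  then show "h' = fps_nth h" by (metis fps_nth_Abs_fps ext)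
qed

lemma foldl_times: "foldl (\<lambda>r x. r * g x) c xs = (c :: complex) * prod_list (map g xs)"
  by (induction xs arbitrary: c) (auto simp: mult.assoc)

context hypergeo
begin

lemma buhring_function_eq:
  assumes k: "k \<in> {1..p}"
  shows "buhring_function p a b k z =
    (\<Prod>i=1..p. Gamma (1 - b i + a k)) / (\<Prod>i\<in>{1..p} - {k}. Gamma (1 - a i + a k)) * eval_fps (G k 0) z"
proof -
  have 1: "prod_list (map f [1..<Suc p]) = (\<Prod>i=1..p. f i)" for f :: "nat \<Rightarrow> complex"
    by (subst prod.distinct_set_conv_list[symmetric]) (simp_all add: atLeastLessThanSuc_atLeastAtMost del: upt_Suc)
  have "prod_list (map f (filter (\<lambda>i. i \<noteq> k) [1..<Suc p])) = (\<Prod>i\<in>{1..p} - {k}. f i)" for f :: "nat \<Rightarrow> complex"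
    by (subst prod.distinct_set_conv_list[symmetric]) (auto intro!: prod.cong)
  note 2 = this
  have "fps_hypergeo (map (\<lambda>i. 1 - b i + a k) [1..<Suc p])
          (map (\<lambda>i. 1 - a i + a k) (filter (\<lambda>i. i \<noteq> k) [1..<Suc p])) 1 = G k 0"
  proof (rule fps_ext)
    fix n
    have "(\<Prod>i=1..p. pochhammer (1 - a i + a k) n) = (\<Prod>i\<in>{1..p} - {k}. pochhammer (1 - a i + a k) n) * fact n"
      using k by (subst prod.remove[of _ k]) (auto simp: pochhammer_fact mult.commute)
    then show "fps_nth (fps_hypergeo (map (\<lambda>i. 1 - b i + a k) [1..<Suc p])
          (map (\<lambda>i. 1 - a i + a k) (filter (\<lambda>i. i \<noteq> k) [1..<Suc p])) 1) n = fps_nth (G k 0) n"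
      unfolding fps_hypergeo_nth foldl_times map_map o_def 1 2
      by (simp add: F_def prod_dividef)
  qed
  then show ?thesis unfolding buhring_function_def by simp
qed

text \<open>The eigenvector of B_0 for the eigenvalue \<open>rho\<close>; the eigenvalue 0 belongs
  to the holomorphic solutions.\<close>

definition special_start :: "nat \<Rightarrow> complex" where "special_start j = (if j = p - 1 then 1 else 0)"

lemma frob_start_special:
  assumes "\<And>n. of_nat n + 1 + rho \<noteq> 0"
  shows "frob_start rho special_start"
proof -
  have "of_nat n + 1 \<noteq> (0 :: complex)" for n by (metis of_nat_Suc of_nat_eq_0_iff nat.distinct(1) add.commute)
  then show ?thesis using assms p_pos unfolding frob_start_def sum_last special_start_def by (auto simp: rho_eq[symmetric])
qed

lemma frob_start_special_large:
  assumes "Re (psi p a b) > real p + 1"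
  shows "frob_start rho special_start"
proof (rule frob_start_special, rule notI)
  fix n assume "of_nat n + 1 + rho = 0"
  then have "Re (of_nat n + 1 + rho) = 0" by simp
  then show False using assms by (simp add: rho_def)
qed

text \<open>Component \<open>j\<close> at step n + 1 draws only on components \<open>j\<close> and
  \<open>j + 1\<close> at step n, so the nonzero entry climbs one place per step. Component 0
  therefore starts at x^(p-1), which turns the exponent \<open>rho\<close> into psi_p - 1;
  \<open>special_fps\<close> is what remains after removing this power.\<close>

lemma frob_special_0: "n + j < p - 1 \<Longrightarrow> frob rho special_start n j = 0"
  by (induction n arbitrary: j) (auto simp: special_start_def frob_step_def)

lemma frob_special_lead:
  "n \<le> p - 1 \<Longrightarrow> frob rho special_start n (p - 1 - n) = (-1) ^ n / pochhammer (rho + 1) n"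
proof (induction n)
  case 0
  then show ?case by (simp add: special_start_def)
next
  case (Suc n)
  have 1: "frob rho special_start n (p - 1 - Suc n) = 0" using Suc.prems by (intro frob_special_0) auto
  have "Suc (p - 1 - Suc n) = p - 1 - n" using Suc.prems by auto
  then have "frob rho special_start (Suc n) (p - 1 - Suc n) = - frob rho special_start n (p - 1 - n) / (of_nat n + 1 + rho)"
    using Suc.prems 1 by (auto simp: frob_step_def)
  then show ?case using Suc by (simp add: pochhammer_Suc add_ac)
qed

definition special_fps :: "complex fps" where "special_fps = fps_shift (p - 1) (X1 rho special_start 0)"

lemma special_fps_0: "fps_nth special_fps 0 = (-1) ^ (p - 1) / pochhammer (rho + 1) (p - 1)"
  using frob_special_lead[of "p - 1"] by (simp add: special_fps_def X1_def)

lemma on_disc_special_fps: "frob_start rho special_start \<Longrightarrow> on_disc special_fps"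
  using on_disc_X1[of rho special_start 0] p_pos by (simp add: special_fps_def on_disc_def)

lemma Y1_special:
  assumes g: "frob_start rho special_start" and z: "z \<in> lens"
  shows "Y1 rho special_start 0 z = (1 - z) powr (psi p a b - 1) * eval_fps special_fps (1 - z)"
proof -
  note z = lensD[OF z]
  have "X1 rho special_start 0 = special_fps * fps_X ^ (p - 1)"
  proof (rule fps_ext)
    fix n
    show "fps_nth (X1 rho special_start 0) n = fps_nth (special_fps * fps_X ^ (p - 1)) n"
      using frob_special_0[of n 0] by (auto simp: special_fps_def X1_def fps_X_power_mult_right_nth)
  qed
  then have "eval_fps (X1 rho special_start 0) (1 - z) = eval_fps special_fps (1 - z) * (1 - z) ^ (p - 1)"
    using on_disc_less[OF on_disc_special_fps[OF g]] z by (simp add: eval_fps_mult)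
  moreover have "(1 - z) powr (psi p a b - 1) = (1 - z) powr rho * (1 - z) ^ (p - 1)"
  proof -
    have "psi p a b - 1 = rho + of_nat (p - 1)" using p_pos by (simp add: rho_def of_nat_diff)
    then show ?thesis using z by (simp add: powr_add powr_nat')
  qed
  ultimately show ?thesis by (simp add: Y1_def)
qed

text \<open>The local exponents at \<open>z = 1\<close> are \<open>0\<close> (with \<open>p - 1\<close> holomorphic solutions) and \<open>\<psi>_p - 1\<close>.\<close>
lemma expansion_at_1:
  assumes psi: "psi p a b \<notin> \<int>" and Z: "sol Z"
  shows "\<exists>f h. on_disc f \<and> on_disc h \<and>
    (\<forall>z\<in>lens. Z 0 z = (1 - z) powr (psi p a b - 1) * eval_fps f (1 - z) + eval_fps h (1 - z))"
proof -
  have rho: "rho \<notin> \<int>" unfolding rho_def using psi by (metis Ints_add Ints_of_nat diff_add_cancel)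
  have rho0: "rho \<noteq> 0" using rho by auto
  have n1: "of_nat n + 1 \<noteq> (0 :: complex)" for n by (metis of_nat_Suc of_nat_eq_0_iff nat.distinct(1) add.commute)
  have g1: "frob_start rho special_start"
  proof (rule frob_start_special, rule notI)
    fix n assume "of_nat n + 1 + rho = 0"
    then have "rho = - of_nat (Suc n)" by (simp only: add_eq_0_iff) simp
    then show False using rho by (metis Ints_minus Ints_of_nat)
  qed
  \<comment> \<open>A basis of the kernel of B_0: unit vectors in the first p - 1 coordinates, with
    the last coordinate chosen to satisfy the last row. As \<open>rho\<close> is not an integer,
    none of them meets a resonance.\<close>
  define w where "w i j = (if j = i then 1 else if j = p - 1 then - (coeff P i - coeff Q i) / rho else 0)" for i j :: nat
  have g0: "frob_start 0 (w i)" if i: "i < p - 1" for i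
  proof -
    have "of_nat n + 1 - rho \<noteq> 0" for n
    proof
      assume "of_nat n + 1 - rho = 0"
      then have "rho = of_nat (Suc n)" by (simp add: add_ac)
      then show False using rho by (metis Ints_of_nat)
    qed
    moreover have "(\<Sum>l<p - 1. (coeff P l - coeff Q l) * w i l) = (\<Sum>l<p - 1. if l = i then coeff P i - coeff Q i else 0)"
      by (intro sum.cong) (auto simp: w_def)
    then have "(\<Sum>l<p. (coeff P l - coeff Q l) * w i l) = (coeff P i - coeff Q i) + rho * w i (p - 1)"
      using i unfolding sum_last rho_eq by simp
    moreover have "rho * w i (p - 1) = - (coeff P i - coeff Q i)" using i rho0 by (simp add: w_def)
    ultimately show ?thesis using n1 by (simp add: frob_start_def)
  qed
  define Ys where "Ys i = (if i = p - 1 then Y1 rho special_start else Y1 0 (w i))" for i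
  have Ysum: "(\<Sum>i<p. c i * Ys i j z) = (\<Sum>i<p - 1. c i * Y1 0 (w i) j z) + c (p - 1) * Y1 rho special_start j z" for c j z
    unfolding sum_last by (simp add: Ys_def)
  have "\<exists>d. \<forall>j<p. \<forall>z\<in>lens. Z j z = (\<Sum>i<p. d i * Ys i j z)"
  proof (rule sol_span[OF _ _ _ _ Z])
    show "sol (Ys i)" if "i \<in> {..<p}" for i using that g0[of i] g1 sol_Y1 by (auto simp: Ys_def)
    fix c assume c: "\<And>j z. j < p \<Longrightarrow> z \<in> lens \<Longrightarrow> (\<Sum>i<p. c i * Ys i j z) = 0"
    define H where "H j = (\<Sum>i<p - 1. fps_const (c i) * X1 0 (w i) j)" for j
    define S where "S j = fps_const (c (p - 1)) * X1 rho special_start j" for j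
    \<comment> \<open>A linear relation splits into its part with exponent \<open>rho\<close> and
      its holomorphic part. Both series vanish, and their constant terms return the coefficients of
      the relation.\<close>
    have HS: "H j = 0 \<and> S j = 0" if j: "j < p" for j
    proof -
      have psH: "on_disc (H j)" unfolding H_def using on_disc_X1[OF g0 j] by (intro on_disc_sum on_disc_mult) auto
      have psS: "on_disc (S j)" unfolding S_def using on_disc_X1[OF g1 j] by (intro on_disc_mult) auto
      have "\<forall>\<^sub>F x::real in at_right 0. of_real x powr rho * eval_fps (S j) (of_real x) + eval_fps (H j) (of_real x) = 0"
        unfolding eventually_at_right_field
      proof (intro exI[of _ 1] conjI allI impI)
        fix x :: real assume x: "0 < x" "x < 1"
        then have "complex_of_real (1 - x) \<in> lens" by (subst of_real_lens) auto
        from c[OF j this] have "(\<Sum>i<p - 1. c i * eval_fps (X1 0 (w i) j) (of_real x)) + c (p - 1) * (of_real x powr rho * eval_fps (X1 rho special_start j) (of_real x)) = 0"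
          using x unfolding Ysum Y1_def by simp
        moreover have "eval_fps (H j) (of_real x) = (\<Sum>i<p - 1. c i * eval_fps (X1 0 (w i) j) (of_real x))"
          unfolding H_def using x on_disc_X1[OF g0 j] by (subst eval_disc_sum) (auto intro!: on_disc_mult sum.cong)
        moreover have "eval_fps (S j) (of_real x) = c (p - 1) * eval_fps (X1 rho special_start j) (of_real x)"
          unfolding S_def using x on_disc_X1[OF g1 j] by (subst eval_disc_mult) auto
        ultimately show "of_real x powr rho * eval_fps (S j) (of_real x) + eval_fps (H j) (of_real x) = 0"
          by (simp add: algebra_simps)
      qed auto
      from two_term_unique[OF rho on_disc_pos[OF psH] on_disc_pos[OF psS] this] show ?thesis by simp
    qed
    show "\<forall>i\<in>{..<p}. c i = 0"
    proof
      fix i assume i: "i \<in> {..<p}"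
      show "c i = 0"
      proof (cases "i = p - 1")
        case True
        have "fps_nth (S (p - 1)) 0 = 0" using HS[of "p - 1"] p_pos by simp
        then show ?thesis using True by (simp add: S_def X1_def special_start_def)
      next
        case False
        then have i': "i < p - 1" using i by auto
        have "fps_nth (H i) 0 = (\<Sum>l<p - 1. if l = i then c i else 0)"
          unfolding H_def using i' by (simp add: fps_sum_nth X1_def w_def if_distrib[of "\<lambda>x. _ * x"] eq_commute cong: if_cong)
        then show ?thesis using HS[of i] i' by simp
      qed
    qed
  qed auto
  then obtain d where d: "\<And>z. z \<in> lens \<Longrightarrow> Z 0 z = (\<Sum>i<p - 1. d i * Y1 0 (w i) 0 z) + d (p - 1) * Y1 rho special_start 0 z"
    unfolding Ysum using p_pos by auto
  define h where "h = (\<Sum>i<p - 1. fps_const (d i) * X1 0 (w i) 0)"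
  define f where "f = fps_const (d (p - 1)) * special_fps"
  have ps: "on_disc (X1 0 (w i) 0)" if "i < p - 1" for i using on_disc_X1[OF g0[OF that], of 0] p_pos by simp
  have "Z 0 z = (1 - z) powr (psi p a b - 1) * eval_fps f (1 - z) + eval_fps h (1 - z)" if z: "z \<in> lens" for z
  proof -
    note zz = lensD[OF z]
    have "eval_fps h (1 - z) = (\<Sum>i<p - 1. d i * eval_fps (X1 0 (w i) 0) (1 - z))"
      unfolding h_def using zz ps by (subst eval_disc_sum) (auto intro!: on_disc_mult sum.cong)
    moreover have "eval_fps f (1 - z) = d (p - 1) * eval_fps special_fps (1 - z)"
      unfolding f_def using zz on_disc_special_fps[OF g1] by simp
    ultimately show ?thesis unfolding d[OF z] Y1_special[OF g1 z] using zz
      by (simp add: Y1_def)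
  qed
  moreover have "on_disc f" "on_disc h" unfolding f_def h_def using ps on_disc_special_fps[OF g1] by (auto intro!: on_disc_mult on_disc_sum)
  ultimately show ?thesis by blast
qed

lemma buhring_h0_expansion:
  assumes psi: "psi p a b \<notin> \<int>" and k: "k \<in> {1..p}"
  shows "\<exists>f h. on_disc f \<and> on_disc h \<and> buhring_h0 p a b k = fps_nth h \<and>
    (\<forall>z\<in>lens. buhring_function p a b k z = (1 - z) powr (psi p a b - 1) * eval_fps f (1 - z) + eval_fps h (1 - z))"
proof -
  obtain f h where fh: "on_disc f" "on_disc h"
    "\<And>z. z \<in> lens \<Longrightarrow> Y0 k 0 z = (1 - z) powr (psi p a b - 1) * eval_fps f (1 - z) + eval_fps h (1 - z)"
    using expansion_at_1[OF psi sol_Y0[OF k]] by blast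
  define c where "c = (\<Prod>i=1..p. Gamma (1 - b i + a k)) / (\<Prod>i\<in>{1..p} - {k}. Gamma (1 - a i + a k))"
  \<comment> \<open>\<open>buhring_function\<close> lacks the factor \<open>z powr a k\<close> of
    \<open>Y0 k 0\<close>; the binomial series expands the inverse of that factor at z = 1.\<close>
  define f' where "f' = fps_const c * binom_fps (- a k) * f"
  define h' where "h' = fps_const c * binom_fps (- a k) * h"
  have ps: "on_disc f'" "on_disc h'" using fh by (auto simp: f'_def h'_def)
  have eq: "buhring_function p a b k z = (1 - z) powr (psi p a b - 1) * eval_fps f' (1 - z) + eval_fps h' (1 - z)"
    if z: "z \<in> lens" for z
  proof -
    note zz = lensD[OF z]
    have "eval_fps (G k 0) z = z powr (- a k) * Y0 k 0 z" using zz by (simp add: Y0_def powr_minus)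
    then show ?thesis
      using zz fh(1,2) unfolding buhring_function_eq[OF k] c_def[symmetric] fh(3)[OF z]
      by (simp add: f'_def h'_def eval_binom_fps algebra_simps)
  qed
  show ?thesis using buhring_h0_eqI[OF psi ps eq] ps eq by blast
qed

end

subsection \<open>Connection coefficients of the special solution\<close>

text \<open>Gauss's limit for 1/Gamma, applied to quotients: the factorials cancel and the powers of
  n combine into one exponential.\<close>

lemma pochhammer_prod_tendsto:
  fixes x y :: "'i \<Rightarrow> complex"
  assumes fin: "finite I" and y: "\<And>i. i \<in> I \<Longrightarrow> y i \<notin> \<int>\<^sub>\<le>\<^sub>0"
  shows "(\<lambda>n. (\<Prod>i\<in>I. pochhammer (x i) (Suc n) / pochhammer (y i) (Suc n)) * exp ((\<Sum>i\<in>I. y i - x i) * of_real (ln (real n))))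
     \<longlonglongrightarrow> (\<Prod>i\<in>I. rGamma (x i) / rGamma (y i))"
proof -
  have "(\<lambda>n. \<Prod>i\<in>I. rGamma_series (x i) n / rGamma_series (y i) n) \<longlonglongrightarrow> (\<Prod>i\<in>I. rGamma (x i) / rGamma (y i))"
    using y by (intro tendsto_intros rGamma_series_LIMSEQ) (auto simp: rGamma_eq_zero_iff)
  moreover have "(\<Prod>i\<in>I. rGamma_series (x i) n / rGamma_series (y i) n) =
     (\<Prod>i\<in>I. pochhammer (x i) (Suc n) / pochhammer (y i) (Suc n)) * exp ((\<Sum>i\<in>I. y i - x i) * of_real (ln (real n)))" for n
  proof -
    have "rGamma_series (x i) n / rGamma_series (y i) n =
        pochhammer (x i) (Suc n) / pochhammer (y i) (Suc n) * exp ((y i - x i) * of_real (ln (real n)))" for i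
      by (simp add: rGamma_series_def left_diff_distrib exp_diff field_simps)
    then show ?thesis by (simp add: prod.distrib sum_distrib_right exp_sum[OF fin] prod_dividef)
  qed
  ultimately show ?thesis by simp
qed

lemma fact_pochhammer_tendsto:
  fixes c :: complex
  assumes "c \<notin> \<int>\<^sub>\<le>\<^sub>0"
  shows "(\<lambda>n. fact n / pochhammer c (Suc n) * exp (c * of_real (ln (real n)))) \<longlonglongrightarrow> Gamma c"
proof -
  have "Gamma_series c = (\<lambda>n. fact n / pochhammer c (Suc n) * exp (c * of_real (ln (real n))))"
    by (rule ext) (simp add: Gamma_series_def)
  then show ?thesis using Gamma_series_LIMSEQ[of c] by simp
qed

lemma has_integral_powr_complex:
  fixes c :: complex
  assumes "Re c > 0"
  shows "((\<lambda>t. of_real t powr c) has_integral 1 / (c + 1)) {0..1}"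
proof -
  have c: "c + 1 \<noteq> 0" "c \<noteq> 0" using assms by (auto simp: complex_eq_iff)
  have "((\<lambda>t::real. of_real t powr c) has_integral of_real 1 powr (c + 1) / (c + 1) - of_real 0 powr (c + 1) / (c + 1)) {0..1}"
  proof (rule fundamental_theorem_of_calculus_interior)
    show "continuous_on {0..1} (\<lambda>t::real. of_real t powr (c + 1) / (c + 1))"
      using assms c by (intro continuous_intros continuous_on_powr_complex) (auto simp: complex_nonpos_Reals_iff)
    fix t :: real assume t: "t \<in> {0<..<1}"
    have "((\<lambda>z. z powr (c + 1) / (c + 1)) has_field_derivative of_real t powr c) (at (of_real t))"
      using t c by (auto intro!: derivative_eq_intros simp: complex_nonpos_Reals_iff)
    from has_vector_derivative_real_field[OF this]
    show "((\<lambda>t. of_real t powr (c + 1) / (c + 1)) has_vector_derivative of_real t powr c) (at t)" .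
  qed auto
  then show ?thesis by simp
qed

lemma continuous_on_1_minus_powr:
  "Re c > 0 \<Longrightarrow> continuous_on {0..1} (\<lambda>t::real. complex_of_real (1 - t) powr c)"
  by (intro continuous_intros continuous_on_powr_complex) (auto simp: complex_nonpos_Reals_iff complex_eq_iff)

text \<open>The beta integral B(n + 1, c). The induction step integrates the derivative of t^(n+1)
  (1 - t)^c, whose boundary values are 0 and which combines the integrands for n and n + 1.\<close>

lemma has_integral_beta_nat:
  fixes c :: complex
  assumes c: "Re c > 1"
  shows "((\<lambda>t. of_real t ^ n * of_real (1 - t) powr (c - 1)) has_integral fact n / pochhammer c (Suc n)) {0..1}"
proof (induction n)
  case 0
  have "((\<lambda>t. complex_of_real (1 - t) powr c) has_vector_derivative - (c * of_real (1 - t) powr (c - 1))) (at t)"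
    if t: "t \<in> {0<..<1}" for t
  proof -
    have "((\<lambda>z. (1 - z) powr c) has_field_derivative - (c * (1 - of_real t) powr (c - 1))) (at (complex_of_real t))"
      using t by (auto intro!: derivative_eq_intros simp: complex_nonpos_Reals_iff)
    from has_vector_derivative_real_field[OF this] show ?thesis by simp
  qed
  then have "((\<lambda>t. - (c * complex_of_real (1 - t) powr (c - 1))) has_integral of_real (1 - 1) powr c - of_real (1 - 0) powr c) {0..1}"
    using continuous_on_1_minus_powr[of c] c by (intro fundamental_theorem_of_calculus_interior) auto
  from has_integral_mult_right[OF this, of "- 1 / c"] show ?case using c by (cases "c = 0") (auto simp: mult.assoc[symmetric])
next
  case (Suc n)
  have cn: "c + of_nat (Suc n) \<noteq> 0"
  proof
    assume "c + of_nat (Suc n) = 0"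
    then have "Re (c + of_nat (Suc n)) = 0" by simp
    then show False using c by simp
  qed
  have "((\<lambda>t. (of_nat n + 1) * (of_real t ^ n * complex_of_real (1 - t) powr (c - 1)) -
       (of_nat n + 1 + c) * (of_real t ^ Suc n * complex_of_real (1 - t) powr (c - 1))) has_integral
       of_real 1 ^ Suc n * of_real (1 - 1) powr c - of_real 0 ^ Suc n * of_real (1 - 0) powr c) {0..1}"
  proof (rule fundamental_theorem_of_calculus_interior)
    show "continuous_on {0..1} (\<lambda>t::real. of_real t ^ Suc n * complex_of_real (1 - t) powr c)"
      using continuous_on_1_minus_powr[of c] c by (intro continuous_intros) auto
    fix t :: real assume t: "t \<in> {0<..<1}"
    have "((\<lambda>z. z ^ Suc n * (1 - z) powr c) has_field_derivative
        (1 + of_nat n) * of_real t ^ n * (1 - of_real t) powr c - of_real t ^ Suc n * (c * (1 - of_real t) powr (c - 1))) (at (complex_of_real t))"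
      using t by (auto intro!: derivative_eq_intros simp: complex_nonpos_Reals_iff) (cases n; simp add: algebra_simps)
    from has_vector_derivative_real_field[OF this]
    have "((\<lambda>t. of_real t ^ Suc n * complex_of_real (1 - t) powr c) has_vector_derivative
        (1 + of_nat n) * of_real t ^ n * (1 - of_real t) powr c - of_real t ^ Suc n * (c * (1 - of_real t) powr (c - 1))) (at t)" by simp
    moreover have "(1 - complex_of_real t) powr c = (1 - of_real t) powr (c - 1) * (1 - of_real t)"
      using t by (simp add: powr_diff)
    ultimately show "((\<lambda>t. of_real t ^ Suc n * complex_of_real (1 - t) powr c) has_vector_derivative
      (of_nat n + 1) * (of_real t ^ n * complex_of_real (1 - t) powr (c - 1)) -
       (of_nat n + 1 + c) * (of_real t ^ Suc n * complex_of_real (1 - t) powr (c - 1))) (at t)"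
      by (simp add: algebra_simps)
  qed auto
  then have "((\<lambda>t. (of_nat n + 1) * (of_real t ^ n * complex_of_real (1 - t) powr (c - 1)) -
       (of_nat n + 1 + c) * (of_real t ^ Suc n * complex_of_real (1 - t) powr (c - 1))) has_integral 0) {0..1}" by simp
  from has_integral_diff[OF has_integral_mult_right[OF Suc.IH, of "of_nat n + 1"] this]
  have "((\<lambda>t. (of_nat n + 1 + c) * (of_real t ^ Suc n * complex_of_real (1 - t) powr (c - 1))) has_integral
      (of_nat n + 1) * (fact n / pochhammer c (Suc n))) {0..1}" by simp
  from has_integral_mult_right[OF this, of "1 / (of_nat n + 1 + c)"]
  have "((\<lambda>t. of_real t ^ Suc n * complex_of_real (1 - t) powr (c - 1)) has_integral
      1 / (of_nat n + 1 + c) * ((of_nat n + 1) * (fact n / pochhammer c (Suc n)))) {0..1}"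
    using cn by (simp add: add_ac mult.assoc[symmetric])
  moreover have "1 / (of_nat n + 1 + c) * ((of_nat n + 1) * (fact n / pochhammer c (Suc n))) = fact (Suc n) / pochhammer c (Suc (Suc n))"
    by (simp add: pochhammer_Suc[of c "Suc n"] add_ac)
  ultimately show ?case by simp
qed

text \<open>Absolute summability at t = 1 suffices for termwise integration, because the powers of t
  are bounded by 1 and the convergence is uniform on the closed interval.\<close>

lemma has_integral_powr_series:
  fixes c :: complex and f :: "nat \<Rightarrow> complex"
  assumes c: "Re c > 0" and f: "summable (\<lambda>n. norm (f n))"
  shows "((\<lambda>t. of_real t powr c * (\<Sum>n. f n * of_real t ^ n)) has_integral (\<Sum>n. f n / (c + 1 + of_nat n))) {0..1}"
    "summable (\<lambda>n. f n / (c + 1 + of_nat n))"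
proof -
  define g where "g n t = f n * of_real t powr (c + of_nat n)" for n and t :: real
  have tn: "of_real t powr (c + of_nat n) = of_real t powr c * of_real t ^ n" if "t \<in> {0..1}" for t :: real and n
    using that c by (cases "t = 0") (auto simp: powr_add powr_nat')
  have nle: "norm (complex_of_real t powr (c + of_nat n)) \<le> 1" if "t \<in> {0..1}" for t n
  proof -
    have "norm (complex_of_real t powr (c + of_nat n)) = t powr Re (c + of_nat n)"
      using that by (subst norm_powr_real_powr) auto
    also have "\<dots> \<le> 1 powr Re (c + of_nat n)" using that c by (intro powr_mono2) auto
    finally show ?thesis by simp
  qed
  have ul: "uniform_limit (cbox 0 1) (\<lambda>N t. \<Sum>n<N. g n t) (\<lambda>t. \<Sum>n. g n t) sequentially"
  proof (rule Weierstrass_m_test[OF _ f])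
    fix n and t :: real assume "t \<in> cbox 0 1"
    then show "norm (g n t) \<le> norm (f n)" using nle[of t n] mult_left_mono[of _ 1 "norm (f n)"]
      by (simp add: g_def norm_mult)
  qed
  have int: "((\<lambda>t. \<Sum>n<N. g n t) has_integral (\<Sum>n<N. f n * (1 / (c + of_nat n + 1)))) (cbox 0 1)" for N
    unfolding g_def cbox_interval using c by (intro has_integral_sum has_integral_mult_right has_integral_powr_complex) auto
  obtain I J where IJ: "\<And>N. ((\<lambda>t. \<Sum>n<N. g n t) has_integral I N) (cbox 0 1)"
    "((\<lambda>t. \<Sum>n. g n t) has_integral J) (cbox 0 1)" "I \<longlonglongrightarrow> J"
  proof (rule uniform_limit_integral_cbox[OF ul])
    show "continuous_on (cbox 0 1) (\<lambda>t. \<Sum>n<N. g n t)" for N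
      unfolding g_def using c by (intro continuous_intros continuous_on_powr_complex) (auto simp: complex_nonpos_Reals_iff complex_eq_iff add_pos_nonneg)
  qed auto
  have "I = (\<lambda>N. \<Sum>n<N. f n * (1 / (c + of_nat n + 1)))" using has_integral_unique[OF IJ(1) int] by auto
  then have "(\<lambda>n. f n / (c + 1 + of_nat n)) sums J" using IJ(3) unfolding sums_def by (simp add: add_ac)
  then have J: "(\<Sum>n. f n / (c + 1 + of_nat n)) = J" and "summable (\<lambda>n. f n / (c + 1 + of_nat n))" by (auto simp: sums_iff)
  then show "summable (\<lambda>n. f n / (c + 1 + of_nat n))" by simp
  have "(\<Sum>n. g n t) = of_real t powr c * (\<Sum>n. f n * of_real t ^ n)" if t: "t \<in> {0..1}" for t
  proof -
    have "summable (\<lambda>n. f n * of_real t ^ n)"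
    proof (rule summable_comparison_test'[OF f])
      show "norm (f n * of_real t ^ n) \<le> norm (f n)" for n
        using t power_le_one[of t n] mult_left_mono[of "t ^ n" 1 "norm (f n)"] by (simp add: norm_mult norm_power)
    qed
    then show ?thesis unfolding g_def tn[OF t] by (subst suminf_mult[symmetric]) (simp_all add: mult_ac)
  qed
  then show "((\<lambda>t. of_real t powr c * (\<Sum>n. f n * of_real t ^ n)) has_integral (\<Sum>n. f n / (c + 1 + of_nat n))) {0..1}"
    using IJ(2) unfolding J by (subst has_integral_cong[symmetric]) auto
qed

context hypergeo
begin

lemma F_tendsto:
  assumes k: "k \<in> {1..p}"
  shows "(\<lambda>n. F k (Suc n) * exp (psi p a b * of_real (ln (real n)))) \<longlonglongrightarrow> (\<Prod>i=1..p. rGamma (1 - b i + a k) / rGamma (1 - a i + a k))"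
proof -
  have "1 - a i + a k \<notin> \<int>\<^sub>\<le>\<^sub>0" if "i \<in> {1..p}" for i
  proof
    assume "1 - a i + a k \<in> \<int>\<^sub>\<le>\<^sub>0"
    then obtain n where "1 - a i + a k = - of_nat n" by (elim nonpos_Ints_cases')
    then show False using a_add_nat_not_0[OF that k, of n] by simp
  qed
  from pochhammer_prod_tendsto[of "{1..p}" "\<lambda>i. 1 - a i + a k" "\<lambda>i. 1 - b i + a k", OF _ this]
  show ?thesis by (simp add: F_def psi_def)
qed

text \<open>By \<open>F_tendsto\<close> the coefficient \<open>F k n\<close> is O(n^(-Re psi_p));
  the polynomial weight costs n^j.\<close>

lemma summable_F:
  assumes k: "k \<in> {1..p}" and j: "real j + 1 < Re (psi p a b)"
  shows "summable (\<lambda>n. norm ((a k + of_nat n) ^ j * F k n))"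
proof -
  have "(\<lambda>n. ((a k + 1 + of_nat n) / (0 + of_nat n)) ^ j * (F k (Suc n) * exp (psi p a b * of_real (ln (real n)))))
    \<longlonglongrightarrow> 1 ^ j * (\<Prod>i=1..p. rGamma (1 - b i + a k) / rGamma (1 - a i + a k))"
    by (intro tendsto_intros ratio_tendsto_1 F_tendsto k)
  then have "Bseq (\<lambda>n. ((a k + 1 + of_nat n) / (0 + of_nat n)) ^ j * (F k (Suc n) * exp (psi p a b * of_real (ln (real n)))))"
    by (intro convergent_imp_Bseq convergentI)
  then obtain C where C: "\<And>n. norm (((a k + 1 + of_nat n) / (0 + of_nat n)) ^ j * (F k (Suc n) * exp (psi p a b * of_real (ln (real n))))) \<le> C"
    by (auto simp: Bseq_def)
  have le: "norm ((a k + of_nat (Suc n)) ^ j * F k (Suc n)) \<le> C * real n powr (real j - Re (psi p a b))" if n: "n \<ge> 1" for n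
  proof -
    have e: "norm (exp (psi p a b * of_real (ln (real n)))) = real n powr Re (psi p a b)"
      using n by (simp add: powr_def)
    have "norm (((a k + 1 + of_nat n) / (0 + of_nat n)) ^ j * (F k (Suc n) * exp (psi p a b * of_real (ln (real n))))) =
       norm ((a k + of_nat (Suc n)) ^ j * F k (Suc n)) * (real n powr Re (psi p a b) / real n powr real j)"
      using n by (simp add: norm_mult norm_power norm_divide power_divide powr_realpow e add_ac del: norm_exp_eq_Re)
    also have "\<dots> = norm ((a k + of_nat (Suc n)) ^ j * F k (Suc n)) / real n powr (real j - Re (psi p a b))"
      by (simp add: powr_diff)
    finally have "norm ((a k + of_nat (Suc n)) ^ j * F k (Suc n)) / real n powr (real j - Re (psi p a b)) \<le> C"
      using C[of n] by simp
    moreover have "real n powr (real j - Re (psi p a b)) > 0" using n by simp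
    ultimately show ?thesis by (simp only: pos_divide_le_eq)
  qed
  have "summable (\<lambda>n. norm ((a k + of_nat (Suc n)) ^ j * F k (Suc n)))"
  proof (rule summable_comparison_test'[where N = 1 and g = "\<lambda>n. C * real n powr (real j - Re (psi p a b))"])
    show "summable (\<lambda>n. C * real n powr (real j - Re (psi p a b)))"
      using j by (intro summable_mult) (simp add: summable_real_powr_iff)
  qed (use le in \<open>simp only: real_norm_def abs_norm_cancel\<close>)
  then show ?thesis
    using summable_Suc_iff[of "\<lambda>n. norm ((a k + of_nat n) ^ j * F k n)"] by blast
qed

text \<open>Dominated convergence: \<open>summable_F\<close> provides the majorant at t = 1.\<close>

lemma tendsto_G:
  assumes k: "k \<in> {1..p}" and j: "real j + 1 < Re (psi p a b)"
  shows "((\<lambda>t. Y0 k j (of_real t)) \<longlongrightarrow> (\<Sum>n. (a k + of_nat n) ^ j * F k n)) (at_left 1)"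
proof -
  note ev = unit_interval_at_left
  have "((\<lambda>t. \<Sum>n. fps_nth (G k j) n * of_real t ^ n) \<longlongrightarrow> (\<Sum>n. (a k + of_nat n) ^ j * F k n)) (at_left 1)"
  proof (rule conjunct2[OF conjunct2[OF tannerys_theorem]])
    show "((\<lambda>t. fps_nth (G k j) n * of_real t ^ n) \<longlongrightarrow> (a k + of_nat n) ^ j * F k n) (at_left 1)" for n
      unfolding G_nth by (auto intro!: tendsto_eq_intros)
    show "summable (\<lambda>n. norm ((a k + of_nat n) ^ j * F k n))" by (rule summable_F) fact+
    have "eventually (\<lambda>t. \<forall>n. norm (fps_nth (G k j) n * of_real t ^ n) \<le> norm ((a k + of_nat n) ^ j * F k n)) (at_left (1::real))"
      using ev
    proof eventually_elim
      case (elim t)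
      then show ?case unfolding G_nth
        by (auto simp: norm_mult norm_power intro!: mult_left_le power_le_one)
    qed
    then have "eventually (\<lambda>(n::nat, t). \<forall>n. norm (fps_nth (G k j) n * of_real t ^ n) \<le> norm ((a k + of_nat n) ^ j * F k n)) (sequentially \<times>\<^sub>F at_left (1::real))"
      by (subst eventually_prod2) auto
    then show "eventually (\<lambda>(n, t). norm (fps_nth (G k j) n * of_real t ^ n) \<le> norm ((a k + of_nat n) ^ j * F k n)) (sequentially \<times>\<^sub>F at_left (1::real))"
      by (rule eventually_mono) auto
  qed auto
  moreover have "((\<lambda>t. complex_of_real t powr a k) \<longlongrightarrow> of_real 1 powr a k) (at_left 1)"
    by (intro tendsto_intros) auto
  ultimately have "((\<lambda>t. complex_of_real t powr a k * (\<Sum>n. fps_nth (G k j) n * of_real t ^ n)) \<longlongrightarrow> of_real 1 powr a k * (\<Sum>n. (a k + of_nat n) ^ j * F k n)) (at_left 1)"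
    by (rule tendsto_mult[rotated])
  then show ?thesis by (simp add: Y0_def[abs_def] eval_fps_def)
qed

text \<open>The residue at s = -a_k of the gamma quotient in Meijer's integral; the c_k of the
  overview.\<close>

definition res_coeff :: "nat \<Rightarrow> complex" where
  "res_coeff k = (\<Prod>i\<in>{1..p} - {k}. Gamma (a i - a k)) * (\<Prod>i=1..p. rGamma (b i - a k))"

text \<open>The constant to which the periodic factor reduces: leading coefficient of the special
  solution times the factor Gamma(psi_p) produced by the beta integral.\<close>

definition special_const :: complex where "special_const = fps_nth special_fps 0 * Gamma (psi p a b)"

end

text \<open>\<open>d\<close> holds the coordinates of the special solution in the basis at z = 0.
  They exist by \<open>sol_span\<close>; the locale computes them, and \<open>u_eq_special\<close>
  instantiates it.\<close>

locale hypergeo_connection = hypergeo +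
  fixes d :: "nat \<Rightarrow> complex"
  assumes psi_large: "Re (psi p a b) > real p + 1"
    and d: "\<And>j z. j < p \<Longrightarrow> z \<in> lens \<Longrightarrow> Y1 rho special_start j z = (\<Sum>k=1..p. d k * Y0 k j z)"
begin

lemma Re_rho: "Re rho > 1" using psi_large by (simp add: rho_def)

lemmas frob_start_rho = frob_start_special_large[OF psi_large]

lemma summable_F': "k \<in> {1..p} \<Longrightarrow> j < p \<Longrightarrow> summable (\<lambda>n. norm ((a k + of_nat n) ^ j * F k n))"
  using psi_large by (intro summable_F) auto

lemma summable_F0: "k \<in> {1..p} \<Longrightarrow> summable (\<lambda>n. norm (F k n))"
  using summable_F'[of k 0] p_pos by simp

text \<open>As \<open>Re \<psi>_p\<close> is large, the special solution and its derivatives vanish at \<open>z = 1\<close>.\<close>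
lemma special_solution_moments:
  assumes j: "j < p"
  shows "(\<Sum>k=1..p. d k * (\<Sum>n. (a k + of_nat n) ^ j * F k n)) = 0"
proof (rule tendsto_unique)
  show "at_left (1::real) \<noteq> bot" by simp
  show "((\<lambda>t. \<Sum>k=1..p. d k * Y0 k j (complex_of_real t)) \<longlongrightarrow> (\<Sum>k=1..p. d k * (\<Sum>n. (a k + of_nat n) ^ j * F k n))) (at_left 1)"
    using psi_large j by (intro tendsto_intros tendsto_G) auto
  have ps: "on_disc (X1 rho special_start j)" using on_disc_X1[OF frob_start_rho j] .
  have "isCont (eval_fps (X1 rho special_start j)) 0" using on_disc_pos[OF ps]
    by (intro continuous_eval_fps) (auto simp: zero_ereal_def)
  then have "((\<lambda>t::real. eval_fps (X1 rho special_start j) (1 - of_real t)) \<longlongrightarrow> eval_fps (X1 rho special_start j) 0) (at_left 1)"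
    by (rule isCont_tendsto_compose) (auto intro!: tendsto_eq_intros)
  moreover have "((\<lambda>t. complex_of_real (1 - t) powr rho) \<longlongrightarrow> 0) (at_left 1)"
  proof -
    have "((\<lambda>t::real. (1 - t) powr Re rho) \<longlongrightarrow> 0) (at_left 1)"
      using Re_rho by (auto intro!: tendsto_eq_intros simp: eventually_at_left_field lt_ex)
    moreover have "eventually (\<lambda>t::real. (1 - t) powr Re rho = norm (complex_of_real (1 - t) powr rho)) (at_left 1)"
      using unit_interval_at_left by eventually_elim (subst norm_powr_real_powr, auto)
    ultimately have "((\<lambda>t. norm (complex_of_real (1 - t) powr rho)) \<longlongrightarrow> 0) (at_left 1)"
      by (rule Lim_transform_eventually)
    then show ?thesis by (rule tendsto_norm_zero_cancel)
  qed
  ultimately have "((\<lambda>t. complex_of_real (1 - t) powr rho * eval_fps (X1 rho special_start j) (1 - of_real t)) \<longlongrightarrow> 0 * eval_fps (X1 rho special_start j) 0) (at_left 1)"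
    by (rule tendsto_mult[rotated])
  then have lim: "((\<lambda>t. complex_of_real (1 - t) powr rho * eval_fps (X1 rho special_start j) (1 - of_real t)) \<longlongrightarrow> 0) (at_left 1)" by simp
  note ev = unit_interval_at_left
  have "eventually (\<lambda>t::real. complex_of_real (1 - t) powr rho * eval_fps (X1 rho special_start j) (1 - of_real t) = (\<Sum>k=1..p. d k * Y0 k j (complex_of_real t))) (at_left 1)"
    using ev
  proof eventually_elim
    case (elim t)
    then have "complex_of_real t \<in> lens" by simp
    from d[OF j this] show ?case by (simp add: Y1_def)
  qed
  from Lim_transform_eventually[OF lim this]
  show "((\<lambda>t. \<Sum>k=1..p. d k * Y0 k j (complex_of_real t)) \<longlongrightarrow> 0) (at_left 1)" .
qed

lemma special_solution_moments_poly:
  assumes B: "degree B < p"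
  shows "k \<in> {1..p} \<Longrightarrow> summable (\<lambda>n. poly B (a k + of_nat n) * F k n)"
    "(\<Sum>k=1..p. d k * (\<Sum>n. poly B (a k + of_nat n) * F k n)) = 0"
proof -
  have B: "poly B x = (\<Sum>j<p. coeff B j * x ^ j)" for x
  proof -
    have "(\<Sum>j\<le>degree B. coeff B j * x ^ j) = (\<Sum>j<p. coeff B j * x ^ j)"
      using B by (intro sum.mono_neutral_left) (auto simp: coeff_eq_0)
    then show ?thesis by (simp add: poly_altdef)
  qed
  have sm: "summable (\<lambda>n. (a k + of_nat n) ^ j * F k n)" if "k \<in> {1..p}" "j < p" for k j
    using summable_norm_cancel[OF summable_F'[OF that]] .
  have eq: "poly B (a k + of_nat n) * F k n = (\<Sum>j<p. coeff B j * ((a k + of_nat n) ^ j * F k n))" for k n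
    by (simp add: B sum_distrib_right mult.assoc)
  have ss: "(\<lambda>n. poly B (a k + of_nat n) * F k n) sums (\<Sum>j<p. coeff B j * (\<Sum>n. (a k + of_nat n) ^ j * F k n))" if "k \<in> {1..p}" for k
    unfolding eq using sm[OF that] by (intro sums_sum sums_mult summable_sums) auto
  then show "k \<in> {1..p} \<Longrightarrow> summable (\<lambda>n. poly B (a k + of_nat n) * F k n)" by (auto simp: sums_iff)
  have "(\<Sum>k=1..p. d k * (\<Sum>n. poly B (a k + of_nat n) * F k n)) =
      (\<Sum>k=1..p. \<Sum>j<p. coeff B j * (d k * (\<Sum>n. (a k + of_nat n) ^ j * F k n)))"
    using ss by (intro sum.cong) (auto simp: sums_iff sum_distrib_left mult_ac)
  also have "\<dots> = (\<Sum>j<p. coeff B j * (\<Sum>k=1..p. d k * (\<Sum>n. (a k + of_nat n) ^ j * F k n)))"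
    by (subst sum.swap) (simp add: sum_distrib_left)
  also have "\<dots> = 0" using special_solution_moments by simp
  finally show "(\<Sum>k=1..p. d k * (\<Sum>n. poly B (a k + of_nat n) * F k n)) = 0" .
qed

text \<open>The Mellin transform of the special solution, expanded in partial fractions.\<close>
definition T :: "complex \<Rightarrow> complex" where
  "T s = (\<Sum>k=1..p. d k * (\<Sum>n. F k n / (s + a k + of_nat n)))"

text \<open>The Mellin transform of P(theta) y. It is evaluated once through P and once through Q.
  At s = -a_k the critical summand has numerator 0, so \<open>W\<close> remains meaningful where
  \<open>T\<close> has a pole.\<close>

definition W :: "complex \<Rightarrow> complex" where
  "W s = (\<Sum>k=1..p. d k * (\<Sum>n. poly P (a k + of_nat n) * F k n / (s + a k + of_nat n)))"

definition pole_free :: "complex \<Rightarrow> bool" where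
  "pole_free s \<longleftrightarrow> (\<forall>k\<in>{1..p}. \<forall>n. s + a k + of_nat n \<noteq> 0)"

lemma pole_free_Suc: "pole_free s \<Longrightarrow> pole_free (s + 1)"
  unfolding pole_free_def by (metis add.assoc add.commute of_nat_Suc)

lemma summable_T:
  assumes k: "k \<in> {1..p}"
  shows "summable (\<lambda>n. F k n / (s + a k + of_nat n))"
proof -
  have "(\<lambda>n. 1 / norm (of_nat n + (s + a k))) \<longlonglongrightarrow> 0" by (rule inverse_norm_tendsto_0)
  then have "Bseq (\<lambda>n. 1 / norm (of_nat n + (s + a k)))" by (intro convergent_imp_Bseq convergentI)
  then obtain C where C: "\<And>n. 1 / norm (of_nat n + (s + a k)) \<le> C"
    unfolding Bseq_def by (force intro: order_trans[OF abs_ge_self])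
  show ?thesis
  proof (rule summable_comparison_test')
    show "summable (\<lambda>n. C * norm (F k n))" using summable_F0[OF k] by (rule summable_mult)
    fix n
    show "norm (F k n / (s + a k + of_nat n)) \<le> C * norm (F k n)"
      using mult_right_mono[OF C[of n], of "norm (F k n)"] by (simp add: norm_divide add_ac)
  qed
qed

lemma poly_diff_dvd:
  fixes R :: "complex poly" and c :: complex
  assumes "degree R = p"
  obtains B where "degree B < p" "\<And>t. poly R t - poly R c = (t - c) * poly B t"
proof -
  have "[:- c, 1:] dvd R - [:poly R c:]" by (simp add: poly_eq_0_iff_dvd[symmetric])
  then obtain B where B: "R - [:poly R c:] = [:- c, 1:] * B" by (elim dvdE)
  have "poly R t - poly R c = (t - c) * poly B t" for t
    using arg_cong[OF B, of "\<lambda>R. poly R t"] by (simp add: algebra_simps)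
  moreover have "degree B < p"
  proof (cases "B = 0")
    case False
    have "degree (R - [:poly R c:]) \<le> p" using assms by (intro degree_diff_le) auto
    then show ?thesis unfolding B using False by (subst (asm) degree_mult_eq) auto
  qed (use p_pos in simp)
  ultimately show ?thesis using that by blast
qed

text \<open>R(t) - R(-s) is t + s times a polynomial of degree below p. The latter cancels the
  denominator, and its contribution vanishes by the moment conditions; this is partial integration
  without boundary terms.\<close>

lemma poly_weighted_sum:
  assumes R: "degree R = p" and s: "pole_free s"
  shows "k \<in> {1..p} \<Longrightarrow> summable (\<lambda>n. poly R (a k + of_nat n) * F k n / (s + a k + of_nat n))"
    "(\<Sum>k=1..p. d k * (\<Sum>n. poly R (a k + of_nat n) * F k n / (s + a k + of_nat n))) = poly R (- s) * T s"
proof -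
  obtain B where B: "degree B < p" "\<And>t. poly R t - poly R (- s) = (t - (- s)) * poly B t"
    using poly_diff_dvd[OF R] by blast
  have eq: "poly R (a k + of_nat n) * F k n / (s + a k + of_nat n) =
      poly R (- s) * (F k n / (s + a k + of_nat n)) + poly B (a k + of_nat n) * F k n" if k: "k \<in> {1..p}" for k n
  proof -
    have nz: "s + a k + of_nat n \<noteq> 0" using s k by (auto simp: pole_free_def)
    have "poly R (a k + of_nat n) = poly R (- s) + (s + a k + of_nat n) * poly B (a k + of_nat n)"
      using B(2)[of "a k + of_nat n"] by (simp add: algebra_simps)
    then show ?thesis using nz by (simp add: field_simps)
  qed
  have sums: "(\<lambda>n. poly R (a k + of_nat n) * F k n / (s + a k + of_nat n)) sums
      (poly R (- s) * (\<Sum>n. F k n / (s + a k + of_nat n)) + (\<Sum>n. poly B (a k + of_nat n) * F k n))"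
    if k: "k \<in> {1..p}" for k
    unfolding eq[OF k] using summable_T[OF k, of s] special_solution_moments_poly(1)[OF B(1) k]
    by (intro sums_add sums_mult summable_sums)
  then show "k \<in> {1..p} \<Longrightarrow> summable (\<lambda>n. poly R (a k + of_nat n) * F k n / (s + a k + of_nat n))"
    by (auto simp: sums_iff)
  have "(\<Sum>k=1..p. d k * (\<Sum>n. poly R (a k + of_nat n) * F k n / (s + a k + of_nat n))) =
      (\<Sum>k=1..p. d k * (poly R (- s) * (\<Sum>n. F k n / (s + a k + of_nat n)) + (\<Sum>n. poly B (a k + of_nat n) * F k n)))"
    using sums by (intro sum.cong) (auto simp: sums_iff)
  also have "\<dots> = poly R (- s) * T s + (\<Sum>k=1..p. d k * (\<Sum>n. poly B (a k + of_nat n) * F k n))"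
    unfolding T_def by (simp add: sum.distrib ring_distribs sum_distrib_left mult_ac)
  finally show "(\<Sum>k=1..p. d k * (\<Sum>n. poly R (a k + of_nat n) * F k n / (s + a k + of_nat n))) = poly R (- s) * T s"
    using special_solution_moments_poly(2)[OF B(1)] by simp
qed

lemma W_eq_P: "pole_free s \<Longrightarrow> W s = poly P (- s) * T s"
  unfolding W_def by (rule poly_weighted_sum(2)[OF degree_P])

text \<open>The summand n = 0 is zero since P(a_k) = 0, and \<open>F_Suc\<close> turns summand n + 1
  for \<open>P\<close> at s into summand n for \<open>Q\<close> at s + 1. Regularity is required
  only at s + 1, so s = -a_k is allowed.\<close>

lemma W_eq_Q:
  assumes s: "pole_free (s + 1)"
  shows "W s = poly Q (- s - 1) * T (s + 1)"
proof -
  have "(\<Sum>n. poly P (a k + of_nat n) * F k n / (s + a k + of_nat n)) =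
      (\<Sum>n. poly Q (a k + of_nat n) * F k n / (s + 1 + a k + of_nat n))" if k: "k \<in> {1..p}" for k
  proof -
    have "poly P (a k + of_nat (Suc n)) * F k (Suc n) / (s + a k + of_nat (Suc n)) =
        poly Q (a k + of_nat n) * F k n / (s + 1 + a k + of_nat n)" for n
      unfolding F_Suc(1)[OF k] by (simp add: add_ac)
    with summable_sums[OF poly_weighted_sum(1)[OF degree_Q s k]]
    have "(\<lambda>n. poly P (a k + of_nat (Suc n)) * F k (Suc n) / (s + a k + of_nat (Suc n))) sums
      (\<Sum>n. poly Q (a k + of_nat n) * F k n / (s + 1 + a k + of_nat n))" by (simp only:)
    then show ?thesis by (subst (asm) sums_Suc_iff) (use k in \<open>simp add: sums_iff\<close>)
  qed
  then show ?thesis unfolding W_def using poly_weighted_sum(2)[OF degree_Q s] by simp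
qed

text \<open>Writing P(t) = (t - a_k) B(t), every fraction cancels to a value of B except the one
  with l = k and n = 0, which is 0 / 0 and counts as 0. The complete sum with weight B vanishes by
  the moment conditions, so minus the missing summand remains. This replaces the residue of
  \<open>T\<close> at -a_k.\<close>

lemma W_at_a:
  assumes k: "k \<in> {1..p}"
  shows "W (- a k) = - d k * (\<Prod>i\<in>{1..p} - {k}. a k - a i)"
proof -
  define B where "B = (\<Prod>i\<in>{1..p} - {k}. [:- a i, 1:])"
  have degB: "degree B < p" using coeff_prod_monic[of "{1..p} - {k}" "\<lambda>i. - a i"] k
    by (auto simp: B_def card_Diff_singleton)
  have PB: "poly P t = (t - a k) * poly B t" for t
    unfolding poly_P B_def using k by (subst prod.remove[of _ k]) (auto simp: poly_prod)
  have trm: "(\<Sum>n. poly P (a l + of_nat n) * F l n / (- a k + a l + of_nat n)) =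
     (\<Sum>n. poly B (a l + of_nat n) * F l n) - (if l = k then poly B (a k) else 0)"
    if l: "l \<in> {1..p}" for l
  proof -
    have eq: "poly P (a l + of_nat n) * F l n / (- a k + a l + of_nat n) =
      poly B (a l + of_nat n) * F l n - (if n = 0 then (if l = k then poly B (a k) else 0) else 0)" for n
    proof (cases "l = k \<and> n = 0")
      case False
      have "a l + of_nat n - a k \<noteq> 0"
      proof
        assume "a l + of_nat n - a k = 0"
        then have eq: "a k - a l = of_nat n" by (simp add: algebra_simps)
        then have "k = l" using a_diff[OF k l] by auto
        then show False using eq False by auto
      qed
      moreover have "- a k + a l + of_nat n = a l + of_nat n - a k" by simp
      ultimately show ?thesis using False
        by (simp only: PB mult.assoc nonzero_mult_div_cancel_left) auto
    qed (use k in \<open>auto simp: P_a\<close>)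
    have "(\<lambda>n. poly P (a l + of_nat n) * F l n / (- a k + a l + of_nat n)) sums
      ((\<Sum>n. poly B (a l + of_nat n) * F l n) - (if l = k then poly B (a k) else 0))"
      unfolding eq using special_solution_moments_poly(1)[OF degB l] sums_single[of 0 "\<lambda>n. if l = k then poly B (a k) else 0"]
      by (intro sums_diff summable_sums) (auto simp: eq_commute cong: if_cong)
    then show ?thesis by (simp add: sums_iff)
  qed
  have "W (- a k) = (\<Sum>l=1..p. d l * ((\<Sum>n. poly B (a l + of_nat n) * F l n) - (if l = k then poly B (a k) else 0)))"
    unfolding W_def by (intro sum.cong) (use trm in auto)
  also have "\<dots> = (\<Sum>l=1..p. d l * (\<Sum>n. poly B (a l + of_nat n) * F l n)) - (\<Sum>l=1..p. if l = k then d k * poly B (a k) else 0)"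
    unfolding right_diff_distrib sum_subtractf by (intro arg_cong2[of _ _ _ _ "(-)"] sum.cong) auto
  also have "\<dots> = - d k * poly B (a k)" using special_solution_moments_poly(2)[OF degB] k by simp
  finally show ?thesis by (simp add: B_def poly_prod)
qed

lemma T_Suc:
  assumes s: "pole_free s"
  shows "T s = (\<Prod>i=1..p. (s + b i) / (s + a i)) * T (s + 1)"
proof -
  have "poly P (- s) = (-1) ^ p * (\<Prod>i=1..p. s + a i)" "poly Q (- s - 1) = (-1) ^ p * (\<Prod>i=1..p. s + b i)"
    unfolding poly_P poly_Q using prod.distrib[of "\<lambda>_. - 1" "\<lambda>i. s + a i" "{1..p}"] prod.distrib[of "\<lambda>_. - 1" "\<lambda>i. s + b i" "{1..p}"]
    by (simp_all add: algebra_simps)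
  moreover have "(\<Prod>i=1..p. s + a i) \<noteq> 0" using s by (auto simp: pole_free_def) (metis add.right_neutral of_nat_0 atLeastAtMost_iff One_nat_def)
  ultimately show ?thesis using W_eq_P[OF s] W_eq_Q[OF pole_free_Suc[OF s]] by (simp add: prod_dividef field_simps)
qed

lemma T_add_nat:
  assumes s: "pole_free s"
  shows "T s = (\<Prod>i=1..p. pochhammer (s + b i) n / pochhammer (s + a i) n) * T (s + of_nat n)" "pole_free (s + of_nat n)"
proof (induction n)
  case (Suc n)
  show r: "pole_free (s + of_nat (Suc n))" using pole_free_Suc[OF Suc.IH(2)] by (simp add: add_ac)
  show "T s = (\<Prod>i=1..p. pochhammer (s + b i) (Suc n) / pochhammer (s + a i) (Suc n)) * T (s + of_nat (Suc n))"
    using T_Suc[OF Suc.IH(2)] Suc.IH(1) by (simp add: pochhammer_Suc prod.distrib add_ac mult_ac prod_dividef)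
qed (use s in auto)

end

lemma fps_split_first: "(f :: complex fps) = fps_const (fps_nth f 0) + fps_X * fps_shift 1 f"
proof (rule fps_ext)
  fix n show "fps_nth f n = fps_nth (fps_const (fps_nth f 0) + fps_X * fps_shift 1 f) n" by (cases n) auto
qed

context hypergeo_connection
begin

text \<open>Near t = 1 the leading term is removed from a power series in 1 - t, which gains one
  power of 1 - t. Away from t = 1 both terms are bounded while (1 - t)^(Re psi_p) is bounded
  below.\<close>

lemma special_solution_bound:
  assumes s: "\<And>k. k \<in> {1..p} \<Longrightarrow> Re (s + a k) > 0"
  obtains C where "\<And>t. t \<in> {0<..<1} \<Longrightarrow>
    norm (of_real t powr s * Y1 rho special_start 0 (of_real t) - fps_nth special_fps 0 * of_real (1 - t) powr (psi p a b - 1))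
      \<le> C * (1 - t) powr Re (psi p a b)"
proof -
  let ?v = "fps_nth special_fps 0" and ?r = "Re (psi p a b)"
  have r: "?r > 1" using psi_large by simp
  define D where "D = fps_shift 1 (binom_fps s * special_fps)"
  have special_fps: "on_disc special_fps" by (rule on_disc_special_fps[OF frob_start_rho])
  have psD: "on_disc D" using on_disc_mult[OF on_disc_binom_fps[of s] special_fps] by (simp add: D_def on_disc_def)
  have "continuous_on (cball 0 (1/2)) (eval_fps D)"
    by (rule continuous_on_subset[OF continuous_on_eval_fps]) (auto simp: in_eball_iff intro!: on_disc_less psD)
  then have "bounded (eval_fps D ` cball 0 (1/2))"
    by (intro compact_imp_bounded compact_continuous_image) auto
  then obtain C1 where "\<forall>x\<in>cball 0 (1/2). norm (eval_fps D x) \<le> C1"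
    by (auto simp: bounded_iff)
  then have C1: "norm x \<le> 1/2 \<Longrightarrow> norm (eval_fps D x) \<le> C1" for x by simp
  \<comment> \<open>The power of 2 compensates for 1 - t being at least 1/2 on the second
    half.\<close>
  define C2 where "C2 = ((\<Sum>k=1..p. norm (d k) * (\<Sum>n. norm (F k n))) + norm ?v) * 2 powr ?r"
  show ?thesis
  proof (rule that[of "max C1 C2"])
    fix t :: real assume t: "t \<in> {0<..<1}"
    define x where "x = 1 - t"
    have x: "0 < x" "x < 1" "complex_of_real t \<in> lens" using t by (auto simp: x_def)
    have nx: "norm (complex_of_real x powr c) = x powr Re c" for c
      using x by (subst norm_powr_real_powr) auto
    let ?E = "norm (of_real t powr s * Y1 rho special_start 0 (of_real t) - ?v * of_real (1 - t) powr (psi p a b - 1))"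
    consider "t \<ge> 1/2" | "t \<le> 1/2" by linarith
    then have "?E \<le> C1 * x powr ?r \<or> ?E \<le> C2 * x powr ?r"
    proof cases
      case 1
      have "binom_fps s * special_fps = fps_const ?v + fps_X * D"
        using fps_split_first[of "binom_fps s * special_fps"] by (simp add: D_def binom_fps_def)
      then have "eval_fps (binom_fps s * special_fps) (of_real x) = eval_fps (fps_const ?v + fps_X * D) (of_real x)" by simp
      then have A: "of_real t powr s * eval_fps special_fps (of_real x) = ?v + of_real x * eval_fps D (of_real x)"
        using x special_fps psD eval_binom_fps[of "of_real t" s] lensD(2)[OF x(3)] by (simp add: x_def)
      have B: "of_real t powr s * Y1 rho special_start 0 (of_real t) = of_real x powr (psi p a b - 1) * (of_real t powr s * eval_fps special_fps (of_real x))"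
        unfolding Y1_special[OF frob_start_rho x(3)] by (simp add: x_def)
      have "w * (v + y * e) - v * w = w * y * e" for w v y e :: complex by (simp add: algebra_simps)
      then have "of_real t powr s * Y1 rho special_start 0 (of_real t) - ?v * of_real (1 - t) powr (psi p a b - 1) =
         of_real x powr (psi p a b - 1) * of_real x * eval_fps D (of_real x)"
        by (simp only: B A x_def[symmetric])
      also have "of_real x powr (psi p a b - 1) * of_real x = of_real x powr (psi p a b)"
        using x by (simp add: powr_diff)
      finally have "?E = x powr ?r * norm (eval_fps D (of_real x))" by (simp add: norm_mult nx)
      also have "\<dots> \<le> x powr ?r * C1"
      proof (rule mult_left_mono)
        have "x \<le> 1/2" using 1 unfolding x_def by simp
        then have "norm (complex_of_real x) \<le> 1/2" using x(1) by simp
        then show "norm (eval_fps D (of_real x)) \<le> C1" by (rule C1)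
      qed simp
      finally show ?thesis by (simp add: mult.commute)
    next
      case 2
      have Fk: "norm (of_real t powr s * Y0 k 0 (of_real t)) \<le> (\<Sum>n. norm (F k n))" if k: "k \<in> {1..p}" for k
      proof -
        have "norm (complex_of_real t powr (s + a k)) = t powr Re (s + a k)"
          using t by (subst norm_powr_real_powr) auto
        also have "\<dots> \<le> 1 powr Re (s + a k)" using t s[OF k] by (intro powr_mono2) auto
        finally have 1: "norm (complex_of_real t powr (s + a k)) \<le> 1" by simp
        have le: "norm (F k n * of_real t ^ n) \<le> norm (F k n)" for n
          using t power_le_one[of t n] mult_left_mono[of "t ^ n" 1 "norm (F k n)"] by (simp add: norm_mult norm_power)
        have "norm (\<Sum>n. F k n * of_real t ^ n) \<le> (\<Sum>n. norm (F k n))"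
          using le by (intro norm_suminf_le summable_F0 k)
        with 1 have "norm (complex_of_real t powr (s + a k)) * norm (\<Sum>n. F k n * of_real t ^ n) \<le> 1 * (\<Sum>n. norm (F k n))"
          by (intro mult_mono) auto
        then show ?thesis by (simp add: Y0_def eval_fps_def powr_add norm_mult mult.assoc)
      qed
      have "norm (of_real t powr s * Y1 rho special_start 0 (of_real t)) = norm (\<Sum>k=1..p. d k * (of_real t powr s * Y0 k 0 (of_real t)))"
        using d[of 0, OF _ x(3)] p_pos by (simp add: sum_distrib_left mult_ac)
      also have "\<dots> \<le> (\<Sum>k=1..p. norm (d k) * (\<Sum>n. norm (F k n)))"
        using Fk by (intro sum_norm_le) (auto simp: norm_mult intro!: mult_left_mono)
      finally have A: "norm (of_real t powr s * Y1 rho special_start 0 (of_real t)) \<le> (\<Sum>k=1..p. norm (d k) * (\<Sum>n. norm (F k n)))" .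
      have "norm (complex_of_real (1 - t) powr (psi p a b - 1)) \<le> 1 powr (?r - 1)"
        using nx[of "psi p a b - 1"] x r unfolding x_def by simp (intro powr_le1, auto)
      then have B: "norm (?v * of_real (1 - t) powr (psi p a b - 1)) \<le> norm ?v"
        using mult_left_mono[of _ 1 "norm ?v"] by (simp add: norm_mult)
      have "?E \<le> (\<Sum>k=1..p. norm (d k) * (\<Sum>n. norm (F k n))) + norm ?v"
        using A B norm_triangle_ineq4 order_trans add_mono by meson
      also have "\<dots> \<le> C2 * x powr ?r"
      proof -
        have "1 = 2 powr ?r * (1/2) powr ?r" by (simp add: powr_mult[symmetric])
        also have "\<dots> \<le> 2 powr ?r * x powr ?r" using 2 r by (intro mult_left_mono powr_mono2) (auto simp: x_def)
        finally have "1 \<le> 2 powr ?r * x powr ?r" .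
        moreover have "(\<Sum>k=1..p. norm (d k) * (\<Sum>n. norm (F k n))) + norm ?v \<ge> 0"
          by (intro add_nonneg_nonneg sum_nonneg mult_nonneg_nonneg suminf_nonneg summable_F0) auto
        ultimately show ?thesis unfolding C2_def mult.assoc using mult_left_mono by fastforce
      qed
      finally show ?thesis ..
    qed
    then show "?E \<le> max C1 C2 * (1 - t) powr ?r"
      using mult_right_mono[of C1 "max C1 C2" "x powr ?r"] mult_right_mono[of C2 "max C1 C2" "x powr ?r"]
      unfolding x_def[symmetric] by fastforce
  qed
qed

text \<open>
  Watson's lemma: the factor \<open>t ^ n\<close> concentrates the Mellin integral at \<open>t = 1\<close>, where the special
  solution is \<open>(1 - t) powr (\<psi>_p - 1)\<close> to leading order.
\<close>
lemma T_asymptotics: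
  assumes s: "\<And>k. k \<in> {1..p} \<Longrightarrow> Re (s + a k) > 0"
  shows "(\<lambda>n. T (s + 1 + of_nat n) * exp (psi p a b * of_real (ln (real n)))) \<longlonglongrightarrow> special_const"
proof -
  let ?\<psi> = "psi p a b" and ?v = "fps_nth special_fps 0"
  have r: "Re ?\<psi> > 1" using psi_large by simp
  obtain C where C: "\<And>t. t \<in> {0<..<1} \<Longrightarrow>
    norm (of_real t powr s * Y1 rho special_start 0 (of_real t) - ?v * of_real (1 - t) powr (?\<psi> - 1)) \<le> C * (1 - t) powr Re ?\<psi>"
    using special_solution_bound[OF s] by blast
  \<comment> \<open>\<open>J\<close> and \<open>R\<close> are the beta integrals of the leading term
    and of the error bound. The extra power of 1 - t in the error makes \<open>R n\<close> smaller
    than n^(-Re psi_p) by a factor of order 1/n.\<close>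
  define c where "c = Re ?\<psi> + 1"
  define J where "J n = fact n / pochhammer ?\<psi> (Suc n)" for n
  define R where "R n = fact n / pochhammer c (Suc n)" for n
  \<comment> \<open>Integrating the power with exponent s + n raises the exponent by one, hence the
    argument s + 1 + n of \<open>T\<close>.\<close>
  have intT: "((\<lambda>t. of_real t ^ n * (of_real t powr s * Y1 rho special_start 0 (of_real t))) has_integral T (s + 1 + of_nat n)) {0<..<1}" for n
  proof -
    have "((\<lambda>t. \<Sum>k=1..p. d k * (of_real t powr (s + a k + of_nat n) * (\<Sum>m. F k m * of_real t ^ m))) has_integral
       (\<Sum>k=1..p. d k * (\<Sum>m. F k m / (s + a k + of_nat n + 1 + of_nat m)))) {0..1}"
      using s summable_F0 by (intro has_integral_sum has_integral_mult_right has_integral_powr_series(1)) (auto simp: add_pos_nonneg)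
    also have "(\<Sum>k=1..p. d k * (\<Sum>m. F k m / (s + a k + of_nat n + 1 + of_nat m))) = T (s + 1 + of_nat n)"
      by (simp add: T_def add_ac)
    finally have "((\<lambda>t. \<Sum>k=1..p. d k * (of_real t powr (s + a k + of_nat n) * (\<Sum>m. F k m * of_real t ^ m))) has_integral
       T (s + 1 + of_nat n)) {0<..<1}" by (simp only: has_integral_Icc_iff_Ioo)
    then show ?thesis
    proof (subst has_integral_cong)
      fix t :: real assume t: "t \<in> {0<..<1}"
      then have tl: "complex_of_real t \<in> lens" by simp
      have "of_real t powr (s + a k + of_nat n) = of_real t ^ n * (of_real t powr s * of_real t powr a k)" for k
        using t by (simp add: powr_add powr_nat')
      then show "of_real t ^ n * (of_real t powr s * Y1 rho special_start 0 (of_real t)) =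
         (\<Sum>k=1..p. d k * (of_real t powr (s + a k + of_nat n) * (\<Sum>m. F k m * of_real t ^ m)))"
        using d[of 0, OF _ tl] p_pos by (simp add: Y0_def eval_fps_def sum_distrib_left mult_ac)
    qed
  qed
  have intJ: "((\<lambda>t. of_real t ^ n * of_real (1 - t) powr (?\<psi> - 1)) has_integral J n) {0<..<1}" for n
    using has_integral_beta_nat[OF r, of n] by (simp only: has_integral_Icc_iff_Ioo J_def)
  have intR: "((\<lambda>t. t ^ n * (1 - t) powr Re ?\<psi>) has_integral R n) {0<..<1}" for n
  proof -
    have "((\<lambda>t. of_real t ^ n * of_real (1 - t) powr (of_real c - 1)) has_integral fact n / pochhammer (complex_of_real c) (Suc n)) {0..1}"
      using r by (intro has_integral_beta_nat) (simp add: c_def)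
    then have "((\<lambda>t. Re (of_real t ^ n * of_real (1 - t) powr (of_real c - 1))) has_integral Re (fact n / pochhammer (complex_of_real c) (Suc n))) {0<..<1}"
      unfolding has_integral_Icc_iff_Ioo by (rule has_integral_Re)
    also have "fact n / pochhammer (complex_of_real c) (Suc n) = of_real (R n)"
      by (simp add: R_def pochhammer_of_real)
    finally have "((\<lambda>t. Re (of_real t ^ n * of_real (1 - t) powr (of_real c - 1))) has_integral R n) {0<..<1}" by simp
    then show ?thesis
    proof (subst has_integral_cong)
      fix t :: real assume t: "t \<in> {0<..<1}"
      have "complex_of_real (1 - t) powr (of_real c - 1) = of_real ((1 - t) powr (c - 1))"
        using t by (subst powr_of_real[symmetric]) auto
      then have "of_real t ^ n * of_real (1 - t) powr (of_real c - 1) = complex_of_real (t ^ n * (1 - t) powr (c - 1))" by simp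
      then show "t ^ n * (1 - t) powr Re ?\<psi> = Re (of_real t ^ n * of_real (1 - t) powr (of_real c - 1))"
        by (simp only: Re_complex_of_real) (simp add: c_def)
    qed
  qed
  have diff: "norm (T (s + 1 + of_nat n) - ?v * J n) \<le> C * R n" for n
  proof -
    let ?f = "\<lambda>t. of_real t ^ n * (of_real t powr s * Y1 rho special_start 0 (of_real t)) - ?v * (of_real t ^ n * of_real (1 - t) powr (?\<psi> - 1))"
    let ?g = "\<lambda>t::real. C * (t ^ n * (1 - t) powr Re ?\<psi>)"
    have f: "(?f has_integral (T (s + 1 + of_nat n) - ?v * J n)) {0<..<1}"
      by (intro has_integral_diff has_integral_mult_right intT intJ)
    have g: "(?g has_integral C * R n) {0<..<1}" by (intro has_integral_mult_right intR)
    have "norm (integral {0<..<1} ?f) \<le> integral {0<..<1} ?g"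
    proof (rule Henstock_Kurzweil_Integration.integral_norm_bound_integral)
      fix t :: real assume t: "t \<in> {0<..<1}"
      have "?f t = of_real t ^ n * (of_real t powr s * Y1 rho special_start 0 (of_real t) - ?v * of_real (1 - t) powr (?\<psi> - 1))"
        by (simp add: algebra_simps)
      then have "norm (?f t) = t ^ n * norm (of_real t powr s * Y1 rho special_start 0 (of_real t) - ?v * of_real (1 - t) powr (?\<psi> - 1))"
        using t by (simp only: norm_mult norm_power) simp
      also have "\<dots> \<le> t ^ n * (C * (1 - t) powr Re ?\<psi>)" using C[OF t] t by (intro mult_left_mono) auto
      finally show "norm (?f t) \<le> ?g t" by (simp add: mult_ac)
    qed (use f g in auto)
    then show ?thesis by (simp only: integral_unique[OF f] integral_unique[OF g])
  qed
  have psi_np: "?\<psi> \<notin> \<int>\<^sub>\<le>\<^sub>0" using r by (auto elim!: nonpos_Ints_cases)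
  have limJ: "(\<lambda>n. J n * exp (?\<psi> * of_real (ln (real n)))) \<longlonglongrightarrow> Gamma ?\<psi>"
    unfolding J_def by (rule fact_pochhammer_tendsto[OF psi_np])
  have limR: "(\<lambda>n. R n * exp (Re ?\<psi> * ln (real n))) \<longlonglongrightarrow> 0"
  proof -
    have "complex_of_real c \<notin> \<int>\<^sub>\<le>\<^sub>0" using r by (auto elim!: nonpos_Ints_cases simp: c_def complex_eq_iff)
    from fact_pochhammer_tendsto[OF this]
    have "(\<lambda>n. complex_of_real (R n * exp (c * ln (real n)))) \<longlonglongrightarrow> Gamma (of_real c)"
      by (simp add: R_def pochhammer_of_real exp_of_real[symmetric])
    then have "(\<lambda>n. R n * exp (c * ln (real n))) \<longlonglongrightarrow> Gamma c" by (simp only: Gamma_complex_of_real tendsto_of_real_iff)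
    moreover have "(\<lambda>n. 1 / real n) \<longlonglongrightarrow> 0" by (rule lim_1_over_n)
    ultimately have "(\<lambda>n. (R n * exp (c * ln (real n))) * (1 / real n)) \<longlonglongrightarrow> Gamma c * 0" by (rule tendsto_mult)
    moreover have "eventually (\<lambda>n. (R n * exp (c * ln (real n))) * (1 / real n) = R n * exp (Re ?\<psi> * ln (real n))) sequentially"
      using eventually_gt_at_top[of 0] by eventually_elim (simp add: c_def distrib_right exp_add)
    ultimately show ?thesis using Lim_transform_eventually by fastforce
  qed
  have "(\<lambda>n. (T (s + 1 + of_nat n) - ?v * J n) * exp (?\<psi> * of_real (ln (real n)))) \<longlonglongrightarrow> 0"
  proof (rule Lim_null_comparison)
    show "(\<lambda>n. C * (R n * exp (Re ?\<psi> * ln (real n)))) \<longlonglongrightarrow> 0" using tendsto_mult_right_zero[OF limR] .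
    have "norm ((T (s + 1 + of_nat n) - ?v * J n) * exp (?\<psi> * of_real (ln (real n)))) \<le> C * (R n * exp (Re ?\<psi> * ln (real n)))" for n
      using mult_right_mono[OF diff[of n], of "exp (Re ?\<psi> * ln (real n))"] by (simp add: norm_mult mult.assoc)
    then show "\<forall>\<^sub>F n in sequentially. norm ((T (s + 1 + of_nat n) - ?v * J n) * exp (?\<psi> * of_real (ln (real n)))) \<le> C * (R n * exp (Re ?\<psi> * ln (real n)))"
      by simp
  qed
  from tendsto_add[OF this tendsto_mult[OF tendsto_const[of ?v] limJ]]
  show ?thesis by (simp add: special_const_def algebra_simps)
qed

text \<open>Move s to the right by n: the pochhammer quotients grow like n^psi_p by Gauss's limit,
  and \<open>T\<close> decays like n^(-psi_p) by \<open>T_asymptotics\<close>, so the product of the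
  two limits is the value of \<open>T\<close>. The Mellin integral requires Re (s + a_k) > 0; other
  s are shifted there by the recurrence first.\<close>

lemma T_eq:
  assumes s: "pole_free s"
  shows "T s = special_const * (\<Prod>i=1..p. rGamma (s + b i) / rGamma (s + a i))"
proof -
  have np: "s + a i \<notin> \<int>\<^sub>\<le>\<^sub>0" if "pole_free s" "i \<in> {1..p}" for s i
  proof
    assume "s + a i \<in> \<int>\<^sub>\<le>\<^sub>0"
    then obtain n where "s + a i = - of_nat n" by (elim nonpos_Ints_cases')
    then have "s + a i + of_nat n = 0" by simp
    then show False using that by (auto simp: pole_free_def)
  qed
  have large: "T s = special_const * (\<Prod>i=1..p. rGamma (s + b i) / rGamma (s + a i))"
    if s: "pole_free s" and Re: "\<And>k. k \<in> {1..p} \<Longrightarrow> Re (s + a k) > 0" for s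
  proof (rule LIMSEQ_unique)
    show "(\<lambda>n. T s) \<longlonglongrightarrow> T s" by simp
    have eq: "(\<Prod>i=1..p. pochhammer (s + b i) (Suc n) / pochhammer (s + a i) (Suc n)) * exp ((\<Sum>i=1..p. (s + a i) - (s + b i)) * of_real (ln (real n))) *
      (T (s + 1 + of_nat n) * exp (psi p a b * of_real (ln (real n)))) = T s" for n
    proof -
      have "(\<Sum>i=1..p. (s + a i) - (s + b i)) = - psi p a b"
        by (simp add: psi_def sum_subtractf)
      then have "exp ((\<Sum>i=1..p. (s + a i) - (s + b i)) * of_real (ln (real n))) * exp (psi p a b * of_real (ln (real n))) = 1"
        by (simp add: exp_minus)
      moreover have "s + of_nat (Suc n) = s + 1 + of_nat n" by simp
      ultimately show ?thesis using T_add_nat(1)[OF s, of "Suc n"] by (simp only: mult_ac) (simp add: mult_ac)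
    qed
    have "(\<lambda>n. (\<Prod>i=1..p. pochhammer (s + b i) (Suc n) / pochhammer (s + a i) (Suc n)) * exp ((\<Sum>i=1..p. (s + a i) - (s + b i)) * of_real (ln (real n))) *
      (T (s + 1 + of_nat n) * exp (psi p a b * of_real (ln (real n))))) \<longlonglongrightarrow> (\<Prod>i=1..p. rGamma (s + b i) / rGamma (s + a i)) * special_const"
      using np[OF s] Re by (intro tendsto_mult pochhammer_prod_tendsto T_asymptotics) auto
    then show "(\<lambda>n. T s) \<longlonglongrightarrow> special_const * (\<Prod>i=1..p. rGamma (s + b i) / rGamma (s + a i))"
      unfolding eq by (simp add: mult.commute)
  qed
  have "\<exists>n::nat. \<forall>k\<in>{1..p}. Re (s + of_nat n + a k) > 0"
  proof -
    obtain n :: nat where n: "real n > (\<Sum>k=1..p. \<bar>Re (s + a k)\<bar>)" using reals_Archimedean2 by blast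
    have "Re (s + of_nat n + a k) > 0" if k: "k \<in> {1..p}" for k
    proof -
      have "\<bar>Re (s + a k)\<bar> \<le> (\<Sum>k=1..p. \<bar>Re (s + a k)\<bar>)" using k by (intro member_le_sum) auto
      then show ?thesis using n by simp
    qed
    then show ?thesis by blast
  qed
  then obtain n :: nat where n: "\<And>k. k \<in> {1..p} \<Longrightarrow> Re (s + of_nat n + a k) > 0" by blast
  have "T s = (\<Prod>i=1..p. pochhammer (s + b i) n / pochhammer (s + a i) n) * (special_const * (\<Prod>i=1..p. rGamma (s + of_nat n + b i) / rGamma (s + of_nat n + a i)))"
    using T_add_nat[OF s, of n] large[OF T_add_nat(2)[OF s] n] by simp
  also have "\<dots> = special_const * (\<Prod>i=1..p. (pochhammer (s + b i) n / pochhammer (s + a i) n) * (rGamma (s + of_nat n + b i) / rGamma (s + of_nat n + a i)))"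
    by (simp only: prod.distrib mult.left_commute)
  also have "\<dots> = special_const * (\<Prod>i=1..p. rGamma (s + b i) / rGamma (s + a i))"
  proof -
    have "s + of_nat n + x = s + x + of_nat n" for x by simp
    then have "(pochhammer (s + b i) n / pochhammer (s + a i) n) * (rGamma (s + of_nat n + b i) / rGamma (s + of_nat n + a i)) = rGamma (s + b i) / rGamma (s + a i)" for i
      by (simp only: pochhammer_rGamma[of "s + b i" n] pochhammer_rGamma[of "s + a i" n] times_divide_times_eq)
    then show ?thesis by simp
  qed
  finally show ?thesis .
qed

text \<open>\<open>W\<close> at -a_k is known from \<open>W_at_a\<close>, and by
  \<open>W_eq_Q\<close> it equals Q(a_k - 1) T(1 - a_k), where \<open>T_eq\<close> applies. The rest
  is the functional equation of Gamma.\<close>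

lemma d_eq:
  assumes k: "k \<in> {1..p}"
  shows "d k = special_const * res_coeff k"
proof -
  let ?I = "{1..p} - {k}"
  have reg: "pole_free (- a k + 1)"
    unfolding pole_free_def using a_add_nat_not_0[OF k] by (auto simp: algebra_simps)
  have ne: "a i - a k \<notin> \<int>" if "i \<in> ?I" for i using a_diff[of i k] that k by auto
  have "- d k * (\<Prod>i\<in>?I. a k - a i) = poly Q (a k - 1) * T (- a k + 1)"
    using W_at_a[OF k] W_eq_Q[OF reg] by simp
  also have "\<dots> = special_const * (\<Prod>i=1..p. (a k - b i) * rGamma (- a k + 1 + b i)) / (\<Prod>i=1..p. rGamma (- a k + 1 + a i))"
    unfolding T_eq[OF reg] poly_Q by (simp add: prod.distrib prod_dividef)
  also have "(\<Prod>i=1..p. (a k - b i) * rGamma (- a k + 1 + b i)) = (\<Prod>i=1..p. (-1) * rGamma (b i - a k))"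
  proof (intro prod.cong refl)
    fix i
    show "(a k - b i) * rGamma (- a k + 1 + b i) = (-1) * rGamma (b i - a k)"
      using rGamma_plus1[of "b i - a k"] by (simp add: algebra_simps)
  qed
  also have "(\<Prod>i=1..p. rGamma (- a k + 1 + a i)) = (\<Prod>i\<in>?I. rGamma (- a k + 1 + a i))"
    using k by (subst prod.remove[of _ k]) auto
  also have "\<dots> = (\<Prod>i\<in>?I. 1 / ((a i - a k) * Gamma (a i - a k)))"
  proof (intro prod.cong refl)
    fix i assume i: "i \<in> ?I"
    have "a i - a k \<notin> \<int>\<^sub>\<le>\<^sub>0" using ne[OF i] nonpos_Ints_Int by blast
    then have "Gamma (a i - a k + 1) = (a i - a k) * Gamma (a i - a k)" by (rule Gamma_plus1)
    moreover have "- a k + 1 + a i = a i - a k + 1" by simp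
    ultimately show "rGamma (- a k + 1 + a i) = 1 / ((a i - a k) * Gamma (a i - a k))"
      by (simp only: rGamma_inverse_Gamma inverse_eq_divide)
  qed
  also have "special_const * (\<Prod>i=1..p. (-1) * rGamma (b i - a k)) / (\<Prod>i\<in>?I. 1 / ((a i - a k) * Gamma (a i - a k))) =
     special_const * (-1) ^ p * res_coeff k * (\<Prod>i\<in>?I. a i - a k)"
    unfolding prod.distrib by (simp add: res_coeff_def prod_dividef prod.distrib)
  also have "(\<Prod>i\<in>?I. a k - a i) = (-1) ^ (p - 1) * (\<Prod>i\<in>?I. a i - a k)"
    using prod.distrib[of "\<lambda>_. -1" "\<lambda>i. a i - a k" ?I] k by (simp add: card_Diff_singleton)
  finally have "- d k * ((-1) ^ (p - 1) * (\<Prod>i\<in>?I. a i - a k)) = special_const * (-1) ^ p * res_coeff k * (\<Prod>i\<in>?I. a i - a k)" .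
  moreover have "a i - a k \<noteq> 0" if "i \<in> ?I" for i using ne[OF that] by (metis Ints_0)
  then have "(\<Prod>i\<in>?I. a i - a k) \<noteq> 0" by (subst prod_zero_iff) auto
  moreover have "(-1) ^ p = - ((-1) ^ (p - 1) :: complex)" using p_pos by (cases p) auto
  ultimately show ?thesis by simp
qed

end

context hypergeo
begin

definition u :: "complex \<Rightarrow> complex" where
  "u z = (\<Sum>k=1..p. res_coeff k * Y0 k 0 z)"

lemma special_fps_0_nonzero: "Re (psi p a b) > real p + 1 \<Longrightarrow> fps_nth special_fps 0 \<noteq> 0"
  and special_const_nonzero: "Re (psi p a b) > real p + 1 \<Longrightarrow> special_const \<noteq> 0"
proof -
  assume large: "Re (psi p a b) > real p + 1"
  have "pochhammer (rho + 1) (p - 1) \<noteq> 0"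
  proof
    assume "pochhammer (rho + 1) (p - 1) = 0"
    then obtain n where "rho + 1 = - of_nat n" by (auto simp: pochhammer_eq_0_iff)
    then have "Re (rho + 1) = Re (- of_nat n)" by (rule arg_cong)
    then show False using large by (simp add: rho_def)
  qed
  then show 1: "fps_nth special_fps 0 \<noteq> 0" by (simp add: special_fps_0)
  have "psi p a b \<notin> \<int>\<^sub>\<le>\<^sub>0" using large by (auto elim!: nonpos_Ints_cases)
  then show "special_const \<noteq> 0" using 1 by (simp add: special_const_def Gamma_eq_zero_iff)
qed

lemma u_eq_special:
  assumes large: "Re (psi p a b) > real p + 1" and z: "z \<in> lens"
  shows "u z = (1 - z) powr (psi p a b - 1) * eval_fps special_fps (1 - z) / special_const"
proof -
  note g = frob_start_special_large[OF large]
  have "\<exists>d. \<forall>j<p. \<forall>z\<in>lens. Y1 rho special_start j z = (\<Sum>k\<in>{1..p}. d k * Y0 k j z)"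
  proof (rule sol_span[OF _ _ _ _ sol_Y1[OF g]])
    fix c assume "\<And>j z. j < p \<Longrightarrow> z \<in> lens \<Longrightarrow> (\<Sum>i\<in>{1..p}. c i * Y0 i j z) = 0"
    then show "\<forall>i\<in>{1..p}. c i = 0" using Y0_indep[of c] p_pos by auto
  qed (use sol_Y0 in auto)
  then obtain d where d: "\<And>j z. j < p \<Longrightarrow> z \<in> lens \<Longrightarrow> Y1 rho special_start j z = (\<Sum>k=1..p. d k * Y0 k j z)" by blast
  interpret C: hypergeo_connection p a b d by unfold_locales (use large d in auto)
  have "Y1 rho special_start 0 z = special_const * u z"
    using d[of 0, OF _ z] p_pos C.d_eq by (simp add: u_def sum_distrib_left mult.assoc)
  then show ?thesis using special_const_nonzero[OF large] Y1_special[OF g z] by (simp add: field_simps)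
qed

end

subsection \<open>Contiguity in \<open>b_1\<close>\<close>

text \<open>Up to sign, the factors involving b_1 form 1 / Gamma(b_1 - a_k - n), and 1 / Gamma(x) =
  x / Gamma(x + 1). Since theta multiplies the term z^(a_k + n) by its exponent, the factor on the
  right is the operator b_1 - theta.\<close>

lemma (in hypergeo) res_coeff_F_shift:
  assumes "b' = b(1 := b 1 + 1)" and k: "k \<in> {1..p}"
  shows "res_coeff k * F k n = (b 1 - a k - of_nat n) * (hypergeo.res_coeff p a b' k * hypergeo.F p a b' k n)"
proof -
  interpret B: hypergeo p a b' by unfold_locales (use p_pos a_diff in auto)
  have 1: "{1..p} = insert 1 {2..p}" "1 \<notin> {2..p}" using p_pos by auto
  define A where "A = (\<Prod>i\<in>{1..p} - {k}. Gamma (a i - a k))"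
  define R where "R = (\<Prod>i\<in>{2..p}. rGamma (b i - a k))"
  define N where "N = (\<Prod>i\<in>{2..p}. pochhammer (1 - b i + a k) n)"
  define D where "D = (\<Prod>i=1..p. pochhammer (1 - a i + a k) n)"
  have b': "b' 1 = b 1 + 1" "\<And>i. i \<in> {2..p} \<Longrightarrow> b' i = b i" using assms(1) by auto
  have "res_coeff k = A * (rGamma (b 1 - a k) * R)"
    unfolding res_coeff_def A_def R_def by (subst (2) 1, subst prod.insert) auto
  moreover have "B.res_coeff k = A * (rGamma (b 1 + 1 - a k) * R)"
    unfolding B.res_coeff_def A_def R_def using b' by (subst (2) 1, subst prod.insert) auto
  moreover have "F k n = pochhammer (1 - b 1 + a k) n * N / D"
    unfolding F_def prod_dividef D_def N_def by (subst 1, subst prod.insert) auto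
  moreover have "B.F k n = pochhammer (a k - b 1) n * N / D"
    unfolding B.F_def prod_dividef D_def N_def using b' by (subst 1, subst prod.insert) auto
  moreover have "rGamma (b 1 - a k) = (b 1 - a k) * rGamma (b 1 + 1 - a k)"
    using rGamma_plus1[of "b 1 - a k"] by (simp add: algebra_simps)
  moreover have "(b 1 - a k) * pochhammer (1 - b 1 + a k) n = (b 1 - a k - of_nat n) * pochhammer (a k - b 1) n"
  proof -
    have "(a k - b 1) * pochhammer (a k - b 1 + 1) n = pochhammer (a k - b 1) n * (a k - b 1 + of_nat n)"
      by (metis pochhammer_Suc pochhammer_rec)
    moreover have "a k - b 1 + 1 = 1 - b 1 + a k" by simp
    ultimately show ?thesis by (simp add: algebra_simps)
  qed
  moreover have "A * ((x * r) * R) * (p1 * N / D) = y * (A * (r * R) * (p0 * N / D))" if "x * p1 = y * p0" for x y r p0 p1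
  proof -
    have "A * ((x * r) * R) * (p1 * N / D) = (A * r * R * N / D) * (x * p1)" by simp
    then show ?thesis unfolding that by simp
  qed
  ultimately show ?thesis by (simp only:)
qed

lemma (in hypergeo) u_shift:
  assumes "b' = b(1 := b 1 + 1)" and z: "z \<in> lens"
    and D: "(hypergeo.u p a b' has_field_derivative D) (at z)"
  shows "u z = b 1 * hypergeo.u p a b' z - z * D"
proof -
  interpret B: hypergeo p a b' by unfold_locales (use p_pos a_diff in auto)
  note zz = lensD[OF z]
  have "(B.u has_field_derivative (\<Sum>k=1..p. B.res_coeff k * (B.Y0 k (Suc 0) z / z))) (at z)"
    unfolding B.u_def[abs_def] using B.Y0_deriv[OF _ z] by (intro DERIV_sum DERIV_cmult) auto
  from DERIV_unique[OF this D] have D: "z * D = (\<Sum>k=1..p. B.res_coeff k * B.Y0 k (Suc 0) z)"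
    using zz by (auto simp: sum_distrib_left)
  have "res_coeff k * Y0 k 0 z = b 1 * (B.res_coeff k * B.Y0 k 0 z) - B.res_coeff k * B.Y0 k (Suc 0) z" if k: "k \<in> {1..p}" for k
  proof -
    have "fps_const (res_coeff k) * G k 0 = fps_const (b 1 * B.res_coeff k) * B.G k 0 - fps_const (B.res_coeff k) * B.G k (Suc 0)"
    proof (rule fps_ext)
      fix n
      show "fps_nth (fps_const (res_coeff k) * G k 0) n = fps_nth (fps_const (b 1 * B.res_coeff k) * B.G k 0 - fps_const (B.res_coeff k) * B.G k (Suc 0)) n"
        using res_coeff_F_shift[OF assms(1) k, of n] by (simp add: G_nth B.G_nth algebra_simps del: G.simps B.G.simps)
    qed
    then have "eval_fps (fps_const (res_coeff k) * G k 0) z = eval_fps (fps_const (b 1 * B.res_coeff k) * B.G k 0 - fps_const (B.res_coeff k) * B.G k (Suc 0)) z"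
      by (simp only:)
    then have "res_coeff k * eval_fps (G k 0) z = b 1 * B.res_coeff k * eval_fps (B.G k 0) z - B.res_coeff k * eval_fps (B.G k (Suc 0)) z"
      using zz on_disc_G[OF k] B.on_disc_G[OF k] by (simp del: G.simps B.G.simps)
    then have "z powr a k * (res_coeff k * eval_fps (G k 0) z) = z powr a k * (b 1 * B.res_coeff k * eval_fps (B.G k 0) z - B.res_coeff k * eval_fps (B.G k (Suc 0)) z)"
      by (simp only:)
    then show ?thesis unfolding Y0_def B.Y0_def by (simp only: right_diff_distrib mult_ac)
  qed
  then have "u z = (\<Sum>k=1..p. b 1 * (B.res_coeff k * B.Y0 k 0 z) - B.res_coeff k * B.Y0 k (Suc 0) z)"
    unfolding u_def by (intro sum.cong) auto
  then show ?thesis unfolding D by (simp add: B.u_def sum_subtractf sum_distrib_left)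
qed

text \<open>
  The coefficients \<open>g n\<close> at this stage belong to the exponent \<open>0\<close> at \<open>z = 0\<close> in place of \<open>a_k\<close>.
  Dividing by \<open>\<Gamma> (\<psi> + n)\<close> makes sense for all values of \<open>\<psi>\<close>, including the poles of \<open>\<Gamma>\<close>.
\<close>
definition gamma_fps :: "(nat \<Rightarrow> complex) \<Rightarrow> complex \<Rightarrow> complex fps" where
  "gamma_fps g \<psi> = Abs_fps (\<lambda>n. g n * rGamma (\<psi> + of_nat n))"

definition expands :: "nat \<Rightarrow> (nat \<Rightarrow> complex) \<Rightarrow> (nat \<Rightarrow> complex) \<Rightarrow> (nat \<Rightarrow> complex) \<Rightarrow> bool" where
  "expands p a b g \<longleftrightarrow> on_disc (gamma_fps g (psi p a b)) \<and>
     (\<forall>z\<in>lens. hypergeo.u p a b z = (1 - z) powr (psi p a b - 1) * eval_fps (gamma_fps g (psi p a b)) (1 - z))"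

lemma psi_fun_upd: "p \<ge> 1 \<Longrightarrow> psi p a (b(1 := w)) = psi p a b + (w - b 1)"
proof -
  assume "p \<ge> 1"
  then have 1: "{1..p} = insert 1 {2..p}" "1 \<notin> {2..p}" by auto
  have "(\<Sum>i\<in>{2..p}. (b(1 := w)) i - a i) = (\<Sum>i\<in>{2..p}. b i - a i)" by (intro sum.cong) auto
  then show ?thesis unfolding psi_def by (subst (1 2) 1(1), subst (1 2) sum.insert) auto
qed

text \<open>In x = 1 - z the operator theta is -(1 - x) d/dx, so b_1 - theta sends x^psi V to
  x^(psi-1) (b_1 x V + (1 - x) (psi V + x V')). The operator psi + x d/dx changes 1 / Gamma(psi + 1
  + n) into 1 / Gamma(psi + n), which explains the normalisation and makes the new coefficients
  polynomial in the old ones.\<close>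

lemma (in hypergeo) expands_shift:
  assumes "b' = b(1 := b 1 + 1)" and g: "expands p a b' g"
  shows "expands p a b (\<lambda>n. g n + (if n = 0 then 0 else (b 1 - psi p a b - of_nat n + 1) * g (n - 1)))"
proof -
  interpret B: hypergeo p a b' by unfold_locales (use p_pos a_diff in auto)
  let ?\<psi> = "psi p a b"
  define V where "V = gamma_fps g (?\<psi> + 1)"
  have psi': "psi p a b' = ?\<psi> + 1" unfolding assms(1) psi_fun_upd[OF p_pos] by simp
  have V: "on_disc V" "\<And>z. z \<in> lens \<Longrightarrow> B.u z = (1 - z) powr ?\<psi> * eval_fps V (1 - z)"
    using g unfolding expands_def psi' V_def by auto
  define V' where "V' = fps_const (b 1) * fps_X * V + (1 - fps_X) * (fps_const ?\<psi> * V + fps_X * fps_deriv V)"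
  have ps: "on_disc V'" unfolding V'_def using V(1) by auto
  have eq: "gamma_fps (\<lambda>n. g n + (if n = 0 then 0 else (b 1 - ?\<psi> - of_nat n + 1) * g (n - 1))) ?\<psi> = V'"
  proof (rule fps_ext)
    fix n
    have r: "(?\<psi> + of_nat m) * rGamma (?\<psi> + 1 + of_nat m) = rGamma (?\<psi> + of_nat m)" for m
      using rGamma_plus1[of "?\<psi> + of_nat m"] by (simp add: add_ac)
    have Vn: "fps_nth (fps_const ?\<psi> * V + fps_X * fps_deriv V) m = g m * rGamma (?\<psi> + of_nat m)" for m
    proof -
      have "fps_nth (fps_const ?\<psi> * V + fps_X * fps_deriv V) m = (?\<psi> + of_nat m) * fps_nth V m"
        by (cases m) (auto simp: algebra_simps)
      also have "\<dots> = g m * ((?\<psi> + of_nat m) * rGamma (?\<psi> + 1 + of_nat m))" by (simp add: V_def gamma_fps_def)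
      finally show ?thesis by (simp only: r)
    qed
    show "fps_nth (gamma_fps (\<lambda>n. g n + (if n = 0 then 0 else (b 1 - ?\<psi> - of_nat n + 1) * g (n - 1))) ?\<psi>) n = fps_nth V' n"
    proof (cases n)
      case 0
      have "fps_nth V' 0 = fps_nth (fps_const ?\<psi> * V + fps_X * fps_deriv V) 0" by (simp add: V'_def)
      then show ?thesis unfolding Vn using 0 by (simp add: gamma_fps_def)
    next
      case (Suc m)
      have "fps_nth V' (Suc m) = b 1 * fps_nth V m + fps_nth (fps_const ?\<psi> * V + fps_X * fps_deriv V) (Suc m) - fps_nth (fps_const ?\<psi> * V + fps_X * fps_deriv V) m"
        by (simp add: V'_def left_diff_distrib mult.assoc)
      also have "\<dots> = b 1 * (g m * rGamma (?\<psi> + of_nat (Suc m))) + g (Suc m) * rGamma (?\<psi> + of_nat (Suc m)) - g m * rGamma (?\<psi> + of_nat m)"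
        unfolding Vn by (simp add: V_def gamma_fps_def add_ac)
      also have "rGamma (?\<psi> + of_nat m) = (?\<psi> + of_nat m) * rGamma (?\<psi> + of_nat (Suc m))"
        using r[of m] by (simp add: add_ac)
      finally show ?thesis using Suc by (simp add: gamma_fps_def algebra_simps)
    qed
  qed
  have "u z = (1 - z) powr (?\<psi> - 1) * eval_fps V' (1 - z)" if z: "z \<in> lens" for z
  proof -
    note zz = lensD[OF z]
    let ?x = "1 - z" and ?v = "eval_fps V (1 - z)" and ?v' = "eval_fps (fps_deriv V) (1 - z)"
    have "((\<lambda>z. (1 - z) powr ?\<psi>) has_field_derivative ?\<psi> * ?x powr (?\<psi> - 1) * (-1)) (at z)"
      using zz by (auto intro!: derivative_eq_intros)
    moreover have "((\<lambda>z. eval_fps V (1 - z)) has_field_derivative ?v' * (-1)) (at z)"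
      using zz V(1) by (intro eval_disc_deriv) (auto intro!: derivative_eq_intros)
    ultimately have "((\<lambda>z. (1 - z) powr ?\<psi> * eval_fps V (1 - z)) has_field_derivative
      ?\<psi> * ?x powr (?\<psi> - 1) * (-1) * ?v + ?v' * (-1) * ?x powr ?\<psi>) (at z)" by (rule DERIV_mult)
    then have "(B.u has_field_derivative ?\<psi> * ?x powr (?\<psi> - 1) * (-1) * ?v + ?v' * (-1) * ?x powr ?\<psi>) (at z)"
      by (rule has_field_derivative_transform_within_open[of _ _ _ lens, OF _ open_lens z]) (simp add: V(2))
    from u_shift[OF assms(1) z this]
    have uz: "u z = b 1 * (?x powr ?\<psi> * ?v) - z * (?\<psi> * ?x powr (?\<psi> - 1) * (-1) * ?v + ?v' * (-1) * ?x powr ?\<psi>)"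
      by (simp only: V(2)[OF z])
    have x: "?x powr ?\<psi> = ?x powr (?\<psi> - 1) * ?x" using zz by (simp add: powr_diff)
    have "eval_fps V' ?x = b 1 * ?x * ?v + z * (?\<psi> * ?v + ?x * ?v')"
      unfolding V'_def using zz V(1) by simp
    moreover have "bb * (W * y * v) - z * (q * W * (-1) * v + v' * (-1) * (W * y)) = W * (bb * y * v + z * (q * v + y * v'))"
      for bb W y v z q v' :: complex by (simp add: algebra_simps)
    ultimately show ?thesis unfolding uz x by (simp only:)
  qed
  then show ?thesis unfolding expands_def eq using ps by auto
qed

lemma (in hypergeo) expands_large:
  assumes large: "Re (psi p a b) > real p + 1"
  shows "expands p a b (\<lambda>n. pochhammer (psi p a b) n * fps_nth special_fps n / fps_nth special_fps 0)"
proof -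
  let ?\<psi> = "psi p a b" and ?v = "fps_nth special_fps 0"
  have "gamma_fps (\<lambda>n. pochhammer ?\<psi> n * fps_nth special_fps n / ?v) ?\<psi> = fps_const (rGamma ?\<psi> / ?v) * special_fps"
  proof (rule fps_ext)
    fix n
    have "rGamma ?\<psi> = pochhammer ?\<psi> n * rGamma (?\<psi> + of_nat n)" by (rule pochhammer_rGamma)
    then show "fps_nth (gamma_fps (\<lambda>n. pochhammer ?\<psi> n * fps_nth special_fps n / ?v) ?\<psi>) n = fps_nth (fps_const (rGamma ?\<psi> / ?v) * special_fps) n"
      by (simp add: gamma_fps_def)
  qed
  moreover have "u z = (1 - z) powr (?\<psi> - 1) * (rGamma ?\<psi> / ?v * eval_fps special_fps (1 - z))" if "z \<in> lens" for z
    using u_eq_special[OF large that] by (simp add: special_const_def rGamma_inverse_Gamma divide_inverse mult_ac)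
  ultimately show ?thesis unfolding expands_def using on_disc_special_fps[OF frob_start_special_large[OF large]] lensD(2) by (auto intro!: on_disc_mult)
qed

context hypergeo
begin

section \<open>Holomorphic dependence of the expansion on b_1\<close>

definition upd :: "complex \<Rightarrow> nat \<Rightarrow> complex" where "upd w = b(1 := w)"

lemma psi_upd: "psi p a (upd w) = psi p a b + (w - b 1)"
  unfolding upd_def by (rule psi_fun_upd[OF p_pos])

lemma coeff_Q_upd_holomorphic: "(\<lambda>w. coeff (hypergeo.Q p (upd w)) l) holomorphic_on S"
proof -
  define R where "R = (\<Prod>i\<in>{2..p}. [:1 - b i, 1:])"
  have 1: "{1..p} = insert 1 {2..p}" "1 \<notin> {2..p}" using p_pos by auto
  have "hypergeo.Q p (upd w) = [:1 - w, 1:] * R" for w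
  proof -
    have "(\<Prod>i\<in>{2..p}. [:1 - upd w i, 1:]) = R" unfolding R_def by (intro prod.cong) (auto simp: upd_def)
    then show ?thesis unfolding hypergeo.Q_def[OF hypergeo_axioms] by (subst 1, subst prod.insert) (auto simp: upd_def)
  qed
  then have "coeff (hypergeo.Q p (upd w)) l = (1 - w) * coeff R l + (case l of 0 \<Rightarrow> 0 | Suc m \<Rightarrow> coeff R m)" for w
    by (simp add: coeff_pCons)
  then show ?thesis by (simp only:) (intro holomorphic_intros)
qed

lemma frob_upd_holomorphic:
  assumes S: "S \<subseteq> {w. Re (psi p a (upd w)) > real p + 1}"
  shows "(\<lambda>w. hypergeo.frob p a (upd w) (hypergeo.rho p a (upd w)) (hypergeo.special_start p) n j) holomorphic_on S"
proof (induction n arbitrary: j)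
  case 0
  show ?case unfolding hypergeo.frob.simps(1)[OF hypergeo_axioms] by (rule holomorphic_on_const)
next
  case (Suc n)
  let ?r = "\<lambda>w. hypergeo.rho p a (upd w)"
  let ?f = "\<lambda>w. hypergeo.frob p a (upd w) (?r w) (hypergeo.special_start p) n"
  have r: "?r holomorphic_on S"
  proof -
    have "?r w = psi p a b + (w - b 1) - of_nat p" for w
      by (simp only: hypergeo.rho_def[OF hypergeo_axioms] psi_upd)
    then show ?thesis by (simp only:) (intro holomorphic_intros)
  qed
  have nz: "of_nat n + 1 + ?r w \<noteq> 0" if "w \<in> S" for w
  proof
    assume "of_nat n + 1 + ?r w = 0"
    then have "Re (of_nat n + 1 + ?r w) = 0" by simp
    moreover have "Re (?r w) > 0" using S that unfolding hypergeo.rho_def[OF hypergeo_axioms] by auto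
    ultimately show False by simp
  qed
  have n1: "of_nat n + 1 + ?r w - ?r w \<noteq> 0" for w
    by (simp, metis of_nat_Suc of_nat_eq_0_iff nat.distinct(1) add.commute)
  have step: "(\<lambda>w. hypergeo.frob_step (?r w) n (?f w) l) holomorphic_on S" for l
    unfolding frob_step_def using nz
    by (intro holomorphic_on_divide holomorphic_on_diff holomorphic_on_mult holomorphic_on_add holomorphic_on_const r Suc.IH) auto
  show ?case
  proof (cases "Suc j < p")
    case True
    then show ?thesis unfolding hypergeo.frob.simps(2)[OF hypergeo_axioms] using step by (simp only: if_True)
  next
    case False
    then show ?thesis unfolding hypergeo.frob.simps(2)[OF hypergeo_axioms]
      by (simp only: if_False) (intro holomorphic_on_divide holomorphic_on_diff holomorphic_on_mult holomorphic_on_add holomorphic_on_sum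
        holomorphic_on_const r Suc.IH step n1 coeff_Q_upd_holomorphic)
  qed
qed

text \<open>Every induction step moves the half-plane one unit to the left by
  \<open>expands_shift\<close>. The family stays holomorphic across nonpositive integers psi_p, and
  this supplies the continuation in b_1 at the exceptional values.\<close>

lemma expands_upd:
  "\<exists>g. (\<forall>n. g n holomorphic_on {w. Re (psi p a (upd w)) > real p + 1 - real M}) \<and>
     (\<forall>w. Re (psi p a (upd w)) > real p + 1 - real M \<longrightarrow> expands p a (upd w) (\<lambda>n. g n w))"
proof (induction M)
  case 0
  let ?S = "{w. Re (psi p a (upd w)) > real p + 1 - real 0}"
  let ?V = "\<lambda>w. hypergeo.special_fps p a (upd w)"
  define g where "g n w = pochhammer (psi p a (upd w)) n * fps_nth (?V w) n / fps_nth (?V w) 0" for n w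
  have "g n holomorphic_on ?S" for n
  proof -
    have "(\<lambda>w. fps_nth (?V w) n) holomorphic_on ?S" for n
      unfolding hypergeo.special_fps_def[OF hypergeo_axioms] hypergeo.X1_def[OF hypergeo_axioms] fps_shift_nth fps_nth_Abs_fps
      by (rule frob_upd_holomorphic) auto
    moreover have "fps_nth (?V w) 0 \<noteq> 0" if "w \<in> ?S" for w
      using hypergeo.special_fps_0_nonzero[OF hypergeo_axioms] that by auto
    moreover have "(\<lambda>w. pochhammer (psi p a (upd w)) n) holomorphic_on ?S"
      unfolding psi_upd pochhammer_prod by (intro holomorphic_intros)
    ultimately show ?thesis unfolding g_def[abs_def] by (intro holomorphic_on_divide holomorphic_on_mult) auto
  qed
  moreover have "expands p a (upd w) (\<lambda>n. g n w)" if "Re (psi p a (upd w)) > real p + 1 - real 0" for w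
    unfolding g_def by (rule hypergeo.expands_large[OF hypergeo_axioms]) (use that in simp)
  ultimately show ?case by blast
next
  case (Suc M)
  then obtain g where g: "\<And>n. g n holomorphic_on {w. Re (psi p a (upd w)) > real p + 1 - real M}"
    "\<And>w. Re (psi p a (upd w)) > real p + 1 - real M \<Longrightarrow> expands p a (upd w) (\<lambda>n. g n w)" by blast
  have R: "Re (psi p a (upd (w + 1))) = Re (psi p a (upd w)) + 1" for w
    unfolding psi_upd by simp
  define g' where "g' n w = g n (w + 1) + (if n = 0 then 0 else (w - psi p a (upd w) - of_nat n + 1) * g (n - 1) (w + 1))" for n w
  let ?S = "{w. Re (psi p a (upd w)) > real p + 1 - real (Suc M)}"
  have "g' n holomorphic_on ?S" for n
  proof -
    have "(g n \<circ> (\<lambda>w. w + 1)) holomorphic_on ?S" for n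
      by (rule holomorphic_on_compose_gen[OF _ g(1)]) (auto intro!: holomorphic_intros simp: R)
    then have "(\<lambda>w. g n (w + 1)) holomorphic_on ?S" for n by (simp add: o_def)
    then show ?thesis unfolding g'_def[abs_def] psi_upd by (cases "n = 0") (auto intro!: holomorphic_intros)
  qed
  moreover have "expands p a (upd w) (\<lambda>n. g' n w)" if w: "w \<in> ?S" for w
  proof -
    have 1: "upd (w + 1) = (upd w)(1 := upd w 1 + 1)" and 2: "upd w 1 = w" by (auto simp: upd_def)
    have "expands p a (upd (w + 1)) (\<lambda>n. g n (w + 1))" using w R by (intro g(2)) simp
    from hypergeo.expands_shift[OF hypergeo_axioms 1 this]
    show ?thesis unfolding g'_def 2 .
  qed
  ultimately show ?case by blast
qed

end

subsection \<open>Meijer's function as a sum of residues\<close>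

lemma nonint_sub_nat:
  assumes "x \<notin> \<int>" shows "x - of_nat n \<notin> \<int>\<^sub>\<le>\<^sub>0" "x - of_nat n \<noteq> (0 :: complex)"
proof -
  have "x - of_nat n \<notin> \<int>" using assms by (metis Ints_add Ints_of_nat diff_add_cancel)
  then show "x - of_nat n \<notin> \<int>\<^sub>\<le>\<^sub>0" "x - of_nat n \<noteq> 0" using nonpos_Ints_Int by (blast, metis Ints_0)
qed

context hypergeo
begin

abbreviation integrand :: "real \<Rightarrow> complex \<Rightarrow> complex" where "integrand \<equiv> meijer_integrand p a b"

lemma integrand_holomorphic:
  assumes "z > 0" "\<And>i s. i \<in> {1..p} \<Longrightarrow> s \<in> S \<Longrightarrow> a i + s \<notin> \<int>\<^sub>\<le>\<^sub>0"
  shows "integrand z holomorphic_on S"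
  unfolding meijer_integrand_def[abs_def] using assms
  by (intro holomorphic_on_mult holomorphic_on_prod holomorphic_Gamma' holomorphic_rGamma' holomorphic_intros) auto

lemma integrand_step:
  assumes z: "z > 0" and s: "\<And>i. i \<in> {1..p} \<Longrightarrow> a i + s - 1 \<notin> \<int>\<^sub>\<le>\<^sub>0"
  shows "integrand z (s - 1) = of_real z * (\<Prod>i=1..p. (b i + s - 1) / (a i + s - 1)) * integrand z s"
proof -
  have 1: "Gamma (a i + (s - 1)) = Gamma (a i + s) / (a i + s - 1)" if "i \<in> {1..p}" for i
  proof -
    have "Gamma (a i + s - 1 + 1) = (a i + s - 1) * Gamma (a i + s - 1)" using s[OF that] by (rule Gamma_plus1)
    moreover have "a i + s - 1 \<noteq> 0" using s[OF that] by auto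
    ultimately show ?thesis by (simp add: field_simps)
  qed
  have 2: "rGamma (b i + (s - 1)) = (b i + s - 1) * rGamma (b i + s)" for i
    using rGamma_plus1[of "b i + s - 1"] by (simp add: algebra_simps)
  have 3: "of_real z powr (- (s - 1)) = of_real z * of_real z powr (- s)"
    using z by (simp add: powr_add[of _ "- s" 1, symmetric, simplified] powr_diff powr_minus field_simps)
  have "(\<Prod>i=1..p. Gamma (a i + (s - 1))) = (\<Prod>i=1..p. Gamma (a i + s)) / (\<Prod>i=1..p. a i + s - 1)"
    unfolding prod_dividef[symmetric] using 1 by (intro prod.cong) auto
  then show ?thesis unfolding meijer_integrand_def 2 3 prod.distrib prod_dividef by simp
qed

text \<open>By \<open>integrand_step\<close> a shift to the left by 1 multiplies the integrand by z
  times a rational function that tends to 1 at infinity. Far out this factor is at most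
  \<open>q < 1\<close>, which gives geometric decay, uniformly on compact sets that avoid the poles
  modulo 1.\<close>

lemma integrand_uniform_decay:
  assumes z: "0 < z" "z < 1" and K: "compact K" "K \<noteq> {}" and int: "\<And>i s. i \<in> {1..p} \<Longrightarrow> s \<in> K \<Longrightarrow> a i + s \<notin> \<int>"
    and e: "e > 0"
  shows "\<exists>N. \<forall>n\<ge>N. \<forall>s\<in>K. norm (integrand z (s - of_nat n)) \<le> e"
proof -
  obtain B where B: "\<And>s. s \<in> K \<Longrightarrow> norm s \<le> B" using compact_imp_bounded[OF K(1)] by (auto simp: bounded_iff)
  define r where "r s = (\<Prod>i=1..p. (b i + s - 1) / (a i + s - 1))" for s
  define q where "q = (1 + z) / 2"
  have q: "z < q" "q < 1" "0 < q" using z by (auto simp: q_def)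
  have "((\<lambda>s. \<Prod>i=1..p. 1 + (b i - a i) / (a i - 1 + s)) \<longlongrightarrow> (\<Prod>i=1..p. 1 + 0)) at_infinity"
    by (intro tendsto_prod tendsto_add tendsto_const tendsto_divide_0[OF tendsto_const]
        tendsto_add_filterlim_at_infinity[OF tendsto_const] filterlim_ident)
  then have "((\<lambda>s. z * norm (\<Prod>i=1..p. 1 + (b i - a i) / (a i - 1 + s))) \<longlongrightarrow> z * norm (\<Prod>i=1..p. 1 + 0 :: complex)) at_infinity"
    by (intro tendsto_mult_left tendsto_norm)
  then have "eventually (\<lambda>s. z * norm (\<Prod>i=1..p. 1 + (b i - a i) / (a i - 1 + s)) < q) at_infinity"
    by (rule order_tendstoD(2)) (use q in simp)
  then obtain C where C: "\<And>s. norm s \<ge> C \<Longrightarrow> z * norm (\<Prod>i=1..p. 1 + (b i - a i) / (a i - 1 + s)) < q"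
    by (auto simp: eventually_at_infinity)
  \<comment> \<open>For \<open>n >= N\<close> all points \<open>s - of_nat n\<close> have norm at
    least \<open>C\<close>, because \<open>B\<close> bounds the norms in \<open>K\<close>.\<close>
  obtain N where N: "real N > C + B" using reals_Archimedean2 by blast
  have step: "norm (integrand z (s - of_nat (Suc n))) \<le> q * norm (integrand z (s - of_nat n))" if s: "s \<in> K" and n: "n \<ge> N" for s n
  proof -
    let ?s = "s - of_nat n"
    have np: "a i + ?s - 1 \<notin> \<int>\<^sub>\<le>\<^sub>0" "a i + ?s - 1 \<noteq> 0" if i: "i \<in> {1..p}" for i
      using nonint_sub_nat[OF int[OF i s], of "Suc n"] by (auto simp: algebra_simps)
    have "r ?s = (\<Prod>i=1..p. 1 + (b i - a i) / (a i - 1 + ?s))"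
      unfolding r_def using np(2) by (intro prod.cong refl) (simp add: field_simps)
    moreover have "norm ?s \<ge> C"
      using norm_triangle_ineq2[of "of_nat n" s] norm_minus_commute[of s "of_nat n"] B[OF s] N n by simp
    ultimately have "z * norm (r ?s) \<le> q" using C[of ?s] by simp
    moreover have "integrand z (?s - 1) = of_real z * r ?s * integrand z ?s"
      unfolding r_def by (rule integrand_step[OF z(1)]) (rule np(1))
    moreover have "s - of_nat (Suc n) = ?s - 1" by simp
    ultimately show ?thesis using z by (simp only: norm_mult norm_of_real abs_of_pos) (intro mult_right_mono norm_ge_zero)
  qed
  have "continuous_on K (\<lambda>s. integrand z (s - of_nat N))"
  proof -
    have "integrand z holomorphic_on ((\<lambda>s. s - of_nat N) ` K)"
    proof (rule integrand_holomorphic[OF z(1)])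
      fix i s assume i: "i \<in> {1..p}" and "s \<in> (\<lambda>s. s - of_nat N) ` K"
      then obtain t where t: "t \<in> K" "s = t - of_nat N" by auto
      have "a i + s = a i + t - of_nat N" using t(2) by simp
      then show "a i + s \<notin> \<int>\<^sub>\<le>\<^sub>0" using nonint_sub_nat(1)[OF int[OF i t(1)], of N] by (simp only: not_False_eq_True)
    qed
    from holomorphic_on_imp_continuous_on[OF this] show ?thesis
      by (rule continuous_on_compose2) (auto intro!: continuous_intros)
  qed
  from compact_imp_bounded[OF compact_continuous_image[OF this K(1)]]
  obtain C where C: "\<And>s. s \<in> K \<Longrightarrow> norm (integrand z (s - of_nat N)) \<le> C" by (auto simp: bounded_iff)
  have C0: "C \<ge> 0" using C K(2) norm_ge_zero order_trans by blast
  have le: "norm (integrand z (s - of_nat (N + m))) \<le> q ^ m * C" if s: "s \<in> K" for s m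
  proof (induction m)
    case 0 then show ?case using C[OF s] by simp
  next
    case (Suc m)
    have "norm (integrand z (s - of_nat (N + Suc m))) \<le> q * norm (integrand z (s - of_nat (N + m)))"
      using step[OF s, of "N + m"] by simp
    also have "\<dots> \<le> q * (q ^ m * C)" using Suc q by (intro mult_left_mono) auto
    finally show ?case by simp
  qed
  have "(\<lambda>m. q ^ m * C) \<longlonglongrightarrow> 0 * C" using q by (intro tendsto_intros LIMSEQ_realpow_zero) auto
  then have "eventually (\<lambda>m. q ^ m * C < e) sequentially" using e by (intro order_tendstoD(2)) auto
  then obtain M where M: "\<And>m. m \<ge> M \<Longrightarrow> q ^ m * C < e" by (auto simp: eventually_at_top_linorder)
  show ?thesis
  proof (intro exI[of _ "N + M"] allI impI ballI)
    fix n s assume n: "n \<ge> N + M" and s: "s \<in> K"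
    define m where "m = n - N"
    have "n = N + m" "m \<ge> M" using n by (auto simp: m_def)
    then show "norm (integrand z (s - of_nat n)) \<le> e" using le[OF s, of m] M[of m] by simp
  qed
qed

text \<open>Only Gamma(a_k + s) is singular at this point, with residue (-1)^j / j!. The other
  factors are carried back to s = -a_k by pochhammer symbols, which assemble into
  \<open>F k j\<close>.\<close>

lemma integrand_residue:
  assumes z: "z > 0" and k: "k \<in> {1..p}"
    and S: "open S" "- a k - of_nat j \<in> S" and hol: "integrand z holomorphic_on S - {- a k - of_nat j}"
  shows "residue (integrand z) (- a k - of_nat j) = res_coeff k * (of_real z powr a k * (F k j * of_real z ^ j))"
proof -
  let ?s = "- a k - of_nat j" and ?I = "{1..p} - {k}"
  have ne: "a i - a k \<notin> \<int>" if "i \<in> ?I" for i using a_diff[of i k] that k by auto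
  define g where "g s = (\<Prod>i\<in>?I. Gamma (a i + s)) * (\<Prod>i=1..p. rGamma (b i + s)) * of_real z powr (- s)" for s
  have phi: "integrand z s = Gamma (a k + s) * g s" for s
    unfolding meijer_integrand_def g_def using k by (subst prod.remove[of _ k]) auto
  have "(\<lambda>w. Gamma (a k + w) * (a k + w + of_nat j)) \<midarrow>?s\<rightarrow> (-1) ^ j / fact j"
  proof -
    have "(\<lambda>h. Gamma (- of_nat j + h) * (- of_nat j + h + of_nat j)) \<midarrow>0\<rightarrow> ((-1) ^ j / fact j :: complex)"
      using Gamma_residues[of j, where ?'a = complex] by (subst (asm) LIM_offset_zero_iff) auto
    then show ?thesis by (subst LIM_offset_zero_iff) (simp_all add: algebra_simps)
  qed
  moreover have "g \<midarrow>?s\<rightarrow> g ?s"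
  proof -
    have "a i + ?s \<notin> \<int>\<^sub>\<le>\<^sub>0" if "i \<in> ?I" for i using nonint_sub_nat(1)[OF ne[OF that], of j] by (simp add: algebra_simps)
    moreover have "isCont (\<lambda>s. rGamma (b i + s)) ?s" for i by (intro continuous_intros)
    then have "(\<lambda>s. rGamma (b i + s)) \<midarrow>?s\<rightarrow> rGamma (b i + ?s)" for i by (simp add: isCont_def)
    ultimately show ?thesis unfolding g_def using z by (intro tendsto_intros) auto
  qed
  ultimately have "(\<lambda>w. (Gamma (a k + w) * (a k + w + of_nat j)) * g w) \<midarrow>?s\<rightarrow> (-1) ^ j / fact j * g ?s" by (rule tendsto_mult)
  then have "(\<lambda>w. integrand z w * (w - ?s)) \<midarrow>?s\<rightarrow> (-1) ^ j / fact j * g ?s" unfolding phi by (simp add: algebra_simps)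
  from residue_simple'[OF S hol this] have res: "residue (integrand z) ?s = (-1) ^ j / fact j * g ?s" .
  have pm: "pochhammer (x - of_nat j) j = (-1) ^ j * pochhammer (1 - x) j" for x :: complex
    using pochhammer_minus[of "x - of_nat j" j] pochhammer_minus[of "of_nat j - x" j] by (simp add: algebra_simps)
  have A: "(\<Prod>i\<in>?I. Gamma (a i + ?s)) = (-1) ^ (j * (p - 1)) * (\<Prod>i\<in>?I. Gamma (a i - a k)) / (\<Prod>i\<in>?I. pochhammer (1 - a i + a k) j)"
  proof -
    have "Gamma (a i + ?s) = (-1) ^ j * Gamma (a i - a k) / pochhammer (1 - a i + a k) j" if i: "i \<in> ?I" for i
    proof -
      let ?x = "a i - a k"
      have "?x - of_nat j \<notin> \<int>\<^sub>\<le>\<^sub>0" using nonint_sub_nat(1)[OF ne[OF i]] .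
      then have "pochhammer (?x - of_nat j) j * Gamma (?x - of_nat j) = Gamma ?x"
        using pochhammer_Gamma[of "?x - of_nat j" j] by (simp add: Gamma_eq_zero_iff)
      moreover have "pochhammer (1 - ?x) j \<noteq> 0"
      proof
        assume "pochhammer (1 - ?x) j = 0"
        then obtain n where "1 - ?x = - of_nat n" by (auto simp: pochhammer_eq_0_iff)
        then have "?x = of_nat (Suc n)" by (simp add: algebra_simps)
        then show False using ne[OF i] by (metis Ints_of_nat)
      qed
      moreover have "1 - ?x = 1 - a i + a k" "a i + ?s = ?x - of_nat j" by simp_all
      moreover have "(-1) ^ j * (-1) ^ j = (1 :: complex)" by (simp flip: power_mult_distrib)
      moreover have "G = e * X / Q" if "e * Q * G = X" "Q \<noteq> 0" "e * e = 1" for e Q G X :: complex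
      proof -
        have "e * X = (e * e) * (Q * G)" using that(1) by (simp add: mult_ac)
        then show ?thesis using that by simp
      qed
      ultimately show ?thesis unfolding pm by (simp only:)
    qed
    then have "(\<Prod>i\<in>?I. Gamma (a i + ?s)) = (\<Prod>i\<in>?I. (-1) ^ j * Gamma (a i - a k) / pochhammer (1 - a i + a k) j)" by (intro prod.cong) auto
    then show ?thesis unfolding prod_dividef prod.distrib using k by (simp add: card_Diff_singleton power_mult)
  qed
  have B: "(\<Prod>i=1..p. rGamma (b i + ?s)) = (-1) ^ (j * p) * (\<Prod>i=1..p. pochhammer (1 - b i + a k) j) * (\<Prod>i=1..p. rGamma (b i - a k))"
  proof -
    have "rGamma (b i + ?s) = (-1) ^ j * pochhammer (1 - b i + a k) j * rGamma (b i - a k)" for i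
    proof -
      have "rGamma (b i - a k - of_nat j) = pochhammer (b i - a k - of_nat j) j * rGamma (b i - a k)"
        using pochhammer_rGamma[of "b i - a k - of_nat j" j] by simp
      moreover have "1 - (b i - a k) = 1 - b i + a k" "b i + ?s = b i - a k - of_nat j" by simp_all
      ultimately show ?thesis unfolding pm by (simp only:)
    qed
    then show ?thesis by (simp add: prod.distrib power_mult)
  qed
  have D: "(\<Prod>i=1..p. pochhammer (1 - a i + a k) j) = fact j * (\<Prod>i\<in>?I. pochhammer (1 - a i + a k) j)"
    using k by (subst prod.remove[of _ k]) (auto simp: pochhammer_fact)
  have E: "of_real z powr (- ?s) = of_real z powr a k * of_real z ^ j"
    using z by (simp add: powr_add powr_nat' add.commute)
  \<comment> \<open>The signs come from the residue of Gamma, from p - 1 gamma factors and from p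
    reciprocal ones; the total exponent is even.\<close>
  have sign: "(-1) ^ j * (-1) ^ (j * (p - 1)) * (-1) ^ (j * p) = (1 :: complex)"
  proof -
    have "j + j * (p - 1) + j * p = 2 * (j * p)" using p_pos by (cases p) auto
    then show ?thesis unfolding power_add[symmetric] by (simp add: power_mult)
  qed
  have "residue (integrand z) ?s = ((-1) ^ j * (-1) ^ (j * (p - 1)) * (-1) ^ (j * p)) * (res_coeff k * (of_real z powr a k * (F k j * of_real z ^ j)))"
    unfolding res g_def A B E res_coeff_def F_def prod_dividef D by simp
  then show ?thesis unfolding sign by simp
qed

text \<open>The number of poles -a_k - j to the right of Re s = x0. Moving this line left by n adds
  exactly n poles for each k.\<close>

definition pole_count :: "real \<Rightarrow> nat \<Rightarrow> nat" where
  "pole_count x0 k = nat \<lceil>- Re (a k) - x0\<rceil>"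

lemma pole_count_iff:
  assumes "x0 < - Re (a k)"
  shows "x0 - real n < Re (- a k - of_nat j) \<longleftrightarrow> j < pole_count x0 k + n"
proof -
  have "x0 - real n < Re (- a k - of_nat j) \<longleftrightarrow> of_int (int j - int n) < - Re (a k) - x0"
    by auto
  also have "\<dots> \<longleftrightarrow> int j - int n < \<lceil>- Re (a k) - x0\<rceil>" by (rule less_ceiling_iff[symmetric])
  also have "\<lceil>- Re (a k) - x0\<rceil> = int (pole_count x0 k)" using assms by (simp add: pole_count_def)
  also have "int j - int n < int (pole_count x0 k) \<longleftrightarrow> j < pole_count x0 k + n" by linarith
  finally show ?thesis .
qed

lemma rect_integral:
  assumes z: "0 < z" and enc: "encloses_poles p a y1 y2 c"
    and x0: "\<And>k. k \<in> {1..p} \<Longrightarrow> x0 < - Re (a k)" "\<And>k. k \<in> {1..p} \<Longrightarrow> x0 + Re (a k) \<notin> \<int>" "x0 < c"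
  shows "contour_integral (rectpath (Complex (x0 - real n) y1) (Complex c y2)) (integrand z) =
    2 * of_real pi * \<i> * (\<Sum>k=1..p. \<Sum>j<pole_count x0 k + n. res_coeff k * (of_real z powr a k * (F k j * of_real z ^ j)))"
proof -
  let ?A = "Complex (x0 - real n) y1" and ?B = "Complex c y2"
  let ?g = "rectpath ?A ?B"
  \<comment> \<open>One unit beyond the left side of the rectangle: the half-plane contains the
    contour and, for each \<open>k\<close>, one pole more than the rectangle. That pole lies outside
    and has winding number 0.\<close>
  define S where "S = {s. Re s > x0 - real (n + 1)}"
  define I where "I = (SIGMA k:{1..p}. {..<pole_count x0 k + (n + 1)})"
  define pt where "pt = (\<lambda>(k, j). - a k - of_nat j :: complex)"
  have enc': "y1 < y2" "\<And>k. k \<in> {1..p} \<Longrightarrow> y1 < - Im (a k) \<and> - Im (a k) < y2 \<and> - Re (a k) < c"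
    using enc by (auto simp: encloses_poles_def)
  have finI: "finite I" by (simp add: I_def)
  have inS: "pt x \<in> S" if "x \<in> I" for x
    using that x0(1) pole_count_iff[of x0 _ "n + 1"] unfolding I_def S_def pt_def
    by (auto split: prod.splits simp del: minus_complex.simps of_nat_Suc)
  have inj: "inj_on pt I"
  proof (rule inj_onI)
    fix x y assume xy: "x \<in> I" "y \<in> I" "pt x = pt y"
    obtain k j l i where [simp]: "x = (k, j)" "y = (l, i)" by (cases x, cases y) auto
    have eq: "a k - a l = of_int (int i - int j)" using xy(3) by (simp add: pt_def algebra_simps)
    then have "k = l" using a_diff[of k l] xy by (auto simp: I_def)
    then have "complex_of_int (int i - int j) = 0" using eq by simp
    then show "x = y" using \<open>k = l\<close> by (simp only: of_int_eq_0_iff) simp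
  qed
  have hol: "integrand z holomorphic_on S - pt ` I"
  proof (rule integrand_holomorphic[OF z], rule notI)
    fix k s assume k: "k \<in> {1..p}" and s: "s \<in> S - pt ` I" and "a k + s \<in> \<int>\<^sub>\<le>\<^sub>0"
    then obtain j where "a k + s = - of_nat j" by (elim nonpos_Ints_cases')
    have "s = (a k + s) - a k" by simp
    also have "\<dots> = - a k - of_nat j" unfolding \<open>a k + s = - of_nat j\<close> by simp
    finally have sj: "s = - a k - of_nat j" .
    then have "x0 - real (n + 1) < Re (- a k - of_nat j)" using s by (simp add: S_def)
    then have "j < pole_count x0 k + (n + 1)" using pole_count_iff[OF x0(1)[OF k]] by blast
    then have "(k, j) \<in> I" using k by (simp add: I_def)
    then have "s \<in> pt ` I" unfolding sj pt_def by (force intro: image_eqI[of _ _ "(k, j)"])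
    then show False using s by simp
  qed
  have box: "pt (k, j) \<in> box ?A ?B" if k: "k \<in> {1..p}" and j: "j < pole_count x0 k + n" for k j
    using enc'(2)[OF k] pole_count_iff[OF x0(1)[OF k], of n j] j by (auto simp: pt_def in_box_complex_iff)
  have cbox: "pt (k, j) \<notin> cbox ?A ?B" if k: "k \<in> {1..p}" and j: "\<not> j < pole_count x0 k + n" for k j
  proof
    assume "pt (k, j) \<in> cbox ?A ?B"
    then have "x0 - real n \<le> - Re (a k) - real j" by (auto simp: pt_def in_cbox_complex_iff)
    moreover have "\<not> x0 - real n < - Re (a k) - real j" using pole_count_iff[OF x0(1)[OF k], of n j] j by simp
    ultimately have "x0 + Re (a k) = of_int (int n - int j)" by simp
    then show False using x0(2)[OF k] by (metis Ints_of_int)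
  qed
  have "contour_integral ?g (integrand z) = of_real (2 * pi) * \<i> * (\<Sum>s\<in>pt ` I. winding_number ?g s * residue (integrand z) s)"
  proof (rule Residue_theorem[where S = S])
    show "open S" unfolding S_def by (rule open_halfspace_Re_gt)
    show "connected S" unfolding S_def by (intro convex_connected convex_halfspace_Re_gt)
    show "path_image ?g \<subseteq> S - pt ` I"
    proof
      fix s assume s: "s \<in> path_image ?g"
      then have s': "s \<in> cbox ?A ?B - box ?A ?B"
        using path_image_rectpath_cbox_minus_box[of ?A ?B] x0(3) enc'(1) by auto
      then have "s \<in> S" by (auto simp: in_cbox_complex_iff S_def)
      moreover have "s \<notin> pt ` I"
      proof
        assume "s \<in> pt ` I"
        then obtain k j where "k \<in> {1..p}" "s = pt (k, j)" by (auto simp: I_def)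
        then show False using s' box[of k j] cbox[of k j] by (cases "j < pole_count x0 k + n") auto
      qed
      ultimately show "s \<in> S - pt ` I" by simp
    qed
    show "\<forall>s. s \<notin> S \<longrightarrow> winding_number ?g s = 0"
    proof (intro allI impI winding_number_rectpath_outside)
      fix s assume "s \<notin> S"
      then show "s \<notin> cbox ?A ?B" by (auto simp: in_cbox_complex_iff S_def)
    qed (use x0(3) enc'(1) in auto)
  qed (use finI hol in auto)
  also have "(\<Sum>s\<in>pt ` I. winding_number ?g s * residue (integrand z) s) = (\<Sum>x\<in>I. winding_number ?g (pt x) * residue (integrand z) (pt x))"
    by (rule sum.reindex_cong[OF inj]) auto
  also have "\<dots> = (\<Sum>k=1..p. \<Sum>j<pole_count x0 k + (n + 1). winding_number ?g (pt (k, j)) * residue (integrand z) (pt (k, j)))"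
    unfolding I_def by (subst sum.Sigma) (auto simp: case_prod_unfold)
  also have "\<dots> = (\<Sum>k=1..p. \<Sum>j<pole_count x0 k + n. res_coeff k * (of_real z powr a k * (F k j * of_real z ^ j)))"
  proof (rule sum.cong)
    fix k assume k: "k \<in> {1..p}"
    have res: "residue (integrand z) (pt (k, j)) = res_coeff k * (of_real z powr a k * (F k j * of_real z ^ j))"
      if j: "j < pole_count x0 k + n" for j
    proof -
      have mem: "(k, j) \<in> I" using k j by (simp add: I_def)
      have "open (S - (pt ` I - {pt (k, j)}))"
        using finI unfolding S_def by (intro open_Diff open_halfspace_Re_gt finite_imp_closed) auto
      moreover have "pt (k, j) \<in> S - (pt ` I - {pt (k, j)})" using inS[OF mem] by simp
      moreover have "S - (pt ` I - {pt (k, j)}) - {pt (k, j)} = S - pt ` I" using mem by blast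
      ultimately show ?thesis using integrand_residue[OF z k, of _ j] hol unfolding pt_def by simp
    qed
    have "winding_number ?g (pt (k, j)) = 1" if "j < pole_count x0 k + n" for j
      using winding_number_rectpath[OF box[OF k that]] .
    moreover have "winding_number ?g (pt (k, pole_count x0 k + n)) = 0"
      using cbox[OF k, of "pole_count x0 k + n"] x0(3) enc'(1) by (intro winding_number_rectpath_outside) auto
    ultimately show "(\<Sum>j<pole_count x0 k + (n + 1). winding_number ?g (pt (k, j)) * residue (integrand z) (pt (k, j))) =
      (\<Sum>j<pole_count x0 k + n. res_coeff k * (of_real z powr a k * (F k j * of_real z ^ j)))"
      using res by (simp add: add.assoc[symmetric])
  qed simp
  finally show ?thesis by simp
qed

lemma residue_sum_tendsto:
  assumes z: "0 < z" "z < 1"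
  shows "(\<lambda>n. \<Sum>k=1..p. \<Sum>j<m k + n. res_coeff k * (of_real z powr a k * (F k j * of_real z ^ j))) \<longlonglongrightarrow> u (of_real z)"
proof -
  have "(\<lambda>n. \<Sum>j<m k + n. res_coeff k * (of_real z powr a k * (F k j * of_real z ^ j))) \<longlonglongrightarrow> res_coeff k * Y0 k 0 (of_real z)"
    if k: "k \<in> {1..p}" for k
  proof -
    have "(\<lambda>j. F k j * of_real z ^ j) sums eval_fps (G k 0) (of_real z)"
      using on_disc_sums[OF on_disc_G[OF k, of 0], of "of_real z"] z by simp
    then have "(\<lambda>j. res_coeff k * (of_real z powr a k * (F k j * of_real z ^ j))) sums (res_coeff k * Y0 k 0 (of_real z))"
      unfolding Y0_def by (intro sums_mult)
    then have "(\<lambda>n. \<Sum>j<n. res_coeff k * (of_real z powr a k * (F k j * of_real z ^ j))) \<longlonglongrightarrow> res_coeff k * Y0 k 0 (of_real z)"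
      by (simp add: sums_def)
    from LIMSEQ_ignore_initial_segment[OF this, of "m k"] show ?thesis by (simp add: add.commute)
  qed
  then show ?thesis unfolding u_def by (intro tendsto_sum)
qed

text \<open>The truncated loop is compared with the rectangle whose left side is the next admissible
  line Re s = x0 - n to the right of -R. The difference consists of that side and two horizontal
  pieces of length at most 1, which disappear by \<open>integrand_uniform_decay\<close>.\<close>

lemma left_loop_limit:
  assumes z: "0 < z" "z < 1" and enc: "encloses_poles p a y1 y2 c"
  shows "((\<lambda>R. 1 / (2 * of_real pi * \<i>) * contour_integral (left_loop y1 y2 c R) (integrand z)) \<longlongrightarrow> u (of_real z)) at_top"
proof -
  have enc': "y1 < y2" "\<And>k. k \<in> {1..p} \<Longrightarrow> y1 < - Im (a k) \<and> - Im (a k) < y2 \<and> - Re (a k) < c"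
    using enc by (auto simp: encloses_poles_def)
  \<comment> \<open>\<open>Lb\<close> is at most \<open>c\<close> and at most every
    \<open>- Re (a k)\<close>. Just below it, countability yields an \<open>x0\<close> such that no
    line Re s = x0 - n carries a pole.\<close>
  define Lb where "Lb = - \<bar>c\<bar> - (\<Sum>k=1..p. \<bar>Re (a k)\<bar>)"
  have "\<exists>x\<in>{Lb - 1<..<Lb}. x \<notin> (\<lambda>(k, n). of_int n - Re (a k)) ` ({1..p} \<times> UNIV)"
    by (rule open_minus_countable) auto
  then obtain x0 where x0: "x0 < Lb" "\<And>k n. k \<in> {1..p} \<Longrightarrow> x0 \<noteq> of_int n - Re (a k)" by force
  have xk: "x0 < - Re (a k)" if "k \<in> {1..p}" for k
  proof -
    have "\<bar>Re (a k)\<bar> \<le> (\<Sum>k=1..p. \<bar>Re (a k)\<bar>)" using that by (intro member_le_sum) auto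
    then show ?thesis using x0(1) by (simp add: Lb_def)
  qed
  have xint: "x0 + Re (a k) \<notin> \<int>" if "k \<in> {1..p}" for k
    using x0(2)[OF that] by (auto elim!: Ints_cases simp: algebra_simps)
  have "0 \<le> (\<Sum>k=1..p. \<bar>Re (a k)\<bar>)" by (rule sum_nonneg) auto
  then have xc: "x0 < c" using x0(1) abs_ge_minus_self[of c] unfolding Lb_def by linarith
  \<comment> \<open>The left side for n = 0 together with unit segments to its left; translated by
    -n it covers all pieces in which the loop and the rectangle differ.\<close>
  define K where "K = closed_segment (Complex x0 y1) (Complex x0 y2) \<union> closed_segment (Complex (x0 - 1) y1) (Complex x0 y1)
     \<union> closed_segment (Complex (x0 - 1) y2) (Complex x0 y2)"
  have K: "compact K" "K \<noteq> {}" by (auto simp: K_def intro!: compact_Un compact_segment)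
  have Kint: "a k + s \<notin> \<int>" if k: "k \<in> {1..p}" and s: "s \<in> K" for k s
  proof
    assume "a k + s \<in> \<int>"
    then obtain n where "a k + s = of_int n" by (elim Ints_cases)
    then have n: "Re (a k) + Re s = of_int n" "Im (a k) + Im s = 0" by (auto simp: complex_eq_iff)
    have "Re s = x0 \<or> Im s = y1 \<or> Im s = y2"
      using s by (auto simp: K_def closed_segment_same_Re closed_segment_same_Im)
    then show False using n xint[OF k] enc'(2)[OF k] by (auto simp: add.commute)
  qed
  define Gd where "Gd = {s. \<forall>k\<in>{1..p}. a k + s \<notin> \<int>\<^sub>\<le>\<^sub>0}"
  have cont: "continuous_on T (integrand z)" if "T \<subseteq> Gd" for T
    by (rule continuous_on_subset[OF _ that], rule holomorphic_on_imp_continuous_on, rule integrand_holomorphic) (use z in \<open>auto simp: Gd_def\<close>)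
  have GdI: "s \<in> Gd" if "Im s = y1 \<or> Im s = y2 \<or> Re s = c \<or> Re s = x0 - real n" for s n
    unfolding Gd_def
  proof (intro CollectI ballI notI)
    fix k assume k: "k \<in> {1..p}" and "a k + s \<in> \<int>\<^sub>\<le>\<^sub>0"
    then obtain j where "a k + s = - of_nat j" by (elim nonpos_Ints_cases')
    then have j: "Re (a k) + Re s = - real j" "Im (a k) + Im s = 0" by (auto simp: complex_eq_iff)
    from that consider "Im s = y1 \<or> Im s = y2" | "Re s = c" | "Re s = x0 - real n" by blast
    then show False
    proof cases
      case 3
      then have "x0 + Re (a k) = of_int (int n - int j)" using j by simp
      then show ?thesis using xint[OF k] by (metis Ints_of_int)
    qed (use j enc'(2)[OF k] in auto)
  qed
  define nn where "nn R = nat \<lfloor>R + x0\<rfloor>" for R :: real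
  define Sn where "Sn n = (\<Sum>k=1..p. \<Sum>j<pole_count x0 k + n. res_coeff k * (of_real z powr a k * (F k j * of_real z ^ j)))" for n
  define E where "E R = contour_integral (left_loop y1 y2 c R) (integrand z) - 2 * of_real pi * \<i> * Sn (nn R)" for R
  have Ebound: "norm (E R) \<le> (2 + \<bar>y2 - y1\<bar>) * e"
    if R: "R \<ge> - x0" "R \<ge> - c" and e: "e \<ge> 0" "\<And>s. s \<in> K \<Longrightarrow> norm (integrand z (s - of_nat (nn R))) \<le> e" for R e
  proof -
    define n where "n = nn R"
    have "real n = of_int \<lfloor>R + x0\<rfloor>" using R unfolding n_def nn_def by simp
    then have n: "real n \<le> R + x0" "R + x0 < real n + 1" by linarith+
    define P1 where "P1 = Complex (x0 - real n) y1"
    define P2 where "P2 = Complex (x0 - real n) y2"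
    let ?I = "\<lambda>s t. contour_integral (linepath s t) (integrand z)"
    have seg1: "closed_segment (Complex s y1) (Complex t y1) \<subseteq> Gd" and seg2: "closed_segment (Complex s y2) (Complex t y2) \<subseteq> Gd" for s t
      by (auto simp: closed_segment_same_Im intro: GdI)
    have seg3: "closed_segment (Complex c s) (Complex c t) \<subseteq> Gd" for s t
      by (auto simp: closed_segment_same_Re intro: GdI)
    have seg4: "closed_segment (Complex (x0 - real n) s) (Complex (x0 - real n) t) \<subseteq> Gd" for s t
      by (auto simp: closed_segment_same_Re intro: GdI)
    have int: "integrand z contour_integrable_on linepath s t" if "closed_segment s t \<subseteq> Gd" for s t
      using cont[OF that] by (rule contour_integrable_continuous_linepath)
    have L: "contour_integral (left_loop y1 y2 c R) (integrand z) =
        ?I (Complex (-R) y1) (Complex c y1) + (?I (Complex c y1) (Complex c y2) + ?I (Complex c y2) (Complex (-R) y2))"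
      unfolding left_loop_def using int seg1 seg2 seg3 by (simp add: contour_integrable_joinI)
    have Rc: "contour_integral (rectpath (Complex (x0 - real n) y1) (Complex c y2)) (integrand z) =
        ?I P1 (Complex c y1) + (?I (Complex c y1) (Complex c y2) + (?I (Complex c y2) P2 + ?I P2 P1))"
      unfolding rectpath_def Let_def P1_def P2_def using int seg1 seg2 seg3 seg4 by (simp add: contour_integrable_joinI)
    have s1: "?I (Complex (-R) y1) (Complex c y1) = ?I (Complex (-R) y1) P1 + ?I P1 (Complex c y1)"
      by (rule contour_integral_split_linepath[OF cont[OF seg1]])
        (use n xc R in \<open>auto simp: P1_def closed_segment_same_Im closed_segment_eq_real_ivl\<close>)
    have s2: "?I (Complex c y2) (Complex (-R) y2) = ?I (Complex c y2) P2 + ?I P2 (Complex (-R) y2)"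
      by (rule contour_integral_split_linepath[OF cont[OF seg2]])
        (use n xc R in \<open>auto simp: P2_def closed_segment_same_Im closed_segment_eq_real_ivl\<close>)
    have "contour_integral (rectpath (Complex (x0 - real n) y1) (Complex c y2)) (integrand z) = 2 * of_real pi * \<i> * Sn n"
      unfolding Sn_def by (rule rect_integral[OF z(1) enc xk xint xc])
    then have E: "E R = ?I (Complex (-R) y1) P1 + ?I P2 (Complex (-R) y2) - ?I P2 P1"
      unfolding E_def n_def[symmetric] L s1 s2 Rc by (simp add: algebra_simps)
    have bd: "norm (?I s t) \<le> e * norm (t - s)"
      if "closed_segment s t \<subseteq> Gd" "\<And>x. x \<in> closed_segment s t \<Longrightarrow> x + of_nat n \<in> K" for s t
    proof (rule contour_integral_bound_linepath[OF int[OF that(1)] e(1)])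
      fix x assume "x \<in> closed_segment s t"
      then show "norm (integrand z x) \<le> e" using e(2)[OF that(2)] unfolding n_def[symmetric] by simp
    qed
    have b1: "norm (?I (Complex (-R) y1) P1) \<le> e * norm (P1 - Complex (-R) y1)"
      unfolding P1_def by (rule bd[OF seg1]) (use n in \<open>auto simp: K_def closed_segment_same_Im closed_segment_eq_real_ivl\<close>)
    have b2: "norm (?I P2 (Complex (-R) y2)) \<le> e * norm (Complex (-R) y2 - P2)"
      unfolding P2_def by (rule bd[OF seg2]) (use n in \<open>auto simp: K_def closed_segment_same_Im closed_segment_eq_real_ivl split: if_splits\<close>)
    have b3: "norm (?I P2 P1) \<le> e * norm (P1 - P2)"
      unfolding P1_def P2_def by (rule bd[OF seg4]) (use enc'(1) in \<open>auto simp: K_def closed_segment_same_Re closed_segment_eq_real_ivl\<close>)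
    have "P1 - Complex (-R) y1 = of_real (x0 - real n + R)" "Complex (-R) y2 - P2 = of_real (- (x0 - real n + R))" "P1 - P2 = of_real (y1 - y2) * \<i>"
      by (auto simp: P1_def P2_def complex_eq_iff)
    then have l: "norm (P1 - Complex (-R) y1) \<le> 1" "norm (Complex (-R) y2 - P2) \<le> 1" "norm (P1 - P2) = \<bar>y2 - y1\<bar>"
      using n by (simp_all only: norm_mult norm_of_real) auto
    have "norm (E R) \<le> norm (?I (Complex (-R) y1) P1) + norm (?I P2 (Complex (-R) y2)) + norm (?I P2 P1)"
      unfolding E using norm_triangle_ineq4[of "?I (Complex (-R) y1) P1 + ?I P2 (Complex (-R) y2)" "?I P2 P1"]
        norm_triangle_ineq[of "?I (Complex (-R) y1) P1" "?I P2 (Complex (-R) y2)"] by linarith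
    also have "\<dots> \<le> e * 1 + e * 1 + e * \<bar>y2 - y1\<bar>"
      using b1 b2 b3 l mult_left_mono[OF l(1) e(1)] mult_left_mono[OF l(2) e(1)] by (intro add_mono) (auto intro: order_trans)
    finally show ?thesis by (simp add: algebra_simps)
  qed
  have nn: "filterlim nn at_top at_top"
    unfolding nn_def[abs_def] filterlim_at_top
  proof
    fix N :: nat
    show "\<forall>\<^sub>F R in at_top. N \<le> nat \<lfloor>R + x0\<rfloor>"
      using eventually_ge_at_top[of "real N - x0"] by eventually_elim (simp add: le_nat_iff le_floor_iff)
  qed
  have "(E \<longlongrightarrow> 0) at_top"
  proof (rule tendstoI)
    fix e :: real assume e: "e > 0"
    define e' where "e' = e / (3 + \<bar>y2 - y1\<bar>)"
    have e': "e' > 0" using e by (simp add: e'_def)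
    obtain N where N: "\<And>n s. n \<ge> N \<Longrightarrow> s \<in> K \<Longrightarrow> norm (integrand z (s - of_nat n)) \<le> e'"
      using integrand_uniform_decay[OF z K Kint e'] by blast
    have "eventually (\<lambda>R. nn R \<ge> N) at_top" using nn by (simp add: filterlim_at_top)
    with eventually_ge_at_top[of "- x0"] eventually_ge_at_top[of "- c"]
    show "eventually (\<lambda>R. dist (E R) 0 < e) at_top"
    proof eventually_elim
      case (elim R)
      have "norm (E R) \<le> (2 + \<bar>y2 - y1\<bar>) * e'"
        by (rule Ebound) (use elim e' N in auto)
      also have "\<dots> < (3 + \<bar>y2 - y1\<bar>) * e'" using e' by (intro mult_strict_right_mono) auto
      also have "\<dots> = e" by (simp add: e'_def)
      finally show ?case by simp
    qed
  qed
  moreover have "((\<lambda>R. Sn (nn R)) \<longlongrightarrow> u (of_real z)) at_top"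
    using filterlim_compose[OF residue_sum_tendsto[OF z, of "pole_count x0"] nn] by (simp add: Sn_def)
  ultimately have "((\<lambda>R. 1 / (2 * of_real pi * \<i>) * E R + Sn (nn R)) \<longlongrightarrow> 1 / (2 * of_real pi * \<i>) * 0 + u (of_real z)) at_top"
    by (intro tendsto_intros)
  moreover have "1 / (2 * of_real pi * \<i>) * E R + Sn (nn R) = 1 / (2 * of_real pi * \<i>) * contour_integral (left_loop y1 y2 c R) (integrand z)" for R
    by (simp add: E_def field_simps)
  ultimately show ?thesis by simp
qed

lemma meijer_G_eq:
  assumes z: "0 < z" "z < 1"
  shows "meijer_G p a b z = u (of_real z)"
  unfolding meijer_G_def
proof (rule the_equality)
  show "\<forall>y1 y2 c. encloses_poles p a y1 y2 c \<longrightarrow>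
     ((\<lambda>R. 1 / (2 * of_real pi * \<i>) * contour_integral (left_loop y1 y2 c R) (integrand z)) \<longlongrightarrow> u (of_real z)) at_top"
    using left_loop_limit[OF z] by blast
  fix I assume I: "\<forall>y1 y2 c. encloses_poles p a y1 y2 c \<longrightarrow>
     ((\<lambda>R. 1 / (2 * of_real pi * \<i>) * contour_integral (left_loop y1 y2 c R) (integrand z)) \<longlongrightarrow> I) at_top"
  \<comment> \<open>An explicit admissible loop: without one the defining condition would be vacuous
    and would not determine \<open>I\<close>.\<close>
  define B where "B = (\<Sum>k=1..p. norm (a k)) + 1"
  have B: "\<bar>Re (a k)\<bar> < B" "\<bar>Im (a k)\<bar> < B" if "k \<in> {1..p}" for k
  proof -
    have "norm (a k) \<le> (\<Sum>k=1..p. norm (a k))" using that by (intro member_le_sum) auto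
    then show "\<bar>Re (a k)\<bar> < B" "\<bar>Im (a k)\<bar> < B"
      using abs_Re_le_cmod[of "a k"] abs_Im_le_cmod[of "a k"] by (simp_all add: B_def)
  qed
  have "0 \<le> (\<Sum>k=1..p. norm (a k))" by (rule sum_nonneg) auto
  then have "encloses_poles p a (- B) B B"
    unfolding encloses_poles_def using B by (auto simp: B_def[symmetric] abs_less_iff) (auto simp: B_def)
  then have "((\<lambda>R. 1 / (2 * of_real pi * \<i>) * contour_integral (left_loop (- B) B B R) (integrand z)) \<longlongrightarrow> I) at_top"
    "((\<lambda>R. 1 / (2 * of_real pi * \<i>) * contour_integral (left_loop (- B) B B R) (integrand z)) \<longlongrightarrow> u (of_real z)) at_top"
    using I left_loop_limit[OF z] by blast+
  then show "I = u (of_real z)" by (intro tendsto_unique[of at_top]) auto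
qed

end

subsection \<open>The identities\<close>

text \<open>Two analytic representatives agree on a punctured neighbourhood, hence by continuity at
  the centre.\<close>

lemma continuation_eq:
  assumes "continues_to f w0 v"
  shows "continuation f w0 = v"
  unfolding continuation_def
proof (rule the_equality[of "continues_to f w0", OF assms])
  fix v' assume "continues_to f w0 v'"
  then obtain g where g: "g analytic_on {w0}" "\<forall>\<^sub>F w in at w0. g w = f w" "g w0 = v'" by (auto simp: continues_to_def)
  obtain h where h: "h analytic_on {w0}" "\<forall>\<^sub>F w in at w0. h w = f w" "h w0 = v" using assms by (auto simp: continues_to_def)
  have "(g \<longlongrightarrow> g w0) (at w0)" "(h \<longlongrightarrow> h w0) (at w0)"
    using g(1) h(1) analytic_at_imp_isCont isCont_def by blast+
  moreover have "\<forall>\<^sub>F w in at w0. g w = h w" using g(2) h(2) by eventually_elim simp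
  ultimately have "(h \<longlongrightarrow> g w0) (at w0)" "(h \<longlongrightarrow> h w0) (at w0)" by (auto intro: Lim_transform_eventually)
  then show "v' = v" using tendsto_unique[of "at w0"] g(3) h(3) by auto
qed

section \<open>Change of the exponent at z = 0 from 0 to a_k\<close>

lemma binom_fps_mult_inverse: "binom_fps c * binom_fps (- c) = 1"
proof -
  have "binom_fps c * binom_fps (- c) - 1 = 0"
  proof (rule fps_eq_0_if_eval_0[of 1])
    show "ereal 1 \<le> fps_conv_radius (binom_fps c * binom_fps (- c) - 1)"
      using on_disc_diff[OF on_disc_mult[OF on_disc_binom_fps on_disc_binom_fps] on_disc_1] by (simp add: on_disc_def one_ereal_def)
    fix x :: complex assume x: "x \<noteq> 0" "norm x < 1"
    then have "1 - x \<noteq> 0" by auto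
    then show "eval_fps (binom_fps c * binom_fps (- c) - 1) x = 0"
      using x eval_binom_fps[of "1 - x" c] eval_binom_fps[of "1 - x" "- c"] by (simp add: powr_minus)
  qed simp
  then show ?thesis by simp
qed

text \<open>The coefficients after division of the series by \<open>z powr c\<close>. The pochhammer
  factor converts 1 / Gamma(psi + n - i) into 1 / Gamma(psi + n), so the formula is polynomial in
  psi and survives at nonpositive integers.\<close>

definition twist :: "complex \<Rightarrow> complex \<Rightarrow> (nat \<Rightarrow> complex) \<Rightarrow> nat \<Rightarrow> complex" where
  "twist c \<psi> g n = (\<Sum>i=0..n. fps_nth (binom_fps (- c)) i * pochhammer (\<psi> + of_nat (n - i)) i * g (n - i))"

lemma gamma_fps_twist: "gamma_fps (twist c \<psi> g) \<psi> = binom_fps (- c) * gamma_fps g \<psi>"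
proof (rule fps_ext)
  fix n
  have r: "rGamma (\<psi> + of_nat (n - i)) = pochhammer (\<psi> + of_nat (n - i)) i * rGamma (\<psi> + of_nat n)" if "i \<le> n" for i
    using pochhammer_rGamma[of "\<psi> + of_nat (n - i)" i] that by (simp add: of_nat_diff)
  have "fps_nth (binom_fps (- c) * gamma_fps g \<psi>) n = (\<Sum>i=0..n. fps_nth (binom_fps (- c)) i * (g (n - i) * rGamma (\<psi> + of_nat (n - i))))"
    by (simp add: fps_mult_nth gamma_fps_def)
  also have "\<dots> = (\<Sum>i=0..n. fps_nth (binom_fps (- c)) i * pochhammer (\<psi> + of_nat (n - i)) i * g (n - i) * rGamma (\<psi> + of_nat n))"
  proof (intro sum.cong refl)
    fix i assume "i \<in> {0..n}"
    then have "i \<le> n" by simp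
    then show "fps_nth (binom_fps (- c)) i * (g (n - i) * rGamma (\<psi> + of_nat (n - i))) =
      fps_nth (binom_fps (- c)) i * pochhammer (\<psi> + of_nat (n - i)) i * g (n - i) * rGamma (\<psi> + of_nat n)"
      by (simp only: r mult_ac)
  qed
  finally show "fps_nth (gamma_fps (twist c \<psi> g) \<psi>) n = fps_nth (binom_fps (- c) * gamma_fps g \<psi>) n"
    by (simp add: gamma_fps_def twist_def sum_distrib_right)
qed

lemma pochhammer_nonzero: "x \<notin> \<int>\<^sub>\<le>\<^sub>0 \<Longrightarrow> pochhammer x n \<noteq> (0 :: complex)"
  by (auto simp: pochhammer_eq_0_iff)

lemma gamma_fps_nth:
  assumes "\<psi> \<notin> \<int>\<^sub>\<le>\<^sub>0"
  shows "g n / pochhammer \<psi> n = Gamma \<psi> * fps_nth (gamma_fps g \<psi>) n"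
proof -
  have "rGamma \<psi> = pochhammer \<psi> n * rGamma (\<psi> + of_nat n)" by (rule pochhammer_rGamma)
  moreover have "rGamma \<psi> \<noteq> 0" using assms by (simp add: rGamma_eq_zero_iff)
  ultimately show ?thesis using pochhammer_nonzero[OF assms, of n]
    by (simp add: gamma_fps_def Gamma_def inverse_eq_divide field_simps)
qed

text \<open>The sum over j is the Cauchy product with the series of \<open>z powr c\<close>, which
  undoes the twist; the result is therefore independent of \<open>c\<close>.\<close>

lemma sum_twist:
  assumes "\<psi> \<notin> \<int>\<^sub>\<le>\<^sub>0"
  shows "(\<Sum>j=0..m. (- 1) ^ j / (pochhammer \<psi> (m - j) * fact j) * (falling c j * twist c \<psi> g (m - j))) =
    Gamma \<psi> * fps_nth (gamma_fps g \<psi>) m"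
proof -
  have "(\<Sum>j=0..m. (- 1) ^ j / (pochhammer \<psi> (m - j) * fact j) * (falling c j * twist c \<psi> g (m - j))) =
     (\<Sum>j=0..m. fps_nth (binom_fps c) j * (twist c \<psi> g (m - j) / pochhammer \<psi> (m - j)))"
    by (intro sum.cong) (auto simp: binom_fps_nth mult_ac)
  also have "\<dots> = Gamma \<psi> * fps_nth (binom_fps c * gamma_fps (twist c \<psi> g) \<psi>) m"
    by (simp add: gamma_fps_nth[OF assms] fps_mult_nth sum_distrib_left mult_ac)
  also have "binom_fps c * gamma_fps (twist c \<psi> g) \<psi> = gamma_fps g \<psi>"
    unfolding gamma_fps_twist mult.assoc[symmetric] binom_fps_mult_inverse by simp
  finally show ?thesis .
qed

context hypergeo
begin

lemma norlund_g0_eq: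
  assumes psi: "psi p a b \<notin> \<int>\<^sub>\<le>\<^sub>0" and g: "expands p a b g"
  shows "norlund_g0 p a b k = twist (a k) (psi p a b) g"
  unfolding norlund_g0_def
proof (rule the_equality)
  let ?\<psi> = "psi p a b" and ?t = "twist (a k) (psi p a b) g"
  have ps: "on_disc (gamma_fps g ?\<psi>)" using g by (simp add: expands_def)
  then have pst: "on_disc (gamma_fps ?t ?\<psi>)" unfolding gamma_fps_twist by auto
  have G0: "Gamma ?\<psi> \<noteq> 0" using psi by (simp add: Gamma_eq_zero_iff)
  have sums: "(\<lambda>n. ?t n / pochhammer ?\<psi> n * of_real x ^ n) sums (Gamma ?\<psi> * eval_fps (gamma_fps ?t ?\<psi>) (of_real x))"
    if "0 < x" "x < 1" for x :: real
    unfolding gamma_fps_nth[OF psi] mult.assoc using that by (intro sums_mult on_disc_sums pst) auto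
  have eq: "meijer_G p a b z = of_real z powr a k * of_real (1 - z) powr (?\<psi> - 1) / Gamma ?\<psi> * (Gamma ?\<psi> * eval_fps (gamma_fps ?t ?\<psi>) (of_real (1 - z)))"
    if z: "0 < z" "z < 1" for z :: real
  proof -
    have zl: "complex_of_real z \<in> lens" using z by simp
    note zz = lensD[OF zl]
    have "u (of_real z) = (1 - of_real z) powr (?\<psi> - 1) * eval_fps (gamma_fps g ?\<psi>) (1 - of_real z)"
      using g zl by (simp add: expands_def)
    moreover have "eval_fps (gamma_fps ?t ?\<psi>) (1 - of_real z) = of_real z powr (- a k) * eval_fps (gamma_fps g ?\<psi>) (1 - of_real z)"
      unfolding gamma_fps_twist using ps zz by (simp add: eval_binom_fps)
    ultimately show ?thesis unfolding meijer_G_eq[OF z] using G0 zz by (simp add: powr_minus)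
  qed
  show "norlund_expansion p a b k ?t"
    unfolding norlund_expansion_def
  proof (intro allI impI)
    fix z :: real assume "0 < z \<and> z < 1"
    then have "0 < z" "z < 1" "0 < 1 - z" "1 - z < 1" by auto
    then show "summable (\<lambda>n. ?t n / pochhammer ?\<psi> n * of_real (1 - z) ^ n) \<and>
        meijer_G p a b z = of_real z powr a k * of_real (1 - z) powr (?\<psi> - 1) / Gamma ?\<psi> *
          (\<Sum>n. ?t n / pochhammer ?\<psi> n * of_real (1 - z) ^ n)"
      using sums[of "1 - z"] eq[of z] by (simp add: sums_iff)
  qed
  fix t' assume t': "norlund_expansion p a b k t'"
  define D where "D = Abs_fps (\<lambda>n. t' n / pochhammer ?\<psi> n) - Abs_fps (\<lambda>n. ?t n / pochhammer ?\<psi> n)"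
  have D: "summable (\<lambda>n. fps_nth D n * of_real x ^ n) \<and> eval_fps D (of_real x) = 0" if x: "0 < x" "x < 1" for x :: real
  proof -
    have x': "0 < 1 - x" "1 - x < 1" using x by auto
    have 1: "summable (\<lambda>n. t' n / pochhammer ?\<psi> n * of_real x ^ n)"
      "meijer_G p a b (1 - x) = of_real (1 - x) powr a k * of_real x powr (?\<psi> - 1) / Gamma ?\<psi> * (\<Sum>n. t' n / pochhammer ?\<psi> n * of_real x ^ n)"
      using t'[unfolded norlund_expansion_def, rule_format, of "1 - x"] x' by auto
    have 2: "meijer_G p a b (1 - x) = of_real (1 - x) powr a k * of_real x powr (?\<psi> - 1) / Gamma ?\<psi> * (\<Sum>n. ?t n / pochhammer ?\<psi> n * of_real x ^ n)"
      using eq[OF x'] sums[OF x] by (simp add: sums_iff)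
    have nz: "of_real (1 - x) powr a k * of_real x powr (?\<psi> - 1) / Gamma ?\<psi> \<noteq> 0" using x G0 by simp
    have 3: "(\<Sum>n. t' n / pochhammer ?\<psi> n * of_real x ^ n) = (\<Sum>n. ?t n / pochhammer ?\<psi> n * of_real x ^ n)"
      using mult_left_cancel[OF nz, THEN iffD1, OF trans[OF sym[OF 1(2)] 2]] .
    have "(\<lambda>n. t' n / pochhammer ?\<psi> n * of_real x ^ n - ?t n / pochhammer ?\<psi> n * of_real x ^ n) sums 0"
      using sums_diff[OF summable_sums[OF 1(1)] summable_sums[OF sums_summable[OF sums[OF x]]]] 3 by simp
    then have "(\<lambda>n. fps_nth D n * of_real x ^ n) sums 0" by (simp add: D_def left_diff_distrib)
    then show ?thesis by (simp add: sums_iff eval_fps_def)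
  qed
  \<comment> \<open>A single summand with exponent 0 is the case of an ordinary power series that
    vanishes on an interval.\<close>
  have "D = 0"
  proof (rule generalized_power_series_unique[where I = "{0::nat}" and e = "\<lambda>_. 0" and H = "\<lambda>_. D" and k = 0])
    show "fps_conv_radius D > 0"
      using conv_radius_pos_if_summable[of "fps_nth D" "1/2"] D[of "1/2"] by (simp add: fps_nth_inverse)
    show "\<forall>\<^sub>F x::real in at_right 0. (\<Sum>i\<in>{0::nat}. of_real x powr 0 * eval_fps D (of_real x)) = 0"
      unfolding eventually_at_right_field using D by (intro exI[of _ 1]) auto
  qed auto
  show "t' = ?t"
  proof
    fix n
    have "fps_nth D n = 0" using \<open>D = 0\<close> by simp
    then show "t' n = ?t n" using pochhammer_nonzero[OF psi, of n] by (simp add: D_def)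
  qed
qed

section \<open>Limits in b_1 and the two identities\<close>

lemma upd_self [simp]: "upd (b 1) = b" "upd (b (Suc 0)) = b"
  by (simp_all add: upd_def)

lemma eventually_psi_upd_not_Ints:
  assumes "psi p a b \<in> \<int>"
  shows "\<forall>\<^sub>F w in at (b 1). psi p a (upd w) \<notin> \<int>"
  unfolding eventually_at
proof (intro exI[of _ 1] conjI ballI impI)
  fix w assume w: "w \<noteq> b 1 \<and> dist w (b 1) < 1"
  show "psi p a (upd w) \<notin> \<int>"
  proof
    assume "psi p a (upd w) \<in> \<int>"
    then have "w - b 1 \<in> \<int>" using assms unfolding psi_upd by (metis Ints_diff add_diff_cancel_left')
    then obtain n where "w - b 1 = of_int n" by (elim Ints_cases)
    then have "norm (of_int n :: complex) < 1" "n \<noteq> 0" using w by (auto simp: dist_norm)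
    then show False by (simp only: norm_of_int)
  qed
qed simp

lemma tendsto_sine_ratio: "((\<lambda>w. sine_ratio p a (upd w) k) \<longlongrightarrow> sine_ratio p a b k) (at (b 1))"
proof -
  have "((\<lambda>w. upd w i) \<longlongrightarrow> b i) (at (b 1))" for i by (cases "i = 1") (auto simp: upd_def)
  then have "((\<lambda>w. (\<Prod>i=1..p. sin (of_real pi * (upd w i - a k))) * inverse (\<Prod>i\<in>{1..p} - {k}. sin (of_real pi * (a i - a k)))) \<longlongrightarrow>
     (\<Prod>i=1..p. sin (of_real pi * (b i - a k))) * inverse (\<Prod>i\<in>{1..p} - {k}. sin (of_real pi * (a i - a k)))) (at (b 1))"
    by (intro tendsto_mult_right tendsto_prod tendsto_sin tendsto_mult_left tendsto_diff tendsto_const)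
  then show ?thesis by (simp add: sine_ratio_def divide_inverse)
qed

lemma tendsto_psi_upd: "((\<lambda>w. psi p a (upd w)) \<longlongrightarrow> psi p a b) (at (b 1))"
  unfolding psi_upd by (auto intro!: tendsto_eq_intros)

lemma tendsto_pochhammer:
  "((\<lambda>w. pochhammer (psi p a (upd w)) n) \<longlongrightarrow> pochhammer (psi p a b) n) (at (b 1))"
  unfolding pochhammer_prod by (intro tendsto_prod tendsto_add tendsto_psi_upd tendsto_const)

text \<open>For regular psi_p all sums over j have the common value \<open>C\<close>, and its factor
  vanishes by \<open>sum_sine_ratio\<close>. For the other values \<open>L\<close> is passed to the
  limit along \<open>w\<close>, where psi_p is not an integer.\<close>

lemma norlund_identity:
  assumes poch: "\<And>n. n \<le> m \<Longrightarrow> pochhammer (psi p a b) n \<noteq> 0" and s: "s \<in> {1..p}"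
  shows "(\<Sum>j=0..m. (- 1) ^ j / (pochhammer (psi p a b) (m - j) * fact j) *
              (falling (a s) j * norlund_g p a b s (m - j) * sin (of_real pi * psi p a b) -
               (\<Sum>k=1..p. falling (a k) j * norlund_g p a b k (m - j) * sine_ratio p a b k))) = 0"
proof -
  obtain M :: nat where M: "real M > real p + 1 - Re (psi p a b)" using reals_Archimedean2 by blast
  define S where "S = {w. Re (psi p a (upd w)) > real p + 1 - real M}"
  obtain g where g: "\<And>n. g n holomorphic_on S" "\<And>w. w \<in> S \<Longrightarrow> expands p a (upd w) (\<lambda>n. g n w)"
    using expands_upd[of M] unfolding S_def by blast
  have bS: "b 1 \<in> S" using M by (simp add: S_def)
  have opS: "open S"
    unfolding S_def psi_upd by (intro open_Collect_less continuous_intros)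
  define gk where "gk k n w = twist (a k) (psi p a (upd w)) (\<lambda>n. g n w) n" for k n w
  have hol: "gk k n holomorphic_on S" for k n
    unfolding gk_def[abs_def] twist_def psi_upd pochhammer_prod by (intro holomorphic_intros g(1))
  have lim: "(gk k n \<longlongrightarrow> gk k n (b 1)) (at (b 1))" for k n
    using holomorphic_on_imp_continuous_on[OF hol] opS bS by (simp add: continuous_on_eq_continuous_at isCont_def)
  have g0: "norlund_g0 p a (upd w) k n = gk k n w" if "w \<in> S" "psi p a (upd w) \<notin> \<int>\<^sub>\<le>\<^sub>0" for w k n
    unfolding gk_def using hypergeo.norlund_g0_eq[OF hypergeo_axioms that(2) g(2)[OF that(1)]] by simp
  have evS: "eventually (\<lambda>w. w \<in> S) (at (b 1))" using opS bS by (rule eventually_at_in_open')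
  define L where "L w = (\<Sum>j=0..m. (- 1) ^ j / (pochhammer (psi p a (upd w)) (m - j) * fact j) *
              (falling (a s) j * gk s (m - j) w * sin (of_real pi * psi p a (upd w)) -
               (\<Sum>k=1..p. falling (a k) j * gk k (m - j) w * sine_ratio p a (upd w) k)))" for w
  have L0: "L w = 0" if w: "w \<in> S" "psi p a (upd w) \<notin> \<int>\<^sub>\<le>\<^sub>0" for w
  proof -
    let ?\<psi> = "psi p a (upd w)"
    define C where "C = Gamma ?\<psi> * fps_nth (gamma_fps (\<lambda>n. g n w) ?\<psi>) m"
    have C: "(\<Sum>j=0..m. (- 1) ^ j / (pochhammer ?\<psi> (m - j) * fact j) * (falling (a k) j * gk k (m - j) w)) = C" for k
      unfolding gk_def C_def by (rule sum_twist[OF w(2)])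
    have "L w = (\<Sum>j=0..m. (- 1) ^ j / (pochhammer ?\<psi> (m - j) * fact j) * (falling (a s) j * gk s (m - j) w)) * sin (of_real pi * ?\<psi>)
      - (\<Sum>k=1..p. (\<Sum>j=0..m. (- 1) ^ j / (pochhammer ?\<psi> (m - j) * fact j) * (falling (a k) j * gk k (m - j) w)) * sine_ratio p a (upd w) k)"
      unfolding L_def right_diff_distrib sum_subtractf sum_distrib_left sum_distrib_right
      by (subst sum.swap) (simp add: mult_ac)
    also have "\<dots> = C * (sin (of_real pi * ?\<psi>) - (\<Sum>k=1..p. sine_ratio p a (upd w) k))"
      unfolding C by (simp add: right_diff_distrib sum_distrib_left)
    also have "\<dots> = 0" using sum_sine_ratio[OF p_pos a_diff, where b = "upd w"] by simp
    finally show ?thesis .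
  qed
  have gk: "norlund_g p a b k n = gk k n (b 1)" for k n
  proof (cases "psi p a b \<in> \<int>\<^sub>\<le>\<^sub>0")
    case False
    then show ?thesis using g0[OF bS] by (simp add: norlund_g_def)
  next
    case True
    then have "psi p a b \<in> \<int>" by (rule nonpos_Ints_Int)
    have "continues_to (\<lambda>w. norlund_g0 p a (upd w) k n) (b 1) (gk k n (b 1))"
      unfolding continues_to_def
    proof (intro exI[of _ "gk k n"] conjI refl)
      show "gk k n analytic_on {b 1}" using hol opS bS by (auto simp: analytic_at)
      show "\<forall>\<^sub>F w in at (b 1). gk k n w = norlund_g0 p a (upd w) k n"
        using eventually_psi_upd_not_Ints[OF \<open>psi p a b \<in> \<int>\<close>] evS
      proof eventually_elim
        case (elim w)
        then have "psi p a (upd w) \<notin> \<int>\<^sub>\<le>\<^sub>0" using nonpos_Ints_Int by blast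
        then show ?case using g0 elim by simp
      qed
    qed
    from continuation_eq[OF this] show ?thesis using True by (simp add: norlund_g_def upd_def)
  qed
  have "L (b 1) = 0"
  proof (cases "psi p a b \<in> \<int>\<^sub>\<le>\<^sub>0")
    case False
    then show ?thesis using L0[OF bS] by simp
  next
    case True
    then have "psi p a b \<in> \<int>" by (rule nonpos_Ints_Int)
    \<comment> \<open>The expansion degenerates at this psi_p, so \<open>L0\<close> does not apply
      here; \<open>poch\<close> keeps the denominators of the finitely many terms away from 0, which
      makes \<open>L\<close> continuous.\<close>
    have "(L \<longlongrightarrow> L (b 1)) (at (b 1))"
      unfolding L_def[abs_def] upd_self
      by (intro tendsto_sum tendsto_mult tendsto_diff tendsto_divide tendsto_const tendsto_sin tendsto_sine_ratio
          tendsto_psi_upd lim tendsto_pochhammer) (use poch in simp)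
    moreover have "(L \<longlongrightarrow> 0) (at (b 1))"
    proof (rule Lim_transform_eventually[OF tendsto_const])
      show "\<forall>\<^sub>F w in at (b 1). 0 = L w"
        using eventually_psi_upd_not_Ints[OF \<open>psi p a b \<in> \<int>\<close>] evS
      proof eventually_elim
        case (elim w)
        then have "psi p a (upd w) \<notin> \<int>\<^sub>\<le>\<^sub>0" using nonpos_Ints_Int by blast
        then show ?case using L0 elim by simp
      qed
    qed
    ultimately show ?thesis by (rule tendsto_unique[rotated]) simp
  qed
  then show ?thesis by (simp add: L_def gk)
qed

text \<open>Euler's reflection formula in both products: p reciprocal factors against p - 1 gamma
  factors leave a single 1 / pi. This links the residues of Meijer's integral with Buehring's
  normalisation.\<close>

lemma res_coeff_eq_sine_ratio:
  assumes k: "k \<in> {1..p}" and b: "\<And>i. i \<in> {1..p} \<Longrightarrow> 1 - b i + a k \<notin> \<int>\<^sub>\<le>\<^sub>0"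
  shows "res_coeff k = sine_ratio p a b k / of_real pi *
    ((\<Prod>i=1..p. Gamma (1 - b i + a k)) / (\<Prod>i\<in>{1..p} - {k}. Gamma (1 - a i + a k)))"
proof -
  let ?I = "{1..p} - {k}"
  have "rGamma (b i - a k) = sin (of_real pi * (b i - a k)) * Gamma (1 - b i + a k) / of_real pi" if i: "i \<in> {1..p}" for i
  proof -
    have "rGamma (b i - a k) * rGamma (1 - (b i - a k)) = sin (of_real pi * (b i - a k)) / of_real pi"
      by (rule rGamma_reflection_complex)
    moreover have "1 - (b i - a k) = 1 - b i + a k" by simp
    moreover have "rGamma (1 - b i + a k) \<noteq> 0" using b[OF i] by (simp add: rGamma_eq_zero_iff)
    ultimately show ?thesis by (simp add: Gamma_def inverse_eq_divide field_simps)
  qed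
  then have 1: "(\<Prod>i=1..p. rGamma (b i - a k)) =
     (\<Prod>i=1..p. sin (of_real pi * (b i - a k))) * (\<Prod>i=1..p. Gamma (1 - b i + a k)) / of_real pi ^ p"
    by (simp add: prod_dividef prod.distrib)
  have "Gamma (a i - a k) = of_real pi / (sin (of_real pi * (a i - a k)) * Gamma (1 - a i + a k))" if i: "i \<in> ?I" for i
  proof -
    have "Gamma (a i - a k) * Gamma (1 - (a i - a k)) = of_real pi / sin (of_real pi * (a i - a k))"
      by (rule Gamma_reflection_complex)
    moreover have "1 - (a i - a k) = 1 - a i + a k" by simp
    moreover have "Gamma (1 - a i + a k) \<noteq> 0"
    proof -
      have "1 - a i + a k \<notin> \<int>\<^sub>\<le>\<^sub>0"
      proof
        assume "1 - a i + a k \<in> \<int>\<^sub>\<le>\<^sub>0"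
        then obtain n where "1 - a i + a k = - of_nat n" by (elim nonpos_Ints_cases')
        then show False using a_add_nat_not_0[of i k n] i k by simp
      qed
      then show ?thesis by (simp add: Gamma_eq_zero_iff)
    qed
    moreover have "x = q / (s * y)" if "x * y = q / s" "y \<noteq> 0" for x y q s :: complex
      using that by (metis divide_divide_eq_left nonzero_mult_div_cancel_right)
    ultimately show ?thesis by (simp only:)
  qed
  then have 2: "(\<Prod>i\<in>?I. Gamma (a i - a k)) =
     of_real pi ^ (p - 1) / ((\<Prod>i\<in>?I. sin (of_real pi * (a i - a k))) * (\<Prod>i\<in>?I. Gamma (1 - a i + a k)))"
    using k by (simp add: prod_dividef prod.distrib card_Diff_singleton)
  have "of_real pi ^ p = of_real pi * (of_real pi ^ (p - 1) :: complex)" using p_pos by (cases p) auto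
  then show ?thesis unfolding res_coeff_def 1 2 sine_ratio_def by simp
qed

text \<open>By \<open>res_coeff_eq_sine_ratio\<close> the combination of the functions
  \<open>z powr a k * buhring_function p a b k z\<close> with the sine ratios is pi times
  \<open>u\<close>. Its holomorphic part at z = 1 is \<open>H\<close>, and the identity is the
  vanishing of coefficient \<open>m\<close> of \<open>H\<close>.\<close>

lemma buhring_identity_generic:
  assumes psi: "psi p a b \<notin> \<int>" and b: "\<And>i k. i \<in> {1..p} \<Longrightarrow> k \<in> {1..p} \<Longrightarrow> 1 - b i + a k \<notin> \<int>\<^sub>\<le>\<^sub>0"
  shows "(\<Sum>j=0..m. (- 1) ^ j / fact j *
              (\<Sum>k=1..p. falling (a k) j * buhring_h0 p a b k (m - j) * sine_ratio p a b k)) = 0"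
proof -
  let ?\<psi> = "psi p a b"
  obtain M :: nat where M: "real M > real p + 1 - Re ?\<psi>" using reals_Archimedean2 by blast
  obtain g where "expands p a (upd (b 1)) g"
    using expands_upd[of M] M by (metis (no_types, lifting) diff_less_eq add.commute less_diff_eq upd_self)
  then have V: "on_disc (gamma_fps g ?\<psi>)" "\<And>z. z \<in> lens \<Longrightarrow> u z = (1 - z) powr (?\<psi> - 1) * eval_fps (gamma_fps g ?\<psi>) (1 - z)"
    by (auto simp: expands_def)
  define V where "V = gamma_fps g ?\<psi>"
  have "\<exists>f h. \<forall>k\<in>{1..p}. on_disc (f k) \<and> on_disc (h k) \<and> buhring_h0 p a b k = fps_nth (h k) \<and>
    (\<forall>z\<in>lens. buhring_function p a b k z = (1 - z) powr (?\<psi> - 1) * eval_fps (f k) (1 - z) + eval_fps (h k) (1 - z))"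
    using buhring_h0_expansion[OF psi] by metis
  then obtain f h where fh: "\<And>k. k \<in> {1..p} \<Longrightarrow> on_disc (f k)" "\<And>k. k \<in> {1..p} \<Longrightarrow> on_disc (h k)"
    "\<And>k. k \<in> {1..p} \<Longrightarrow> buhring_h0 p a b k = fps_nth (h k)"
    "\<And>k z. k \<in> {1..p} \<Longrightarrow> z \<in> lens \<Longrightarrow> buhring_function p a b k z = (1 - z) powr (?\<psi> - 1) * eval_fps (f k) (1 - z) + eval_fps (h k) (1 - z)"
    by blast
  define \<sigma> where "\<sigma> k = sine_ratio p a b k" for k
  define H where "H = (\<Sum>k=1..p. fps_const (\<sigma> k) * binom_fps (a k) * h k)"
  \<comment> \<open>Subtracting the series of pi times \<open>u\<close> leaves an expression that is
    identically 0, as \<open>two_term_unique\<close> requires.\<close>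
  define S where "S = (\<Sum>k=1..p. fps_const (\<sigma> k) * binom_fps (a k) * f k) - fps_const (of_real pi) * V"
  have psH: "on_disc H" unfolding H_def using fh by (intro on_disc_sum on_disc_mult) auto
  have psS1: "on_disc (\<Sum>k=1..p. fps_const (\<sigma> k) * binom_fps (a k) * f k)" using fh by (intro on_disc_sum on_disc_mult) auto
  have psV: "on_disc V" using V(1) by (simp add: V_def)
  have psS: "on_disc S" unfolding S_def using psS1 psV by (intro on_disc_diff on_disc_mult) auto
  have "H = 0"
  proof (rule two_term_unique(1)[of "?\<psi> - 1" H S])
    show "?\<psi> - 1 \<notin> \<int>" using psi by (metis Ints_1 Ints_add diff_add_cancel)
    show "fps_conv_radius H > 0" "fps_conv_radius S > 0" using on_disc_pos psH psS by auto
    show "\<forall>\<^sub>F x::real in at_right 0. of_real x powr (?\<psi> - 1) * eval_fps S (of_real x) + eval_fps H (of_real x) = 0"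
      unfolding eventually_at_right_field
    proof (intro exI[of _ 1] conjI allI impI)
      fix x :: real assume x: "0 < x" "x < 1"
      define z where "z = complex_of_real (1 - x)"
      have zl: "z \<in> lens" unfolding z_def by (subst of_real_lens) (use x in auto)
      note zz = lensD[OF zl]
      have xz: "of_real x = 1 - z" by (simp add: z_def)
      have "of_real pi * (res_coeff k * Y0 k 0 z) = \<sigma> k * z powr a k * ((1 - z) powr (?\<psi> - 1) * eval_fps (f k) (1 - z) + eval_fps (h k) (1 - z))"
        if k: "k \<in> {1..p}" for k
      proof -
        have "res_coeff k = sine_ratio p a b k / of_real pi *
          ((\<Prod>i=1..p. Gamma (1 - b i + a k)) / (\<Prod>i\<in>{1..p} - {k}. Gamma (1 - a i + a k)))"
          by (rule res_coeff_eq_sine_ratio[OF k]) (rule b[OF _ k])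
        then show ?thesis
          unfolding fh(4)[OF k zl, symmetric] buhring_function_eq[OF k] \<sigma>_def Y0_def by simp
      qed
      then have "of_real pi * u z = (\<Sum>k=1..p. \<sigma> k * z powr a k * ((1 - z) powr (?\<psi> - 1) * eval_fps (f k) (1 - z) + eval_fps (h k) (1 - z)))"
        unfolding u_def sum_distrib_left by (intro sum.cong) auto
      also have "\<dots> = (1 - z) powr (?\<psi> - 1) * (\<Sum>k=1..p. \<sigma> k * z powr a k * eval_fps (f k) (1 - z)) + (\<Sum>k=1..p. \<sigma> k * z powr a k * eval_fps (h k) (1 - z))"
        by (simp add: distrib_left sum.distrib sum_distrib_left mult_ac)
      also have "(\<Sum>k=1..p. \<sigma> k * z powr a k * eval_fps (h k) (1 - z)) = eval_fps H (1 - z)"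
        unfolding H_def using fh zz by (subst eval_disc_sum) (auto simp: eval_binom_fps intro!: on_disc_mult sum.cong)
      also have "(\<Sum>k=1..p. \<sigma> k * z powr a k * eval_fps (f k) (1 - z)) = eval_fps (\<Sum>k=1..p. fps_const (\<sigma> k) * binom_fps (a k) * f k) (1 - z)"
        using fh zz by (subst eval_disc_sum) (auto simp: eval_binom_fps intro!: on_disc_mult sum.cong)
      finally have "of_real pi * ((1 - z) powr (?\<psi> - 1) * eval_fps V (1 - z)) =
         (1 - z) powr (?\<psi> - 1) * eval_fps (\<Sum>k=1..p. fps_const (\<sigma> k) * binom_fps (a k) * f k) (1 - z) + eval_fps H (1 - z)"
        unfolding V(2)[OF zl] V_def .
      moreover have "eval_fps S (1 - z) = eval_fps (\<Sum>k=1..p. fps_const (\<sigma> k) * binom_fps (a k) * f k) (1 - z) - of_real pi * eval_fps V (1 - z)"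
        unfolding S_def using psS1 psV zz by (subst eval_disc_diff) auto
      moreover have "W * (t - q * v) + h = 0" if "q * (W * v) = W * t + h" for W t q v h :: complex
        using that by (simp add: algebra_simps)
      ultimately show "of_real x powr (?\<psi> - 1) * eval_fps S (of_real x) + eval_fps H (of_real x) = 0"
        unfolding xz by (simp only:)
    qed auto
  qed
  then have "fps_nth H m = 0" by simp
  moreover have "fps_nth H m = (\<Sum>k=1..p. \<Sum>j=0..m. \<sigma> k * (fps_nth (binom_fps (a k)) j * fps_nth (h k) (m - j)))"
    unfolding H_def by (simp add: fps_sum_nth mult.assoc fps_mult_nth[of "binom_fps _"] sum_distrib_left)
  moreover have "\<dots> = (\<Sum>k=1..p. \<Sum>j=0..m. (- 1) ^ j / fact j * (falling (a k) j * buhring_h0 p a b k (m - j) * sine_ratio p a b k))"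
    by (intro sum.cong refl) (auto simp: binom_fps_nth fh(3) \<sigma>_def)
  ultimately show ?thesis by (subst (asm) sum.swap) (simp add: sum_distrib_left)
qed

lemma buhring_identity:
  assumes "\<And>k n. k \<in> {1..p} \<Longrightarrow> n \<le> m \<Longrightarrow> buhring_h_defined p a b k n"
  shows "(\<Sum>j=0..m. (- 1) ^ j / fact j *
              (\<Sum>k=1..p. falling (a k) j * buhring_h p a b k (m - j) * sine_ratio p a b k)) = 0"
proof -
  have b: "1 - b i + a k \<notin> \<int>\<^sub>\<le>\<^sub>0" if "i \<in> {1..p}" "k \<in> {1..p}" for i k
    using assms[OF that(2), of 0] that(1) by (auto simp: buhring_h_defined_def)
  show ?thesis
  proof (cases "psi p a b \<in> \<int>")
    case False
    then show ?thesis using buhring_identity_generic[OF False b] by (simp add: buhring_h_def)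
  next
    case True
    \<comment> \<open>Fixing one analytic representative per \<open>k\<close> and \<open>n\<close>
      allows passing to the limit, since \<open>buhring_h0\<close> itself is specified only off the
      integer values of psi_p.\<close>
    define ok where "ok k n \<phi> \<longleftrightarrow> \<phi> analytic_on {b 1} \<and>
      (\<forall>\<^sub>F w in at (b 1). \<phi> w = buhring_h0 p a (upd w) k n) \<and> \<phi> (b 1) = buhring_h p a b k n" for k n \<phi>
    have "\<exists>\<phi>. ok k n \<phi>" if kn: "k \<in> {1..p}" "n \<le> m" for k n
    proof -
      obtain v where v: "continues_to (\<lambda>w. buhring_h0 p a (upd w) k n) (b 1) v"
        using assms[OF kn] True by (auto simp: buhring_h_defined_def upd_def)
      have "buhring_h p a b k n = v" using continuation_eq[OF v] True by (simp add: buhring_h_def upd_def)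
      then show ?thesis using v by (auto simp: continues_to_def ok_def)
    qed
    then obtain \<phi> where "\<And>k n. k \<in> {1..p} \<Longrightarrow> n \<le> m \<Longrightarrow> ok k n (\<phi> k n)" by metis
    then have \<phi>: "\<phi> k n analytic_on {b 1} \<and> (\<forall>\<^sub>F w in at (b 1). \<phi> k n w = buhring_h0 p a (upd w) k n) \<and>
      \<phi> k n (b 1) = buhring_h p a b k n" if "k \<in> {1..p}" "n \<le> m" for k n
      using that by (simp add: ok_def)
    define L where "L w = (\<Sum>j=0..m. (- 1) ^ j / fact j * (\<Sum>k=1..p. falling (a k) j * \<phi> k (m - j) w * sine_ratio p a (upd w) k))" for w
    have "(\<phi> k n \<longlongrightarrow> \<phi> k n (b 1)) (at (b 1))" if "k \<in> {1..p}" "n \<le> m" for k n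
      using analytic_at_imp_isCont[OF conjunct1[OF \<phi>[OF that]]] by (simp add: isCont_def)
    then have "(L \<longlongrightarrow> L (b 1)) (at (b 1))"
      unfolding L_def[abs_def] upd_self
      by (intro tendsto_sum tendsto_mult tendsto_const tendsto_sine_ratio) auto
    moreover have "(L \<longlongrightarrow> 0) (at (b 1))"
    proof (rule Lim_transform_eventually[OF tendsto_const])
      have "\<forall>\<^sub>F w in at (b 1). \<forall>k\<in>{1..p}. \<forall>n\<in>{..m}. \<phi> k n w = buhring_h0 p a (upd w) k n"
        using \<phi> by (intro eventually_ball_finite ballI) auto
      \<comment> \<open>The generic identity is applied at \<open>upd w\<close>, so finiteness of
        the gamma factors must persist near \<open>b 1\<close>; it does because the nonpositive
        integers form a closed set.\<close>
      moreover have "\<forall>\<^sub>F w in at (b 1). \<forall>k\<in>{1..p}. 1 - w + a k \<notin> \<int>\<^sub>\<le>\<^sub>0"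
      proof (intro eventually_ball_finite ballI)
        fix k assume k: "k \<in> {1..p}"
        have "closed (\<int>\<^sub>\<le>\<^sub>0 :: complex set)" by (rule closed_subset_Ints) (auto simp: nonpos_Ints_Int)
        then have "open ((\<lambda>w. 1 - w + a k) -` (- \<int>\<^sub>\<le>\<^sub>0))"
          by (intro open_vimage) (auto intro!: continuous_intros)
        moreover have "b 1 \<in> (\<lambda>w. 1 - w + a k) -` (- \<int>\<^sub>\<le>\<^sub>0)" using b[of 1 k] k p_pos by simp
        ultimately have "\<forall>\<^sub>F w in at (b 1). w \<in> (\<lambda>w. 1 - w + a k) -` (- \<int>\<^sub>\<le>\<^sub>0)" by (rule eventually_at_in_open')
        then show "\<forall>\<^sub>F w in at (b 1). 1 - w + a k \<notin> \<int>\<^sub>\<le>\<^sub>0" by eventually_elim auto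
      qed simp
      ultimately show "\<forall>\<^sub>F w in at (b 1). 0 = L w"
        using eventually_psi_upd_not_Ints[OF True]
      proof eventually_elim
        case (elim w)
        have "1 - upd w i + a k \<notin> \<int>\<^sub>\<le>\<^sub>0" if "i \<in> {1..p}" "k \<in> {1..p}" for i k
          using b[OF that] elim(2) that by (auto simp: upd_def)
        from hypergeo.buhring_identity_generic[OF hypergeo_axioms elim(3) this, of m]
        have "(\<Sum>j=0..m. (- 1) ^ j / fact j * (\<Sum>k=1..p. falling (a k) j * buhring_h0 p a (upd w) k (m - j) * sine_ratio p a (upd w) k)) = 0" .
        moreover have "(\<Sum>k=1..p. falling (a k) j * \<phi> k (m - j) w * sine_ratio p a (upd w) k) =
            (\<Sum>k=1..p. falling (a k) j * buhring_h0 p a (upd w) k (m - j) * sine_ratio p a (upd w) k)" for j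
          using elim(1) by (intro sum.cong refl) simp
        ultimately show ?case by (simp only: L_def)
      qed
    qed
    ultimately have "L (b 1) = 0" by (rule tendsto_unique[rotated]) simp
    moreover have "(\<Sum>k=1..p. falling (a k) j * \<phi> k (m - j) (b 1) * sine_ratio p a b k) =
        (\<Sum>k=1..p. falling (a k) j * buhring_h p a b k (m - j) * sine_ratio p a b k)" for j
      using \<phi> by (intro sum.cong refl) simp
    ultimately show ?thesis by (simp only: L_def upd_self)
  qed
qed

end

theorem theorem3p5:
  fixes p m :: nat and a b :: "nat \<Rightarrow> complex"
  assumes p_pos: "p \<ge> 1"
    and a_diff: "\<And>i j. \<lbrakk>i \<in> {1..p}; j \<in> {1..p}; i \<noteq> j\<rbrakk> \<Longrightarrow> a i - a j \<notin> \<int>"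
  shows "((\<forall>k\<in>{1..p}. \<forall>n\<le>m. buhring_h_defined p a b k n) \<longrightarrow>
           (\<Sum>j=0..m. (- 1) ^ j / fact j *
              (\<Sum>k=1..p. falling (a k) j * buhring_h p a b k (m - j) * sine_ratio p a b k)) = 0)
       \<and> (\<forall>s\<in>{1..p}. (\<forall>n\<le>m. pochhammer (psi p a b) n \<noteq> 0) \<longrightarrow>
           (\<Sum>j=0..m. (- 1) ^ j / (pochhammer (psi p a b) (m - j) * fact j) *
              (falling (a s) j * norlund_g p a b s (m - j) * sin (of_real pi * psi p a b) -
               (\<Sum>k=1..p. falling (a k) j * norlund_g p a b k (m - j) * sine_ratio p a b k))) = 0)"
proof -
  interpret hypergeo p a b by unfold_locales (use assms in auto)
  show ?thesis using buhring_identity norlund_identity by blast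
qed

end
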